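(* Let $\Omega\subset\mathbb{R}^d$ be convex and compact with non-empty interior, and let $\mathcal{H}$ be equal to the (fractional) Sobolev space $H^m=H^m(\Omega)$ with equivalent norms. Let $\alpha\in\mathbb{N}^d$ be a multi-index and suppose $m>d/2+|\alpha|$. Suppose the design satisfies the norm-comparison property and $n^{-2m/d}\lesssim\lambda\le1$. In addition, suppose the random error satisfies $\mathbb{E}\exp\{\vartheta e_1\}\le\exp\{\vartheta^2\varsigma^2/2\}$ for all $\vartheta\in\mathbb{R}$ and some $\varsigma^2>0$. Then $$\sup_{x\in\Omega}\big|D^\alpha\hat f(x)-\mathbb{E}_ED^\alpha\hat f(x)\big|=O_{\mathbb P}\left(\varsigma\,n^{-\frac12}\lambda^{-\frac{d+2|\alpha|}{4m}}\sqrt{\log\Big(\frac{C}{\lambda}\Big)}\right)$$ for some $C>1$ independent of $\varsigma^2$, $\lambda$ and $n$.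
   Context: Setting: $K$ is a reproducing kernel on $\Omega\subset\mathbb{R}^d$ with reproducing kernel Hilbert space $\mathcal{H}$ (norm $\|\cdot\|_{\mathcal H}$). For each $n$ there are design points $x_1,\dots,x_n\in\Omega$ (deterministic or random, may depend on $n$) and data $y_i=f(x_i)+e_i$, with $f\in\mathcal{H}$ and $e_1,e_2,\dots$ i.i.d. with mean zero and finite variance $\sigma^2$; the errors are independent of the design. Write $X=(x_1,\dots,x_n)^T$, $E=(e_1,\dots,e_n)^T$. The smoothing parameter $\lambda=\lambda_n>0$ is deterministic and may depend on $n$. Asymptotics are as $n\to\infty$. The kernel ridge regression (KRR) estimator is $\hat f=\operatorname{argmin}_{v\in\mathcal{H}}\frac1n\sum_{i=1}^n(y_i-v(x_i))^2+\lambda\|v\|_{\mathcal{H}}^2$. $D^\alpha$ is the partial derivative with multi-index $\alpha$, of total order $|\alpha|$. $\mathbb{E}_E$ is expectation with respect to $E$ only ($X$ held fixed). Also $\|v\|_n^2=\frac1n\sum_{i=1}^n v(x_i)^2$, and $\|\cdot\|_{L_2}$ is the $L_2(\Omega)$ norm. $a_n\lesssim b_n$ means $a_n/b_n$ is bounded (in probability). Norm-comparison property of the design: $X$, if random, is independent of $E$; and there is $C_1>0$, and for each $\epsilon>0$ a $C_\epsilon>0$, all independent of $n$ and $X$, such that $\mathbb{P}(\Xi_\epsilon)\ge1-\epsilon$, where $\Xi_\epsilon$ is the event that, for all $v\in\mathcal H$, $\|v\|_{L_2}\le\max\{C_1\|v\|_n,C_\epsilon n^{-m/d}\|v\|_{\mathcal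 H}\}$ and $\|v\|_n\le\max\{C_1\|v\|_{L_2},C_\epsilon n^{-m/d}\|v\|_{\mathcal H}\}$ (for deterministic $X$ these inequalities hold unconditionally). *)

theory Defs
  imports "HOL-Probability.Probability" "HOL-Library.Landau_Symbols"
begin

section \<open>Reproducing kernel Hilbert spaces\<close>

text \<open>
  A function on \<open>\<Omega>\<close> is represented by its extension by zero to the whole space, so that two
  elements of \<open>H\<close> are equal iff they agree on \<open>\<Omega>\<close>.
\<close>

locale rkhs =
  fixes \<Omega> :: "'a set" and K :: "'a \<Rightarrow> 'a \<Rightarrow> real"
    and H :: "('a \<Rightarrow> real) set" and ip :: "('a \<Rightarrow> real) \<Rightarrow> ('a \<Rightarrow> real) \<Rightarrow> real"
  assumes supp: "\<lbrakk>v \<in> H; x \<notin> \<Omega>\<rbrakk> \<Longrightarrow> v x = 0"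
    and zero_mem: "(\<lambda>x. 0) \<in> H"
    and add_mem: "\<lbrakk>v \<in> H; w \<in> H\<rbrakk> \<Longrightarrow> (\<lambda>x. v x + w x) \<in> H"
    and scale_mem: "v \<in> H \<Longrightarrow> (\<lambda>x. c * v x) \<in> H"
    and ip_sym: "\<lbrakk>v \<in> H; w \<in> H\<rbrakk> \<Longrightarrow> ip v w = ip w v"
    and ip_add: "\<lbrakk>u \<in> H; v \<in> H; w \<in> H\<rbrakk> \<Longrightarrow> ip (\<lambda>x. u x + v x) w = ip u w + ip v w"
    and ip_scale: "\<lbrakk>v \<in> H; w \<in> H\<rbrakk> \<Longrightarrow> ip (\<lambda>x. c * v x) w = c * ip v w"
    and ip_nonneg: "v \<in> H \<Longrightarrow> 0 \<le> ip v v"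
    and ip_definite: "\<lbrakk>v \<in> H; ip v v = 0\<rbrakk> \<Longrightarrow> v = (\<lambda>x. 0)"
    and complete_H:
      "\<lbrakk>\<And>k. s k \<in> H;
        \<And>\<epsilon>. \<epsilon> > 0 \<Longrightarrow> \<exists>N. \<forall>j\<ge>N. \<forall>k\<ge>N. ip (\<lambda>x. s j x - s k x) (\<lambda>x. s j x - s k x) < \<epsilon>\<rbrakk>
       \<Longrightarrow> \<exists>v\<in>H. (\<lambda>k. ip (\<lambda>x. s k x - v x) (\<lambda>x. s k x - v x)) \<longlonglongrightarrow> 0"
    and kernel_mem: "x \<in> \<Omega> \<Longrightarrow> (\<lambda>y. if y \<in> \<Omega> then K y x else 0) \<in> H"
    and reproducing: "\<lbrakk>x \<in> \<Omega>; v \<in> H\<rbrakk> \<Longrightarrow> ip v (\<lambda>y. if y \<in> \<Omega> then K y x else 0) = v x"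

definition ip_norm :: "(('a \<Rightarrow> real) \<Rightarrow> ('a \<Rightarrow> real) \<Rightarrow> real) \<Rightarrow> ('a \<Rightarrow> real) \<Rightarrow> real" where
  "ip_norm ip v = sqrt (ip v v)"


section \<open>Fractional Sobolev spaces\<close>

text \<open>
  \<open>F\<close> is the unitary inverse Fourier--Plancherel transform of \<open>G\<close>: both are square integrable and
  \<open>F\<close> is the limit in \<open>L\<^sub>2\<close> of the inverse Fourier integrals of \<open>G\<close> truncated to balls.
\<close>

definition inverse_plancherel :: "(real^'d \<Rightarrow> complex) \<Rightarrow> (real^'d \<Rightarrow> complex) \<Rightarrow> bool" where
  "inverse_plancherel G F \<longleftrightarrow>
     G \<in> borel_measurable borel \<and> integrable lborel (\<lambda>w. (cmod (G w))\<^sup>2) \<and>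
     F \<in> borel_measurable borel \<and> integrable lborel (\<lambda>x. (cmod (F x))\<^sup>2) \<and>
     ((\<lambda>R. \<integral>\<^sup>+ x. ennreal ((cmod (F x - complex_of_real ((2 * pi) powr (- real CARD('d) / 2)) *
                 (LINT w:cball 0 R|lborel. cis (w \<bullet> x) * G w)))\<^sup>2) \<partial>lborel) \<longlongrightarrow> 0) at_top"

text \<open>
  \<open>H\<^sup>m\<close> on the whole space consists of the \<open>F\<close> whose Fourier transform \<open>G\<close> satisfies
  \<open>(1 + |w|\<^sup>2)\<^sup>m |G w|\<^sup>2\<close> integrable. On \<open>\<Omega>\<close>, the space consists of the (almost everywhere)
  restrictions, with the quotient norm. Membership is invariant under almost everywhere equality,
  so \<open>sobolev_space\<close> is the union of the usual equivalence classes.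
\<close>

definition has_sobolev_spectrum :: "real \<Rightarrow> (real^'d \<Rightarrow> real) \<Rightarrow> (real^'d \<Rightarrow> complex) \<Rightarrow> bool" where
  "has_sobolev_spectrum m F G \<longleftrightarrow>
     inverse_plancherel G (\<lambda>x. complex_of_real (F x)) \<and>
     integrable lborel (\<lambda>w. (1 + (norm w)\<^sup>2) powr m * (cmod (G w))\<^sup>2)"

definition sobolev_extension ::
  "real \<Rightarrow> (real^'d) set \<Rightarrow> (real^'d \<Rightarrow> real) \<Rightarrow> (real^'d \<Rightarrow> complex) \<Rightarrow> bool" where
  "sobolev_extension m \<Omega> v G \<longleftrightarrow>
     (\<exists>F. has_sobolev_spectrum m F G \<and> (AE x in lborel. x \<in> \<Omega> \<longrightarrow> v x = F x))"

definition sobolev_space :: "real \<Rightarrow> (real^'d) set \<Rightarrow> (real^'d \<Rightarrow> real) set" where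
  "sobolev_space m \<Omega> = {v. \<exists>G. sobolev_extension m \<Omega> v G}"

definition sobolev_norm :: "real \<Rightarrow> (real^'d) set \<Rightarrow> (real^'d \<Rightarrow> real) \<Rightarrow> real" where
  "sobolev_norm m \<Omega> v =
     Inf {sqrt (LINT w|lborel. (1 + (norm w)\<^sup>2) powr m * (cmod (G w))\<^sup>2) | G.
            sobolev_extension m \<Omega> v G}"

text \<open>
  An RKHS consists of genuine functions. It is identified with \<open>H\<^sup>m(\<Omega>)\<close>, for \<open>m > d/2\<close>, by taking
  from every equivalence class its continuous representative on \<open>\<Omega>\<close>, extended by zero.
\<close>

definition equals_sobolev ::
  "real \<Rightarrow> (real^'d) set \<Rightarrow> (real^'d \<Rightarrow> real) set \<Rightarrow>
     ((real^'d \<Rightarrow> real) \<Rightarrow> (real^'d \<Rightarrow> real) \<Rightarrow> real) \<Rightarrow> bool" where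
  "equals_sobolev m \<Omega> H ip \<longleftrightarrow>
     H = {v \<in> sobolev_space m \<Omega>. continuous_on \<Omega> v \<and> (\<forall>x. x \<notin> \<Omega> \<longrightarrow> v x = 0)} \<and>
     (\<exists>a>0. \<exists>b>0. \<forall>v\<in>H. a * sobolev_norm m \<Omega> v \<le> ip_norm ip v \<and>
                          ip_norm ip v \<le> b * sobolev_norm m \<Omega> v)"


section \<open>Partial derivatives\<close>

text \<open>
  Derivatives are taken within \<open>\<Omega>\<close>, which gives them a meaning at boundary points as well: on a
  convex set with non-empty interior the derivative within the set is unique, and it is the
  ordinary derivative at interior points.
\<close>

primrec iterated_partial ::
  "(real^'d) set \<Rightarrow> 'd list \<Rightarrow> (real^'d \<Rightarrow> real) \<Rightarrow> real^'d \<Rightarrow> real" where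
  "iterated_partial \<Omega> [] v = v"
| "iterated_partial \<Omega> (i # is) v =
     (\<lambda>x. frechet_derivative (iterated_partial \<Omega> is v) (at x within \<Omega>) (axis i 1))"

text \<open>
  The coordinate type carries no order, so the order of differentiation is an arbitrary but fixed
  one. It is irrelevant for functions with continuous derivatives up to the order of \<open>\<alpha>\<close>.
\<close>

definition multi_partial ::
  "(real^'d) set \<Rightarrow> nat^'d \<Rightarrow> (real^'d \<Rightarrow> real) \<Rightarrow> real^'d \<Rightarrow> real" where
  "multi_partial \<Omega> \<alpha> = iterated_partial \<Omega> (SOME is. \<forall>i. count_list is i = \<alpha> $ i)"

definition multi_order :: "nat^'d \<Rightarrow> nat" where
  "multi_order \<alpha> = (\<Sum>i\<in>UNIV. \<alpha> $ i)"


section \<open>The regression model\<close>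

text \<open>
  Indices start at \<open>0\<close>: the design of size \<open>n\<close> is \<open>X n 0, \<dots>, X n (n - 1)\<close>, with errors
  \<open>e 0, \<dots>, e (n - 1)\<close>. A deterministic design is a family of constant random variables.
\<close>

locale regression_model = prob_space M
  for M :: "'w measure" +
  fixes \<Omega> :: "(real^'d) set" and X :: "nat \<Rightarrow> nat \<Rightarrow> 'w \<Rightarrow> real^'d"
    and e :: "nat \<Rightarrow> 'w \<Rightarrow> real" and \<sigma>2 :: real
  assumes design_measurable: "i < n \<Longrightarrow> random_variable borel (X n i)"
    and design_in: "\<lbrakk>i < n; \<omega> \<in> space M\<rbrakk> \<Longrightarrow> X n i \<omega> \<in> \<Omega>"
    and errors_indep: "indep_vars (\<lambda>_. borel) e UNIV"
    and errors_identical: "distr M borel (e i) = distr M borel (e 0)"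
    and errors_integrable: "integrable M (e 0)"
    and errors_mean: "expectation (e 0) = 0"
    and errors_square_integrable: "integrable M (\<lambda>\<omega>. (e 0 \<omega>)\<^sup>2)"
    and errors_variance: "variance (e 0) = \<sigma>2"
    and design_errors_indep:
      "indep_set
         (sets (vimage_algebra (space M) (\<lambda>\<omega>. \<lambda>i\<in>{..<n}. X n i \<omega>) (PiM {..<n} (\<lambda>_. borel))))
         (sets (vimage_algebra (space M) (\<lambda>\<omega>. \<lambda>i\<in>{..<n}. e i \<omega>) (PiM {..<n} (\<lambda>_. borel))))"

definition subgaussian :: "'w measure \<Rightarrow> ('w \<Rightarrow> real) \<Rightarrow> real \<Rightarrow> bool" where
  "subgaussian M Z \<tau> \<longleftrightarrow>
     (\<forall>\<theta>. integrable M (\<lambda>\<omega>. exp (\<theta> * Z \<omega>)) \<and>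
          (LINT \<omega>|M. exp (\<theta> * Z \<omega>)) \<le> exp (\<theta>\<^sup>2 * \<tau>\<^sup>2 / 2))"

definition empirical_norm :: "nat \<Rightarrow> (nat \<Rightarrow> 'a) \<Rightarrow> ('a \<Rightarrow> real) \<Rightarrow> real" where
  "empirical_norm n xs v = sqrt ((\<Sum>i<n. (v (xs i))\<^sup>2) / real n)"

definition L2_norm_on :: "(real^'d) set \<Rightarrow> (real^'d \<Rightarrow> real) \<Rightarrow> real" where
  "L2_norm_on \<Omega> v = sqrt (LINT x:\<Omega>|lborel. (v x)\<^sup>2)"

definition norms_comparable ::
  "(real^'d) set \<Rightarrow> (real^'d \<Rightarrow> real) set \<Rightarrow> ((real^'d \<Rightarrow> real) \<Rightarrow> (real^'d \<Rightarrow> real) \<Rightarrow> real) \<Rightarrow>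
     real \<Rightarrow> real \<Rightarrow> real \<Rightarrow> nat \<Rightarrow> (nat \<Rightarrow> real^'d) \<Rightarrow> bool" where
  "norms_comparable \<Omega> H ip m C1 C\<epsilon> n xs \<longleftrightarrow>
     (\<forall>v\<in>H.
        L2_norm_on \<Omega> v
          \<le> max (C1 * empirical_norm n xs v) (C\<epsilon> * real n powr (- m / real CARD('d)) * ip_norm ip v) \<and>
        empirical_norm n xs v
          \<le> max (C1 * L2_norm_on \<Omega> v) (C\<epsilon> * real n powr (- m / real CARD('d)) * ip_norm ip v))"

definition norm_comparison_property ::
  "'w measure \<Rightarrow> (real^'d) set \<Rightarrow> (real^'d \<Rightarrow> real) set \<Rightarrow>
     ((real^'d \<Rightarrow> real) \<Rightarrow> (real^'d \<Rightarrow> real) \<Rightarrow> real) \<Rightarrow> real \<Rightarrow>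
     (nat \<Rightarrow> nat \<Rightarrow> 'w \<Rightarrow> real^'d) \<Rightarrow> bool" where
  "norm_comparison_property M \<Omega> H ip m X \<longleftrightarrow>
     (\<exists>C1>0. \<forall>\<epsilon>>0. \<exists>C\<epsilon>>0. \<forall>n\<ge>1.
        measure M {\<omega> \<in> space M. norms_comparable \<Omega> H ip m C1 C\<epsilon> n (\<lambda>i. X n i \<omega>)} \<ge> 1 - \<epsilon>)"

text \<open>The minimiser is unique for \<open>l > 0\<close>, as the objective is then strictly convex on \<open>H\<close>.\<close>

definition krr_estimator ::
  "('a \<Rightarrow> real) set \<Rightarrow> (('a \<Rightarrow> real) \<Rightarrow> ('a \<Rightarrow> real) \<Rightarrow> real) \<Rightarrow> real \<Rightarrow> nat \<Rightarrow>
     (nat \<Rightarrow> 'a) \<Rightarrow> (nat \<Rightarrow> real) \<Rightarrow> 'a \<Rightarrow> real" where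
  "krr_estimator H ip l n xs ys =
     arg_min (\<lambda>v. (\<Sum>i<n. (ys i - v (xs i))\<^sup>2) / real n + l * (ip_norm ip v)\<^sup>2) (\<lambda>v. v \<in> H)"

text \<open>
  The derivative of the estimator at \<open>x\<close>, with the design taken at \<open>\<omega>\<close> and the errors at \<open>\<omega>'\<close>.
  The estimator itself is the case \<open>\<omega>' = \<omega>\<close>; the expectation with respect to the errors only is
  the integral over \<open>\<omega>'\<close> for fixed \<open>\<omega>\<close>.
\<close>

definition krr_derivative ::
  "(real^'d) set \<Rightarrow> (real^'d \<Rightarrow> real) set \<Rightarrow> ((real^'d \<Rightarrow> real) \<Rightarrow> (real^'d \<Rightarrow> real) \<Rightarrow> real) \<Rightarrow>
     nat^'d \<Rightarrow> real \<Rightarrow> nat \<Rightarrow> (nat \<Rightarrow> nat \<Rightarrow> 'w \<Rightarrow> real^'d) \<Rightarrow> (real^'d \<Rightarrow> real) \<Rightarrow>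
     (nat \<Rightarrow> 'w \<Rightarrow> real) \<Rightarrow> 'w \<Rightarrow> 'w \<Rightarrow> real^'d \<Rightarrow> real" where
  "krr_derivative \<Omega> H ip \<alpha> l n X f e \<omega> \<omega>' =
     multi_partial \<Omega> \<alpha>
       (krr_estimator H ip l n (\<lambda>i. X n i \<omega>) (\<lambda>i. f (X n i \<omega>) + e i \<omega>'))"

text \<open>
  Stochastic boundedness is stated through the complementary event, so that it does not hold
  vacuously for a non-measurable event, to which \<open>measure\<close> assigns \<open>0\<close>. The extended reals make
  suprema of unbounded families \<open>\<infinity>\<close> rather than unspecified.
\<close>

definition bigO_in_prob :: "'w measure \<Rightarrow> (nat \<Rightarrow> 'w \<Rightarrow> ereal) \<Rightarrow> (nat \<Rightarrow> real) \<Rightarrow> bool" where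
  "bigO_in_prob M Z r \<longleftrightarrow>
     (\<forall>\<epsilon>>0. \<exists>B. \<forall>\<^sub>F n in sequentially.
        measure M {\<omega> \<in> space M. Z n \<omega> \<le> ereal (B * r n)} \<ge> 1 - \<epsilon>)"

end

theory Submission
  imports Defs
begin

text \<open>
  Fix the design \<open>x\<^sub>i\<close>. The form \<open>a(u, v) = n \<lambda> \<langle>u, v\<rangle> + \<Sum>\<^sub>i u(x\<^sub>i) v(x\<^sub>i)\<close> on \<open>H\<close> has a reproducing
  kernel \<open>R\<close>, and the estimator for the data \<open>y\<close> is \<open>\<Sum>\<^sub>i y\<^sub>i R(\<cdot>, x\<^sub>i)\<close>. It is linear in the data, so
  the quantity to be bounded is the noise part \<open>\<Sum>\<^sub>i e\<^sub>i D\<^sup>\<alpha>R(\<cdot>, x\<^sub>i)(x)\<close>, a weighted sum of independent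
  subgaussian errors. By duality the sum of the squared weights is at most the supremum of
  \<open>|D\<^sup>\<alpha>v(x)|\<^sup>2 / a(v, v)\<close> over \<open>v\<close> in \<open>H\<close>.

  This supremum is the deterministic heart of the matter. It is controlled by the interpolation
  inequality
  \<open>|D\<^sup>\<alpha>v(x)| \<le> C h\<^bsup>-|\<alpha>|-d/2\<^esup> (\<parallel>v\<parallel>\<^bsub>L2(\<Omega>)\<^esub> + h\<^sup>m \<parallel>v\<parallel>\<^sub>H)\<close> for \<open>0 < h \<le> 1\<close> (\<open>derivative_interpolation\<close>),
  taken at \<open>h = \<lambda>\<^bsup>1/(2m)\<^esup>\<close>: the norm comparison bounds the \<open>L\<^sub>2\<close> norm, and hence the whole bracket,
  by a multiple of \<open>(a(v, v) / n)\<^bsup>1/2\<^esup>\<close>. The resulting factor is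
  \<open>n\<^bsup>-1/2\<^esup> \<lambda>\<^bsup>-(d+2|\<alpha>|)/(4m)\<^esup>\<close>, the pointwise rate (\<open>design_functional_bound\<close>).

  The interpolation inequality itself comes from writing \<open>v\<close> as a Fourier integral and
  comparing the symbol \<open>(iw)\<^sup>\<alpha>\<close> of the derivative with finite exponential sums, that is, comparing
  \<open>D\<^sup>\<alpha>v(x)\<close> with finite combinations of values of \<open>v\<close>. The points of evaluation are obtained
  by shrinking a fixed configuration towards \<open>x\<close> by the factor \<open>h\<close>, so convexity keeps them in \<open>\<Omega>\<close>.
  The error symbol vanishes to order at least \<open>m\<close> at the origin, which produces the factor \<open>h\<^sup>m\<close>, and
  averaging over the configurations turns point values into an \<open>L\<^sub>2\<close> norm.

  The supremum over \<open>x\<close> costs the logarithm. A net of \<open>\<Omega>\<close> whose mesh is a power of \<open>\<lambda>\<close> has at most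
  polynomially many points in \<open>1/\<lambda>\<close>, so a union bound over it loses \<open>(ln (C/\<lambda>))\<^bsup>1/2\<^esup>\<close>. Between the points
  of the net the noise part is Hoelder continuous with its \<open>H\<close> norm as constant. The expected square of
  that norm is at most of the order \<open>\<tau>\<^sup>2 \<Sum>\<^sub>i R(x\<^sub>i, x\<^sub>i) / (n \<lambda>)\<close>, which the case \<open>\<alpha> = 0\<close> of the pointwise bound
  makes of size \<open>\<tau>\<^sup>2 / n\<close> times a power of \<open>1/\<lambda>\<close>, and a fine enough mesh compensates that power.

  Since the design is independent of the errors, all probabilities may be computed with the design
  held fixed, provided that the events are measurable in both. This is why \<open>R\<close> is built by explicit
  rank-one updates: its values are rational functions of values of the kernel \<open>K\<close>.
\<close>

section \<open>Weighted integrals of spectra\<close>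

text \<open>
  The weight is at most a constant multiple of \<open>2\<^bsup>-2sk\<^esup>\<close> on the dyadic shell
  \<open>2\<^bsup>k-1\<^esup> < |w| \<le> 2\<^sup>k\<close>, whose volume is of the order \<open>2\<^bsup>kd\<^esup>\<close>. The geometric series converges
  because \<open>2s > d\<close>.
\<close>

lemma integrable_bessel_weight:
  fixes s :: real
  assumes s: "s > DIM('a) / 2"
  shows "integrable lborel (\<lambda>w :: 'a::euclidean_space. (1 + (norm w)\<^sup>2) powr (- s))"
proof -
  define d where "d = DIM('a)"
  have d0: "0 < d" by (simp add: d_def)
  have s0: "s > 0" using s d0 unfolding d_def by (smt (verit) divide_nonneg_nonneg of_nat_0_le_iff)
  define q where "q = 2 powr (- 2 * s)"
  have q: "q > 0" by (simp add: q_def)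
  define c where "c = (\<lambda>k::nat. 2 powr (2 * s) * q ^ k)"
  have c0: "c k > 0" for k by (simp add: c_def q)
  define f where "f = (\<lambda>w::'a. (1 + (norm w)\<^sup>2) powr (- s))"
  have [measurable]: "cball (0::'a) r \<in> sets borel" for r by (rule borel_closed) simp
  have cover: "\<exists>k. norm w \<le> 2 ^ k \<and> f w \<le> c k" for w :: 'a
  proof -
    \<comment> \<open>The shell of \<open>w\<close> is given by the least such exponent.\<close>
    obtain k0 where "norm w < 2 ^ k0" using real_arch_pow[of 2 "norm w"] by auto
    then have ex: "norm w \<le> 2 ^ k0" by simp
    define k where "k = (LEAST k. norm w \<le> 2 ^ k)"
    have k: "norm w \<le> 2 ^ k" unfolding k_def using ex by (rule LeastI)
    show ?thesis
    proof (cases k)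
      case 0
      have "f w \<le> 1 powr (- s)" unfolding f_def by (rule powr_mono2') (use s0 in auto)
      also have "\<dots> \<le> c 0" using s0 ge_one_powr_ge_zero[of 2 "2 * s"] by (simp add: c_def)
      finally show ?thesis using k unfolding 0 by blast
    next
      case (Suc j)
      have "\<not> norm w \<le> 2 ^ j"
        using not_less_Least[of j "\<lambda>k. norm w \<le> 2 ^ k"] Suc by (simp add: k_def)
      then have "(2 ^ j)\<^sup>2 \<le> (norm w)\<^sup>2" by (intro power_mono) auto
      then have "(2 ^ j)\<^sup>2 \<le> 1 + (norm w)\<^sup>2" by linarith
      then have "f w \<le> ((2 ^ j)\<^sup>2) powr (- s)"
        unfolding f_def by (intro powr_mono2') (use s0 in auto)
      also have "((2 ^ j)\<^sup>2 :: real) = 2 powr real (2 * j)"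
        by (subst powr_realpow) (simp_all add: power_even_eq)
      also have "(2 powr real (2 * j)) powr (- s) = q ^ j"
      proof -
        have "q ^ j = q powr real j" using q by (simp add: powr_realpow)
        also have "\<dots> = 2 powr ((- 2 * s) * real j)" unfolding q_def by (rule powr_powr)
        finally show ?thesis by (simp only: powr_powr) (simp add: mult_ac)
      qed
      also have "q ^ j = c k"
        by (simp add: c_def Suc q_def powr_minus)
      finally show ?thesis using k by blast
    qed
  qed
  have "(\<integral>\<^sup>+ w. ennreal (f w) \<partial>lborel)
      \<le> (\<integral>\<^sup>+ w. (\<Sum>k. ennreal (c k) * indicator (cball (0::'a) (2 ^ k)) w) \<partial>lborel)"
  proof (rule nn_integral_mono)
    fix w :: 'a
    obtain k where k: "norm w \<le> 2 ^ k" "f w \<le> c k" using cover by blast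
    have "ennreal (f w) \<le> (\<Sum>k\<in>{k}. ennreal (c k) * indicator (cball 0 (2 ^ k)) w)"
      using k by (simp add: ennreal_leI)
    also have "\<dots> \<le> (\<Sum>k. ennreal (c k) * indicator (cball 0 (2 ^ k)) w)"
      by (rule sum_le_suminf) auto
    finally show "ennreal (f w) \<le> (\<Sum>k. ennreal (c k) * indicator (cball 0 (2 ^ k)) w)" .
  qed
  also have "\<dots> = (\<Sum>k. \<integral>\<^sup>+ w. ennreal (c k) * indicator (cball (0::'a) (2 ^ k)) w \<partial>lborel)"
    by (rule nn_integral_suminf) measurable
  also have "\<dots> = (\<Sum>k. ennreal (c k * (unit_ball_vol (real d) * (2 ^ k) ^ d)))"
  proof (intro suminf_cong)
    fix k
    have "(\<integral>\<^sup>+ w. ennreal (c k) * indicator (cball (0::'a) (2 ^ k)) w \<partial>lborel)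
        = ennreal (c k) * emeasure lborel (cball (0::'a) (2 ^ k))"
      by (rule nn_integral_cmult_indicator) auto
    also have "\<dots> = ennreal (c k * (unit_ball_vol (real d) * (2 ^ k) ^ d))"
      using c0[of k] by (subst emeasure_cball) (auto simp: d_def ennreal_mult)
    finally show "(\<integral>\<^sup>+ w. ennreal (c k) * indicator (cball (0::'a) (2 ^ k)) w \<partial>lborel)
       = ennreal (c k * (unit_ball_vol (real d) * (2 ^ k) ^ d))" .
  qed
  also have "\<dots> < \<top>"
  proof -
    have "norm (q * 2 ^ d) < 1"
    proof -
      have "q * 2 ^ d = 2 powr (real d - 2 * s)"
        by (simp add: q_def powr_realpow powr_diff powr_minus divide_simps)
      also have "\<dots> < 2 powr 0" using s by (intro powr_less_mono) (auto simp: d_def)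
      finally show ?thesis using q by simp
    qed
    then have "summable (\<lambda>k. 2 powr (2 * s) * unit_ball_vol (real d) * (q * 2 ^ d) ^ k)"
      by (intro summable_mult summable_geometric)
    also have "(\<lambda>k. 2 powr (2 * s) * unit_ball_vol (real d) * (q * 2 ^ d) ^ k)
        = (\<lambda>k. c k * (unit_ball_vol (real d) * (2 ^ k) ^ d))"
      by (simp add: c_def power_mult_distrib mult_ac flip: power_mult)
    finally have "(\<Sum>k. ennreal (c k * (unit_ball_vol (real d) * (2 ^ k) ^ d))) \<noteq> \<top>"
      using c0 by (intro ennreal_suminf_neq_top) (auto intro!: mult_nonneg_nonneg less_imp_le)
    then show ?thesis by (simp add: top.not_eq_extremum)
  qed
  finally have "(\<integral>\<^sup>+ w. ennreal (f w) \<partial>lborel) < \<top>" .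
  then show ?thesis
    by (intro integrableI_bounded) (auto simp: f_def)
qed

lemma Cauchy_Schwarz_integral:
  fixes f g :: "'a \<Rightarrow> real"
  assumes [measurable]: "f \<in> borel_measurable M" "g \<in> borel_measurable M"
    and f: "integrable M (\<lambda>x. (f x)\<^sup>2)" and g: "integrable M (\<lambda>x. (g x)\<^sup>2)"
  shows "integrable M (\<lambda>x. f x * g x)"
    and "(LINT x|M. \<bar>f x * g x\<bar>) \<le> sqrt (LINT x|M. (f x)\<^sup>2) * sqrt (LINT x|M. (g x)\<^sup>2)"
proof -
  show int: "integrable M (\<lambda>x. f x * g x)"
  proof (rule Bochner_Integration.integrable_bound[OF Bochner_Integration.integrable_add[OF f g]])
    show "AE x in M. norm (f x * g x) \<le> norm ((f x)\<^sup>2 + (g x)\<^sup>2)"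
    proof (rule AE_I2)
      fix x
      have "0 \<le> (\<bar>f x\<bar> - \<bar>g x\<bar>)\<^sup>2" by simp
      then have "2 * (\<bar>f x\<bar> * \<bar>g x\<bar>) \<le> (f x)\<^sup>2 + (g x)\<^sup>2" by (simp add: power2_diff)
      moreover have "0 \<le> \<bar>f x\<bar> * \<bar>g x\<bar>" "norm (f x * g x) = \<bar>f x\<bar> * \<bar>g x\<bar>" by (simp_all add: abs_mult)
      ultimately show "norm (f x * g x) \<le> norm ((f x)\<^sup>2 + (g x)\<^sup>2)"
        unfolding real_norm_def[of "(f x)\<^sup>2 + (g x)\<^sup>2"] by linarith
    qed
  qed auto
  have "(\<integral>\<^sup>+ x. ennreal \<bar>f x\<bar> * ennreal \<bar>g x\<bar> \<partial>M)\<^sup>2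
      \<le> (\<integral>\<^sup>+ x. (ennreal \<bar>f x\<bar>)\<^sup>2 \<partial>M) * (\<integral>\<^sup>+ x. (ennreal \<bar>g x\<bar>)\<^sup>2 \<partial>M)"
    by (rule Cauchy_Schwarz_nn_integral) auto
  also have "(\<integral>\<^sup>+ x. (ennreal \<bar>f x\<bar>)\<^sup>2 \<partial>M) = ennreal (LINT x|M. (f x)\<^sup>2)"
    using f by (subst nn_integral_eq_integral[symmetric]) (auto simp: ennreal_power)
  also have "(\<integral>\<^sup>+ x. (ennreal \<bar>g x\<bar>)\<^sup>2 \<partial>M) = ennreal (LINT x|M. (g x)\<^sup>2)"
    using g by (subst nn_integral_eq_integral[symmetric]) (auto simp: ennreal_power)
  also have "(\<integral>\<^sup>+ x. ennreal \<bar>f x\<bar> * ennreal \<bar>g x\<bar> \<partial>M) = ennreal (LINT x|M. \<bar>f x * g x\<bar>)"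
    using integrable_abs[OF int] by (subst nn_integral_eq_integral[symmetric]) (simp_all add: abs_mult ennreal_mult)
  finally have "(LINT x|M. \<bar>f x * g x\<bar>)\<^sup>2 \<le> (LINT x|M. (f x)\<^sup>2) * (LINT x|M. (g x)\<^sup>2)"
    by (simp add: ennreal_power flip: ennreal_mult)
  then show "(LINT x|M. \<bar>f x * g x\<bar>) \<le> sqrt (LINT x|M. (f x)\<^sup>2) * sqrt (LINT x|M. (g x)\<^sup>2)"
    by (metis real_le_rsqrt real_sqrt_mult)
qed

text \<open>
  The \<open>H\<^sup>m\<close> norm, on the whole space, of the function with Fourier transform \<open>G\<close>.
\<close>

definition spectral_norm :: "real \<Rightarrow> ('a::euclidean_space \<Rightarrow> complex) \<Rightarrow> real" where
  "spectral_norm m G = sqrt (LINT w|lborel. (1 + (norm w)\<^sup>2) powr m * (cmod (G w))\<^sup>2)"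

lemma spectral_norm_nonneg: "0 \<le> spectral_norm m G"
  by (simp add: spectral_norm_def)

text \<open>
  The form of Cauchy-Schwarz that produces every bound on Fourier integrals below: the multiplier
  \<open>p\<close> may use up the weight \<open>(1 + |w|\<^sup>2)\<^bsup>m/2\<^esup>\<close> of the spectrum, and what is left over has to be square
  integrable.
\<close>

lemma weighted_spectral_integral:
  fixes G p :: "'a::euclidean_space \<Rightarrow> complex" and \<phi> :: "'a \<Rightarrow> real"
  assumes [measurable]: "G \<in> borel_measurable borel" "p \<in> borel_measurable borel" "\<phi> \<in> borel_measurable borel"
    and G: "integrable lborel (\<lambda>w. (1 + (norm w)\<^sup>2) powr m * (cmod (G w))\<^sup>2)"
    and \<phi>: "integrable lborel (\<lambda>w. (\<phi> w)\<^sup>2)"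
    and p: "\<And>w. cmod (p w) \<le> (1 + (norm w)\<^sup>2) powr (m / 2) * \<phi> w"
  shows "integrable lborel (\<lambda>w. p w * G w)"
    and "cmod (LINT w|lborel. p w * G w) \<le> sqrt (LINT w|lborel. (\<phi> w)\<^sup>2) * spectral_norm m G"
proof -
  define g where "g = (\<lambda>w. (1 + (norm w)\<^sup>2) powr (m / 2) * cmod (G w))"
  have [measurable]: "g \<in> borel_measurable borel" unfolding g_def by measurable
  have g2: "(g w)\<^sup>2 = (1 + (norm w)\<^sup>2) powr m * (cmod (G w))\<^sup>2" for w
  proof -
    have "((1 + (norm w)\<^sup>2) powr (m / 2))\<^sup>2 = (1 + (norm w)\<^sup>2) powr m"
      by (simp add: power2_eq_square flip: powr_add)
    then show ?thesis by (simp add: g_def power_mult_distrib)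
  qed
  have ig: "integrable lborel (\<lambda>w. (g w)\<^sup>2)" using G by (simp add: g2)
  note CS = Cauchy_Schwarz_integral[of \<phi> lborel g, OF _ _ \<phi> ig]
  have le: "cmod (p w * G w) \<le> \<phi> w * g w" for w
    using mult_right_mono[OF p[of w], of "cmod (G w)"] by (simp add: norm_mult g_def mult_ac)
  have le': "cmod (p w * G w) \<le> \<bar>\<phi> w * g w\<bar>" for w using le[of w] by linarith
  show i: "integrable lborel (\<lambda>w. p w * G w)"
    by (rule Bochner_Integration.integrable_bound[OF CS(1)]) (use le' in auto)
  have "cmod (LINT w|lborel. p w * G w) \<le> (LINT w|lborel. cmod (p w * G w))"
    by (rule integral_norm_bound)
  also have "\<dots> \<le> (LINT w|lborel. \<bar>\<phi> w * g w\<bar>)"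
    by (rule integral_mono) (use le' i CS(1) in auto)
  also have "\<dots> \<le> sqrt (LINT w|lborel. (\<phi> w)\<^sup>2) * sqrt (LINT w|lborel. (g w)\<^sup>2)"
    by (rule CS(2)) auto
  finally show "cmod (LINT w|lborel. p w * G w) \<le> sqrt (LINT w|lborel. (\<phi> w)\<^sup>2) * spectral_norm m G"
    by (simp add: spectral_norm_def g2)
qed

lemma cmod_cis_minus_one_le: "cmod (cis t - 1) \<le> \<bar>t\<bar>"
  using iexp_approx1[of t 0] by (simp add: cis_conv_exp)

text \<open>
  Trading \<open>|s - t|\<close> for the power \<open>|s - t|\<^sup>\<beta>\<close> saves integrability at high frequencies: only the strict
  inequality \<open>m > d/2 + |\<alpha>|\<close> is available, with no room for a whole derivative.
\<close>

lemma cmod_cis_diff_le_powr: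
  assumes "0 < \<beta>" "\<beta> \<le> 1"
  shows "cmod (cis s - cis t) \<le> 2 * \<bar>s - t\<bar> powr \<beta>"
proof -
  have "cis s - cis t = cis t * (cis (s - t) - 1)" by (simp add: right_diff_distrib cis_mult)
  then have eq: "cmod (cis s - cis t) = cmod (cis (s - t) - 1)" by (simp add: norm_mult)
  show ?thesis
  proof (cases "\<bar>s - t\<bar> \<le> 1")
    case True
    have "\<bar>s - t\<bar> \<le> \<bar>s - t\<bar> powr \<beta>"
    proof (cases "s = t")
      case False
      then show ?thesis using powr_mono'[of \<beta> 1 "\<bar>s - t\<bar>"] True assms by simp
    qed auto
    then show ?thesis using cmod_cis_minus_one_le[of "s - t"] unfolding eq by simp
  next
    case False
    have "cmod (cis (s - t) - 1) \<le> 2" using norm_triangle_ineq4[of "cis (s - t)" 1] by simp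
    moreover have "1 \<le> \<bar>s - t\<bar> powr \<beta>" using False assms by (intro ge_one_powr_ge_zero) auto
    ultimately show ?thesis unfolding eq by simp
  qed
qed

lemma cmod_cis_taylor_le_powr:
  assumes "0 < \<beta>" "\<beta> \<le> 1"
  shows "cmod (cis t - 1 - \<i> * complex_of_real t) \<le> 3 * \<bar>t\<bar> powr (1 + \<beta>)"
proof (cases "\<bar>t\<bar> \<le> 1")
  case True
  have "{..1::nat} = {0, 1}" by auto
  then have "cmod (cis t - 1 - \<i> * complex_of_real t) \<le> \<bar>t\<bar>\<^sup>2 / 2"
    using iexp_approx1[of t 1] by (simp add: cis_conv_exp numeral_2_eq_2 diff_diff_eq)
  also have "\<bar>t\<bar>\<^sup>2 / 2 \<le> \<bar>t\<bar>\<^sup>2" by simp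
  also have "\<bar>t\<bar>\<^sup>2 \<le> \<bar>t\<bar> powr (1 + \<beta>)"
  proof (cases "t = 0")
    case False
    then have "\<bar>t\<bar> powr 2 \<le> \<bar>t\<bar> powr (1 + \<beta>)" using True assms by (intro powr_mono') auto
    then show ?thesis using False by (simp add: powr_numeral)
  qed auto
  finally show ?thesis by (smt (verit) powr_ge_zero)
next
  case False
  have "cmod (cis t - 1 - \<i> * complex_of_real t) \<le> cmod (cis t) + cmod 1 + cmod (\<i> * complex_of_real t)"
    by (smt (verit) norm_triangle_ineq4)
  also have "\<dots> \<le> 3 * \<bar>t\<bar>" using False by (simp add: norm_mult)
  also have "\<bar>t\<bar> = \<bar>t\<bar> powr 1" using False by simp
  also have "3 * \<bar>t\<bar> powr 1 \<le> 3 * \<bar>t\<bar> powr (1 + \<beta>)"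
    using False assms by (intro mult_left_mono powr_mono) auto
  finally show ?thesis .
qed

text \<open>
  The Fourier multiplier of the partial derivative in the directions of a list.
\<close>

definition deriv_symbol :: "'d list \<Rightarrow> real^'d \<Rightarrow> complex" where
  "deriv_symbol is w = (\<Prod>i\<leftarrow>is. \<i> * complex_of_real (w $ i))"

lemma deriv_symbol_simps [simp]:
  "deriv_symbol [] w = 1"
  "deriv_symbol (i # is) w = \<i> * complex_of_real (w $ i) * deriv_symbol is w"
  by (simp_all add: deriv_symbol_def)

lemma deriv_symbol_measurable [measurable]: "deriv_symbol is \<in> borel_measurable borel"
proof (induction "is")
  case (Cons i "is")
  then show ?case unfolding deriv_symbol_simps by measurable
qed (simp add: deriv_symbol_def)

lemma cmod_deriv_symbol_le: "cmod (deriv_symbol is w) \<le> norm w ^ length is"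
proof (induction "is")
  case (Cons i "is")
  then show ?case
    by (auto simp: norm_mult intro!: mult_mono component_le_norm_cart)
qed simp

lemma deriv_symbol_scaleR:
  "deriv_symbol is (h *\<^sub>R w) = complex_of_real h ^ length is * deriv_symbol is w"
  by (induction "is") auto

definition fourier_integral ::
  "(real^'d \<Rightarrow> complex) \<Rightarrow> (real^'d \<Rightarrow> complex) \<Rightarrow> real^'d \<Rightarrow> complex" where
  "fourier_integral p G x = complex_of_real ((2 * pi) powr (- real CARD('d) / 2)) *
      (LINT w|lborel. p w * cis (w \<bullet> x) * G w)"

abbreviation fourier_const :: "'d::finite itself \<Rightarrow> real" where
  "fourier_const _ \<equiv> (2 * pi) powr (- real CARD('d) / 2)"

lemma norm_le_sqrt_one_plus: "norm w \<le> sqrt (1 + (norm w)\<^sup>2)"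
  by (simp add: real_le_rsqrt)

lemma norm_powr_le_weight:
  assumes "0 \<le> r" "r \<le> t"
  shows "norm w powr r \<le> (1 + (norm w)\<^sup>2) powr (t / 2)"
proof -
  have "norm w powr r \<le> sqrt (1 + (norm w)\<^sup>2) powr r"
    by (rule powr_mono2[OF assms(1) norm_ge_zero norm_le_sqrt_one_plus])
  also have "\<dots> = (1 + (norm w)\<^sup>2) powr (r / 2)"
    by (simp add: powr_half_sqrt[symmetric] powr_powr)
  also have "\<dots> \<le> (1 + (norm w)\<^sup>2) powr (t / 2)"
    using assms by (intro powr_mono) auto
  finally show ?thesis .
qed

text \<open>
  The \<open>L\<^sub>2\<close> norm of \<open>(1 + |w|\<^sup>2)\<^bsup>-t/2\<^esup>\<close>, meaningful for \<open>t > d/2\<close>.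
\<close>

definition bessel_mass :: "'a::euclidean_space itself \<Rightarrow> real \<Rightarrow> real" where
  "bessel_mass _ t = sqrt (LINT w|(lborel :: 'a measure). (1 + (norm w)\<^sup>2) powr (- t))"

lemma bessel_mass_nonneg: "0 \<le> bessel_mass T t"
  by (simp add: bessel_mass_def)

definition spectral :: "real \<Rightarrow> ('a::euclidean_space \<Rightarrow> complex) \<Rightarrow> bool" where
  "spectral m G \<longleftrightarrow> G \<in> borel_measurable borel \<and>
     integrable lborel (\<lambda>w. (1 + (norm w)\<^sup>2) powr m * (cmod (G w))\<^sup>2)"

lemma spectral_integral_bound:
  fixes G p :: "'a::euclidean_space \<Rightarrow> complex"
  assumes G: "spectral m G" and [measurable]: "p \<in> borel_measurable borel"
    and r: "m > DIM('a) / 2 + r" and A: "0 \<le> A"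
    and p: "\<And>w. cmod (p w) \<le> A * (1 + (norm w)\<^sup>2) powr (r / 2)"
  shows "integrable lborel (\<lambda>w. p w * G w)"
    and "cmod (LINT w|lborel. p w * G w) \<le> A * bessel_mass TYPE('a) (m - r) * spectral_norm m G"
proof -
  define \<phi> where "\<phi> = (\<lambda>w::'a. A * (1 + (norm w)\<^sup>2) powr ((r - m) / 2))"
  have [measurable]: "\<phi> \<in> borel_measurable borel" unfolding \<phi>_def by measurable
  have \<phi>2: "(\<phi> w)\<^sup>2 = A\<^sup>2 * (1 + (norm w)\<^sup>2) powr (- (m - r))" for w
    by (simp add: \<phi>_def power_mult_distrib power2_eq_square flip: powr_add)
  have i: "integrable lborel (\<lambda>w. (\<phi> w)\<^sup>2)"
    unfolding \<phi>2 using r by (intro integrable_mult_right integrable_bessel_weight) auto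
  have b: "cmod (p w) \<le> (1 + (norm w)\<^sup>2) powr (m / 2) * \<phi> w" for w
    using p[of w] by (simp add: \<phi>_def diff_divide_distrib mult_ac flip: powr_add)
  have sq: "sqrt (LINT w|lborel. (\<phi> w)\<^sup>2) = A * bessel_mass TYPE('a) (m - r)"
    using A unfolding \<phi>2 by (simp add: bessel_mass_def real_sqrt_mult)
  show "integrable lborel (\<lambda>w. p w * G w)"
    using G by (intro weighted_spectral_integral(1)[OF _ _ _ _ i b]) (auto simp: spectral_def)
  show "cmod (LINT w|lborel. p w * G w) \<le> A * bessel_mass TYPE('a) (m - r) * spectral_norm m G"
    unfolding sq[symmetric]
    using G by (intro weighted_spectral_integral(2)[OF _ _ _ _ i b]) (auto simp: spectral_def)
qed

lemma cis_measurable [measurable]: "cis \<in> borel_measurable borel"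
  by (intro borel_measurable_continuous_onI continuous_intros)

lemma symbol_weight_bound:
  assumes "real (length is) \<le> r"
  shows "cmod (deriv_symbol is w) \<le> (1 + (norm w)\<^sup>2) powr (r / 2)"
proof (cases "is")
  case Nil
  then show ?thesis using assms by (auto intro!: ge_one_powr_ge_zero)
next
  case (Cons i js)
  have "cmod (deriv_symbol is w) \<le> norm w ^ length is" by (rule cmod_deriv_symbol_le)
  also have "\<dots> = norm w powr real (length is)"
  proof (cases "w = 0")
    case False
    then show ?thesis using powr_realpow[of "norm w" "length is"] by simp
  qed (use Cons in simp)
  also have "\<dots> \<le> (1 + (norm w)\<^sup>2) powr (r / 2)"
    by (rule norm_powr_le_weight) (use assms in auto)
  finally show ?thesis .
qed

text \<open>
  Used with \<open>z\<close> an increment of \<open>cis (w \<bullet> x)\<close>: Hoelder and Taylor remainders in \<open>x\<close> cost \<open>\<gamma>\<close> additional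
  powers of the frequency.
\<close>

lemma symbol_increment_bound:
  assumes "real (length is) + \<gamma> \<le> r" "0 \<le> \<gamma>" "0 \<le> B" "cmod z \<le> B * norm w powr \<gamma>"
  shows "cmod (deriv_symbol is w * z) \<le> B * (1 + (norm w)\<^sup>2) powr (r / 2)"
proof -
  have "cmod (deriv_symbol is w * z)
      \<le> (1 + (norm w)\<^sup>2) powr (real (length is) / 2) * (B * (1 + (norm w)\<^sup>2) powr (\<gamma> / 2))"
    unfolding norm_mult
    using assms norm_powr_le_weight[of \<gamma> \<gamma> w]
    by (intro mult_mono symbol_weight_bound) (auto intro: order_trans mult_left_mono)
  also have "\<dots> = B * (1 + (norm w)\<^sup>2) powr ((real (length is) + \<gamma>) / 2)"
    by (simp add: add_divide_distrib powr_add)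
  also have "\<dots> \<le> B * (1 + (norm w)\<^sup>2) powr (r / 2)"
    using assms by (intro mult_left_mono powr_mono) auto
  finally show ?thesis .
qed

lemma fourier_integral_hoelder:
  fixes G :: "real^'d \<Rightarrow> complex"
  assumes G: "spectral m G" and \<beta>: "0 < \<beta>" "\<beta> \<le> 1"
    and m: "m > real CARD('d) / 2 + real (length is) + \<beta>"
  shows "cmod (fourier_integral (deriv_symbol is) G x - fourier_integral (deriv_symbol is) G y)
    \<le> fourier_const TYPE('d) * (2 * norm (x - y) powr \<beta> *
         bessel_mass TYPE(real^'d) (m - (real (length is) + \<beta>)) * spectral_norm m G)"
proof -
  have [measurable]: "G \<in> borel_measurable borel" using G by (simp add: spectral_def)
  have i: "integrable lborel (\<lambda>w. deriv_symbol is w * cis (w \<bullet> z) * G w)" for z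
    using m \<beta> by (intro spectral_integral_bound(1)[OF G, where r = "length is" and A = 1])
      (auto simp: norm_mult intro: symbol_weight_bound)
  define p where "p = (\<lambda>w. deriv_symbol is w * (cis (w \<bullet> x) - cis (w \<bullet> y)))"
  have [measurable]: "p \<in> borel_measurable borel" unfolding p_def by measurable
  have pb: "cmod (p w) \<le> (2 * norm (x - y) powr \<beta>) * (1 + (norm w)\<^sup>2) powr ((real (length is) + \<beta>) / 2)" for w
    unfolding p_def
  proof (rule symbol_increment_bound[where \<gamma> = \<beta>])
    have "cmod (cis (w \<bullet> x) - cis (w \<bullet> y)) \<le> 2 * \<bar>w \<bullet> x - w \<bullet> y\<bar> powr \<beta>"
      by (rule cmod_cis_diff_le_powr[OF \<beta>])
    also have "\<bar>w \<bullet> x - w \<bullet> y\<bar> \<le> norm w * norm (x - y)"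
      by (metis Cauchy_Schwarz_ineq2 inner_diff_right)
    then have "2 * \<bar>w \<bullet> x - w \<bullet> y\<bar> powr \<beta> \<le> 2 * (norm w * norm (x - y)) powr \<beta>"
      using \<beta> by (intro mult_left_mono powr_mono2) auto
    finally show "cmod (cis (w \<bullet> x) - cis (w \<bullet> y)) \<le> 2 * norm (x - y) powr \<beta> * norm w powr \<beta>"
      by (simp add: powr_mult mult_ac)
  qed (use \<beta> in auto)
  have "fourier_integral (deriv_symbol is) G x - fourier_integral (deriv_symbol is) G y
      = complex_of_real (fourier_const TYPE('d)) * (LINT w|lborel. p w * G w)"
    unfolding fourier_integral_def right_diff_distrib[symmetric]
    by (subst Bochner_Integration.integral_diff[symmetric, OF i i])
      (simp add: p_def algebra_simps)
  then have "cmod (fourier_integral (deriv_symbol is) G x - fourier_integral (deriv_symbol is) G y)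
      = fourier_const TYPE('d) * cmod (LINT w|lborel. p w * G w)"
    by (simp add: norm_mult)
  also have "\<dots> \<le> fourier_const TYPE('d) * (2 * norm (x - y) powr \<beta> *
         bessel_mass TYPE(real^'d) (m - (real (length is) + \<beta>)) * spectral_norm m G)"
    using m by (intro mult_left_mono spectral_integral_bound(2)[OF G _ _ _ pb]) auto
  finally show ?thesis .
qed

lemma tendsto_norm_powr_zero:
  fixes f :: "'a \<Rightarrow> 'b::real_normed_vector" and \<beta> :: real
  assumes "0 < \<beta>" and "(f \<longlongrightarrow> a) F"
  shows "((\<lambda>y. C * norm (f y - a) powr \<beta>) \<longlongrightarrow> 0) F"
proof -
  have "((\<lambda>y. norm (f y - a)) \<longlongrightarrow> norm (a - a)) F" by (intro tendsto_intros assms(2))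
  then have "((\<lambda>y. norm (f y - a) powr \<beta>) \<longlongrightarrow> 0) F"
    using assms(1) by (intro tendsto_zero_powrI[where b = \<beta>]) auto
  from tendsto_mult_left[OF this, of C] show ?thesis by simp
qed

lemma continuous_on_of_powr_bound:
  fixes f :: "'a::real_normed_vector \<Rightarrow> 'b::real_normed_vector"
  assumes "0 < \<beta>" and "\<And>x y. x \<in> S \<Longrightarrow> y \<in> S \<Longrightarrow> norm (f x - f y) \<le> C * norm (x - y) powr \<beta>"
  shows "continuous_on S f"
  unfolding continuous_on_def
proof
  fix x assume x: "x \<in> S"
  have "((\<lambda>y. f y - f x) \<longlongrightarrow> 0) (at x within S)"
    by (rule Lim_null_comparison[OF _ tendsto_norm_powr_zero[OF assms(1) tendsto_ident_at]])
      (use assms(2)[OF _ x] in \<open>auto simp: eventually_at intro!: exI[of _ 1]\<close>)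
  then show "(f \<longlongrightarrow> f x) (at x within S)" by (simp add: LIM_zero_iff)
qed

text \<open>
  Derivatives of Fourier integrals are obtained from a quantitative remainder of order \<open>1 + \<beta>\<close>, so
  no interchange of limit and integral has to be justified separately.
\<close>

lemma has_derivative_of_powr_remainder:
  fixes f :: "'a::real_normed_vector \<Rightarrow> 'b::real_normed_vector"
  assumes L: "bounded_linear L" and \<beta>: "0 < \<beta>"
    and b: "\<And>y. norm (f y - f x - L (y - x)) \<le> C * norm (y - x) powr (1 + \<beta>)"
  shows "(f has_derivative L) (at x within S)"
  unfolding has_derivative_iff_norm
proof (intro conjI L)
  show "((\<lambda>y. norm (f y - f x - L (y - x)) / norm (y - x)) \<longlongrightarrow> 0) (at x within S)"
  proof (rule Lim_null_comparison)
    have le: "norm (f y - f x - L (y - x)) / norm (y - x) \<le> C * norm (y - x) powr \<beta>" for y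
    proof (cases "y = x")
      case False
      then show ?thesis using b[of y] by (simp add: powr_add field_simps)
    qed simp
    show "\<forall>\<^sub>F y in at x within S. norm (norm (f y - f x - L (y - x)) / norm (y - x)) \<le> C * norm (y - x) powr \<beta>"
      using le by simp
    show "((\<lambda>y. C * norm (y - x) powr \<beta>) \<longlongrightarrow> 0) (at x within S)"
      by (rule tendsto_norm_powr_zero[OF \<beta> tendsto_ident_at])
  qed
qed

lemma fourier_integral_has_derivative:
  fixes G :: "real^'d \<Rightarrow> complex"
  assumes G: "spectral m G" and \<beta>: "0 < \<beta>" "\<beta> \<le> 1"
    and m: "m > real CARD('d) / 2 + real (length is) + 1 + \<beta>"
  shows "((\<lambda>x. Re (fourier_integral (deriv_symbol is) G x)) has_derivative
     (\<lambda>h. \<Sum>i\<in>UNIV. h $ i * Re (fourier_integral (deriv_symbol (i # is)) G x))) (at x within S)"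
proof (rule has_derivative_of_powr_remainder)
  have [measurable]: "G \<in> borel_measurable borel" using G by (simp add: spectral_def)
  have i: "integrable lborel (\<lambda>w. deriv_symbol is w * cis (w \<bullet> z) * G w)"
    if "length is \<le> length is + 1" for z
    using m \<beta> that by (intro spectral_integral_bound(1)[OF G, where r = "length is" and A = 1])
      (auto simp: norm_mult intro: symbol_weight_bound)
  have i1: "integrable lborel (\<lambda>w. deriv_symbol (j # is) w * cis (w \<bullet> z) * G w)" for z j
    using m \<beta> by (intro spectral_integral_bound(1)[OF G, where r = "length (j # is)" and A = 1])
      (auto simp: norm_mult intro!: order_trans[OF _ symbol_weight_bound[of "j # is"]] simp del: deriv_symbol_simps)
  have "linear (\<lambda>h. h $ i * c)" for i :: 'd and c :: real
    by (intro linearI) (auto simp: algebra_simps)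
  then show "bounded_linear (\<lambda>h. \<Sum>i\<in>UNIV. h $ i * Re (fourier_integral (deriv_symbol (i # is)) G x))"
    by (intro linear_conv_bounded_linear[THEN iffD1] linear_compose_sum) auto
  fix y
  define h where "h = y - x"
  define p where "p = (\<lambda>w. deriv_symbol is w * (cis (w \<bullet> x) * (cis (w \<bullet> h) - 1 - \<i> * complex_of_real (w \<bullet> h))))"
  have [measurable]: "p \<in> borel_measurable borel" unfolding p_def by measurable
  have pb: "cmod (p w) \<le> (3 * norm h powr (1 + \<beta>)) * (1 + (norm w)\<^sup>2) powr ((real (length is) + (1 + \<beta>)) / 2)" for w
    unfolding p_def
  proof (rule symbol_increment_bound[where \<gamma> = "1 + \<beta>"])
    have "cmod (cis (w \<bullet> h) - 1 - \<i> * complex_of_real (w \<bullet> h)) \<le> 3 * \<bar>w \<bullet> h\<bar> powr (1 + \<beta>)"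
      by (rule cmod_cis_taylor_le_powr[OF \<beta>])
    also have "\<dots> \<le> 3 * (norm w * norm h) powr (1 + \<beta>)"
      using \<beta> by (intro mult_left_mono powr_mono2 Cauchy_Schwarz_ineq2) auto
    finally show "cmod (cis (w \<bullet> x) * (cis (w \<bullet> h) - 1 - \<i> * complex_of_real (w \<bullet> h)))
      \<le> 3 * norm h powr (1 + \<beta>) * norm w powr (1 + \<beta>)"
      by (simp add: powr_mult mult_ac norm_mult)
  qed (use \<beta> in auto)
  let ?F = "fourier_integral (deriv_symbol is) G"
  let ?c = "complex_of_real (fourier_const TYPE('d))"
  have "?F y - ?F x - (\<Sum>i\<in>UNIV. complex_of_real (h $ i) * fourier_integral (deriv_symbol (i # is)) G x)
      = ?c * ((LINT w|lborel. deriv_symbol is w * cis (w \<bullet> y) * G w)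
          - (LINT w|lborel. deriv_symbol is w * cis (w \<bullet> x) * G w)
          - (LINT w|lborel. (\<Sum>i\<in>UNIV. complex_of_real (h $ i) * (deriv_symbol (i # is) w * cis (w \<bullet> x) * G w))))"
  proof -
    have "(LINT w|lborel. (\<Sum>i\<in>UNIV. complex_of_real (h $ i) * (deriv_symbol (i # is) w * cis (w \<bullet> x) * G w)))
      = (\<Sum>i\<in>UNIV. complex_of_real (h $ i) * (LINT w|lborel. deriv_symbol (i # is) w * cis (w \<bullet> x) * G w))"
      using i1 by (subst Bochner_Integration.integral_sum) (auto simp del: deriv_symbol_simps)
    then show ?thesis
      unfolding fourier_integral_def by (simp add: algebra_simps sum_distrib_left del: deriv_symbol_simps)
  qed
  also have "\<dots> = ?c * (LINT w|lborel. deriv_symbol is w * cis (w \<bullet> y) * G w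
      - deriv_symbol is w * cis (w \<bullet> x) * G w
      - (\<Sum>i\<in>UNIV. complex_of_real (h $ i) * (deriv_symbol (i # is) w * cis (w \<bullet> x) * G w)))"
    using i i1 by (subst Bochner_Integration.integral_diff | (simp del: deriv_symbol_simps; fail))+
  also have "(\<lambda>w. deriv_symbol is w * cis (w \<bullet> y) * G w
      - deriv_symbol is w * cis (w \<bullet> x) * G w
      - (\<Sum>i\<in>UNIV. complex_of_real (h $ i) * (deriv_symbol (i # is) w * cis (w \<bullet> x) * G w)))
      = (\<lambda>w. p w * G w)"
  proof
    fix w
    have y: "cis (w \<bullet> y) = cis (w \<bullet> x) * cis (w \<bullet> h)"
      by (simp add: h_def cis_mult inner_diff_right)
    have "(\<Sum>i\<in>UNIV. complex_of_real (h $ i) * (deriv_symbol (i # is) w * cis (w \<bullet> x) * G w))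
        = \<i> * complex_of_real (w \<bullet> h) * deriv_symbol is w * cis (w \<bullet> x) * G w"
      by (simp add: inner_vec_def sum_distrib_left sum_distrib_right mult_ac)
    then show "deriv_symbol is w * cis (w \<bullet> y) * G w - deriv_symbol is w * cis (w \<bullet> x) * G w
      - (\<Sum>i\<in>UNIV. complex_of_real (h $ i) * (deriv_symbol (i # is) w * cis (w \<bullet> x) * G w)) = p w * G w"
      by (simp add: y p_def algebra_simps)
  qed
  finally have eq: "?F y - ?F x - (\<Sum>i\<in>UNIV. complex_of_real (h $ i) * fourier_integral (deriv_symbol (i # is)) G x)
      = ?c * (LINT w|lborel. p w * G w)" .
  have "norm (Re (?F y) - Re (?F x) - (\<Sum>i\<in>UNIV. (y - x) $ i * Re (fourier_integral (deriv_symbol (i # is)) G x)))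
      = \<bar>Re (?F y - ?F x - (\<Sum>i\<in>UNIV. complex_of_real (h $ i) * fourier_integral (deriv_symbol (i # is)) G x))\<bar>"
    by (simp add: h_def del: deriv_symbol_simps)
  also have "\<dots> \<le> fourier_const TYPE('d) * cmod (LINT w|lborel. p w * G w)"
    unfolding eq by (rule order_trans[OF abs_Re_le_cmod]) (simp add: norm_mult)
  also have "\<dots> \<le> fourier_const TYPE('d) * (3 * norm h powr (1 + \<beta>) *
         bessel_mass TYPE(real^'d) (m - (real (length is) + (1 + \<beta>))) * spectral_norm m G)"
    using m by (intro mult_left_mono spectral_integral_bound(2)[OF G _ _ _ pb]) auto
  finally show "norm (Re (?F y) - Re (?F x) - (\<Sum>i\<in>UNIV. (y - x) $ i * Re (fourier_integral (deriv_symbol (i # is)) G x)))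
      \<le> (fourier_const TYPE('d) * 3 * bessel_mass TYPE(real^'d) (m - (real (length is) + (1 + \<beta>))) * spectral_norm m G)
          * norm (y - x) powr (1 + \<beta>)"
    by (simp add: h_def mult_ac del: deriv_symbol_simps)
qed (use \<beta> in auto)

lemma sobolev_spectrum_spectral: "has_sobolev_spectrum m F G \<Longrightarrow> spectral m G"
  by (simp add: has_sobolev_spectrum_def inverse_plancherel_def spectral_def)

text \<open>
  As \<open>m > d/2\<close>, the spectrum is integrable, so the truncated inverse Fourier integrals converge
  pointwise to the full one. They also converge to \<open>F\<close> in \<open>L\<^sub>2\<close>, and Fatou's lemma identifies the two limits.
\<close>

lemma sobolev_spectrum_inversion:
  fixes F :: "real^'d \<Rightarrow> real"
  assumes FG: "has_sobolev_spectrum m F G" and m: "m > real CARD('d) / 2"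
  shows "AE x in lborel. complex_of_real (F x) = fourier_integral (deriv_symbol []) G x"
proof -
  have G: "spectral m G" using FG by (rule sobolev_spectrum_spectral)
  have [measurable]: "G \<in> borel_measurable borel" using G by (simp add: spectral_def)
  have [measurable]: "(\<lambda>x. complex_of_real (F x)) \<in> borel_measurable borel"
    using FG by (simp add: has_sobolev_spectrum_def inverse_plancherel_def)
  have [measurable]: "cball (0::real^'d) r \<in> sets borel" for r by (rule borel_closed) simp
  let ?c = "complex_of_real ((2 * pi) powr (- real CARD('d) / 2))"
  define T where "T = (\<lambda>R x. LINT w:cball 0 R|lborel. cis (w \<bullet> x) * G w)"
  have [measurable]: "T R \<in> borel_measurable borel" for R
    unfolding T_def set_lebesgue_integral_def by measurable
  have i: "integrable lborel (\<lambda>w. cis (w \<bullet> x) * G w)" for x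
    using m by (intro spectral_integral_bound(1)[OF G, where r = 0 and A = 1]) (auto simp: add_nonneg_eq_0_iff)
  have lim: "(\<lambda>n. T (real n) x) \<longlonglongrightarrow> (LINT w|lborel. cis (w \<bullet> x) * G w)" for x
    unfolding T_def set_lebesgue_integral_def
  proof (rule integral_dominated_convergence[where w = "\<lambda>w. cmod (cis (w \<bullet> x) * G w)"])
    show "AE w in lborel. (\<lambda>n. indicator (cball 0 (real n)) w *\<^sub>R (cis (w \<bullet> x) * G w)) \<longlonglongrightarrow> cis (w \<bullet> x) * G w"
    proof (rule AE_I2)
      fix w :: "real^'d"
      obtain N :: nat where N: "norm w \<le> real N" using real_arch_simple by blast
      have "\<forall>\<^sub>F n in sequentially. indicator (cball 0 (real n)) w *\<^sub>R (cis (w \<bullet> x) * G w) = cis (w \<bullet> x) * G w"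
        using N by (auto simp: eventually_sequentially intro!: exI[of _ N])
      then show "(\<lambda>n. indicator (cball 0 (real n)) w *\<^sub>R (cis (w \<bullet> x) * G w)) \<longlonglongrightarrow> cis (w \<bullet> x) * G w"
        by (rule tendsto_eventually)
    qed
    show "\<And>n. AE w in lborel. norm (indicator (cball 0 (real n)) w *\<^sub>R (cis (w \<bullet> x) * G w)) \<le> cmod (cis (w \<bullet> x) * G w)"
      by (auto simp: indicator_def)
  qed (use i[of x] in auto)
  define u where "u = (\<lambda>n x. ennreal ((cmod (complex_of_real (F x) - ?c * T (real n) x))\<^sup>2))"
  have "((\<lambda>R. \<integral>\<^sup>+ x. ennreal ((cmod (complex_of_real (F x) - ?c * T R x))\<^sup>2) \<partial>lborel) \<longlongrightarrow> 0) at_top"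
    using FG by (simp add: has_sobolev_spectrum_def inverse_plancherel_def T_def)
  then have u0: "(\<lambda>n. \<integral>\<^sup>+ x. u n x \<partial>lborel) \<longlonglongrightarrow> 0"
    unfolding u_def by (rule filterlim_compose) (rule filterlim_real_sequentially)
  have "(\<lambda>n. u n x) \<longlonglongrightarrow> ennreal ((cmod (complex_of_real (F x) - fourier_integral (deriv_symbol []) G x))\<^sup>2)" for x
    unfolding u_def fourier_integral_def using lim[of x]
    by (intro tendsto_intros tendsto_ennrealI) auto
  then have lu: "liminf (\<lambda>n. u n x) = ennreal ((cmod (complex_of_real (F x) - fourier_integral (deriv_symbol []) G x))\<^sup>2)" for x
    by (intro lim_imp_Liminf) auto
  have [measurable]: "u n \<in> borel_measurable borel" for n unfolding u_def by measurable
  have "(\<integral>\<^sup>+ x. liminf (\<lambda>n. u n x) \<partial>lborel) \<le> liminf (\<lambda>n. \<integral>\<^sup>+ x. u n x \<partial>lborel)"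
    by (rule nn_integral_liminf) auto
  also have "\<dots> = 0" using u0 by (intro lim_imp_Liminf) auto
  finally have "(\<integral>\<^sup>+ x. liminf (\<lambda>n. u n x) \<partial>lborel) = 0" by simp
  then have "AE x in lborel. liminf (\<lambda>n. u n x) = 0"
    by (subst (asm) nn_integral_0_iff_AE) auto
  then show ?thesis unfolding lu by simp
qed

section \<open>Derivatives on a convex body\<close>

locale convex_body =
  fixes \<Omega> :: "(real^'d) set"
  assumes convex_domain: "convex \<Omega>" and compact_domain: "compact \<Omega>"
    and interior_domain: "interior \<Omega> \<noteq> {}"
begin

lemma closed_domain: "closed \<Omega>"
  using compact_domain by (rule compact_imp_closed)

lemma ball_in_domain: obtains c \<rho> where "0 < \<rho>" "ball c \<rho> \<subseteq> \<Omega>"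
  using interior_domain mem_interior by blast

text \<open>
  Restricting to segments from \<open>x\<close> shows that two derivatives agree on \<open>\<Omega> - x\<close>. This set contains a
  ball, possibly away from the origin, and differences of its points span the space.
\<close>

lemma derivative_within_unique:
  fixes f :: "real^'d \<Rightarrow> real"
  assumes x: "x \<in> \<Omega>" and D: "(f has_derivative D) (at x within \<Omega>)"
    and D': "(f has_derivative D') (at x within \<Omega>)"
  shows "D = D'"
proof -
  obtain c \<rho> where \<rho>: "0 < \<rho>" "ball c \<rho> \<subseteq> \<Omega>" by (rule ball_in_domain)
  have lin: "linear D" "linear D'" using D D' by (auto intro: has_derivative_linear)
  have eq: "D (z - x) = D' (z - x)" if z: "z \<in> \<Omega>" for z
  proof -
    define g where "g = (\<lambda>t::real. x + t *\<^sub>R (z - x))"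
    have sub: "g ` {0..1} \<subseteq> \<Omega>"
    proof
      fix y assume "y \<in> g ` {0..1}"
      then obtain t where t: "0 \<le> t" "t \<le> 1" "y = g t" by auto
      have "y = (1 - t) *\<^sub>R x + t *\<^sub>R z" by (simp add: t(3) g_def algebra_simps)
      then show "y \<in> \<Omega>" using convexD_alt[OF convex_domain x z t(1,2)] by simp
    qed
    have g: "(g has_vector_derivative (z - x)) (at 0 within {0..1})"
      unfolding g_def by (auto intro!: derivative_eq_intros)
    have ch: "((f \<circ> g) has_vector_derivative L (z - x)) (at 0 within {0..1})"
      if "(f has_derivative L) (at x within \<Omega>)" for L
      by (rule vector_derivative_diff_chain_within[OF g])
        (use that sub in \<open>auto simp: g_def intro: has_derivative_subset\<close>)
    have "at (0::real) within {0..1} \<noteq> bot" by (simp add: at_within_Icc_at_right)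
    then show ?thesis by (rule vector_derivative_unique_within[OF _ ch[OF D] ch[OF D']])
  qed
  show ?thesis
  proof
    fix u :: "real^'d"
    define r where "r = \<rho> / (2 * (norm u + 1))"
    have nu: "0 < norm u + 1" by (smt (verit) norm_ge_zero)
    have r: "0 < r" using \<rho> nu by (simp add: r_def)
    have "norm (r *\<^sub>R u) = \<rho> / 2 * (norm u / (norm u + 1))"
      using \<rho>(1) nu by (simp add: r_def)
    also have "\<dots> \<le> \<rho> / 2 * 1" using \<rho> nu by (intro mult_left_mono) (auto simp: divide_simps)
    also have "\<dots> < \<rho>" using \<rho> by simp
    finally have "c + r *\<^sub>R u \<in> \<Omega>" "c \<in> \<Omega>" using \<rho> by (auto simp: dist_norm)
    note e = eq[OF this(1)] eq[OF this(2)]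
    have "L (r *\<^sub>R u) = L (c + r *\<^sub>R u - x) - L (c - x)" if "linear L" for L :: "real^'d \<Rightarrow> real"
      by (subst linear_diff[OF that, symmetric]) simp
    from this[OF lin(1)] this[OF lin(2)] have "D (r *\<^sub>R u) = D' (r *\<^sub>R u)" unfolding e by simp
    then have "r * D u = r * D' u" by (simp add: linear_scale[OF lin(1)] linear_scale[OF lin(2)])
    then show "D u = D' u" using r by simp
  qed
qed

lemma frechet_derivative_within_eq:
  fixes f :: "real^'d \<Rightarrow> real"
  assumes x: "x \<in> \<Omega>" and D: "(f has_derivative D) (at x within \<Omega>)"
  shows "frechet_derivative f (at x within \<Omega>) = D"
proof -
  have "(f has_derivative frechet_derivative f (at x within \<Omega>)) (at x within \<Omega>)"
    using D by (auto simp: frechet_derivative_works[symmetric] differentiable_def)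
  then show ?thesis using derivative_within_unique[OF x _ D] by blast
qed

lemma fourier_integral_continuous_on:
  fixes G :: "real^'d \<Rightarrow> complex"
  assumes G: "spectral m G" and m: "m > real CARD('d) / 2 + real (length is)"
  shows "continuous_on S (fourier_integral (deriv_symbol is) G)"
proof -
  define \<beta> where "\<beta> = min 1 ((m - real CARD('d) / 2 - real (length is)) / 2)"
  have \<beta>: "0 < \<beta>" "\<beta> \<le> 1" using m by (auto simp: \<beta>_def)
  have m': "m > real CARD('d) / 2 + real (length is) + \<beta>" using m unfolding \<beta>_def by (auto simp: min_def field_simps)
  show ?thesis
    by (rule continuous_on_of_powr_bound[OF \<beta>(1), of _ _ "fourier_const TYPE('d) * 2 *
        bessel_mass TYPE(real^'d) (m - (real (length is) + \<beta>)) * spectral_norm m G"])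
      (use fourier_integral_hoelder[OF G \<beta> m'] in \<open>simp add: mult_ac\<close>)
qed

text \<open>
  A continuous function that vanishes almost everywhere vanishes on the interior, which is dense in \<open>\<Omega>\<close>.
\<close>

lemma AE_zero_imp_zero:
  fixes g :: "real^'d \<Rightarrow> 'b::real_normed_vector"
  assumes ae: "AE x in lborel. x \<in> \<Omega> \<longrightarrow> g x = 0" and cont: "continuous_on \<Omega> g" and x: "x \<in> \<Omega>"
  shows "g x = 0"
proof -
  have int: "g y = 0" if y: "y \<in> interior \<Omega>" for y
  proof (rule ccontr)
    assume ny: "g y \<noteq> 0"
    define U where "U = {y \<in> interior \<Omega>. g y \<noteq> 0}"
    have "open (g -` (- {0}) \<inter> interior \<Omega>)"
      by (rule continuous_on_open_vimage[THEN iffD1, rule_format])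
        (use continuous_on_subset[OF cont interior_subset] in auto)
    also have "g -` (- {0}) \<inter> interior \<Omega> = U" by (auto simp: U_def)
    finally have op: "open U" .
    obtain N where N: "{x \<in> space lborel. \<not> (x \<in> \<Omega> \<longrightarrow> g x = 0)} \<subseteq> N"
      "emeasure lborel N = 0" "N \<in> sets lborel"
      by (rule AE_E[OF ae])
    have "U \<subseteq> N" using N(1) interior_subset[of \<Omega>] by (auto simp: U_def)
    moreover have "negligible N"
      using null_setsI[OF N(2,3)] by (simp add: negligible_iff_null_sets null_sets_completionI)
    ultimately have "negligible U" by (rule negligible_subset[rotated])
    moreover have "U \<noteq> {}" using y ny by (auto simp: U_def)
    ultimately show False using open_not_negligible[OF op] by simp
  qed
  have cl: "closure (interior \<Omega>) = \<Omega>"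
    using convex_closure_interior[OF convex_domain interior_domain] closed_domain by simp
  show ?thesis
    by (rule continuous_constant_on_closure[of "interior \<Omega>"]) (use cont cl int x in auto)
qed

lemma sobolev_function_eq_fourier_integral:
  assumes v: "continuous_on \<Omega> v" and G: "sobolev_extension m \<Omega> v G"
    and m: "m > real CARD('d) / 2" and x: "x \<in> \<Omega>"
  shows "complex_of_real (v x) = fourier_integral (deriv_symbol []) G x"
proof -
  obtain F where F: "has_sobolev_spectrum m F G" "AE x in lborel. x \<in> \<Omega> \<longrightarrow> v x = F x"
    using G by (auto simp: sobolev_extension_def)
  have "AE x in lborel. complex_of_real (F x) = fourier_integral (deriv_symbol []) G x"
    by (rule sobolev_spectrum_inversion[OF F(1) m])
  with F(2) have "AE x in lborel. x \<in> \<Omega> \<longrightarrow> complex_of_real (v x) - fourier_integral (deriv_symbol []) G x = 0"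
    by eventually_elim auto
  then have "complex_of_real (v x) - fourier_integral (deriv_symbol []) G x = 0"
    by (rule AE_zero_imp_zero[OF _ _ x])
      (use v m F(1) in \<open>auto intro!: continuous_intros fourier_integral_continuous_on[where m = m] sobolev_spectrum_spectral\<close>)
  then show ?thesis by simp
qed

lemma sobolev_extension_spectral: "sobolev_extension m \<Omega> v G \<Longrightarrow> spectral m G"
  by (auto simp: sobolev_extension_def dest: sobolev_spectrum_spectral)

text \<open>
  Each derivative within \<open>\<Omega>\<close> only sees values on \<open>\<Omega>\<close>, where the function coincides with the Fourier
  integral of any of its extensions, and that integral is differentiable on the whole space.
\<close>

lemma iterated_partial_eq_fourier_integral:
  assumes v: "continuous_on \<Omega> v" and G: "sobolev_extension m \<Omega> v G"
  shows "m > real CARD('d) / 2 + real (length is) \<Longrightarrow> x \<in> \<Omega> \<Longrightarrow>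
    iterated_partial \<Omega> is v x = Re (fourier_integral (deriv_symbol is) G x)"
proof (induction "is" arbitrary: x)
  case Nil
  then have "complex_of_real (v x) = fourier_integral (deriv_symbol []) G x"
    by (intro sobolev_function_eq_fourier_integral[OF v G]) auto
  then show ?case by (metis Re_complex_of_real iterated_partial.simps(1))
next
  case (Cons i js)
  define \<beta> where "\<beta> = min 1 ((m - real CARD('d) / 2 - real (length js) - 1) / 2)"
  have \<beta>: "0 < \<beta>" "\<beta> \<le> 1" using Cons(2) by (auto simp: \<beta>_def)
  have m': "m > real CARD('d) / 2 + real (length js) + 1 + \<beta>"
    using Cons(2) unfolding \<beta>_def by (auto simp: min_def field_simps)
  have "(iterated_partial \<Omega> js v has_derivative
     (\<lambda>h. \<Sum>i\<in>UNIV. h $ i * Re (fourier_integral (deriv_symbol (i # js)) G x))) (at x within \<Omega>)"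
    by (rule has_derivative_transform[OF Cons(3) _ fourier_integral_has_derivative[OF sobolev_extension_spectral[OF G] \<beta> m']])
      (use Cons in auto)
  from frechet_derivative_within_eq[OF Cons(3) this]
  show ?case by (simp add: axis_def if_distrib[of "\<lambda>z. z * _"] cong: if_cong del: deriv_symbol_simps)
qed

lemma iterated_partial_differentiable:
  assumes v: "continuous_on \<Omega> v" and G: "sobolev_extension m \<Omega> v G"
    and m: "m > real CARD('d) / 2 + real (length is) + 1" and x: "x \<in> \<Omega>"
  shows "iterated_partial \<Omega> is v differentiable (at x within \<Omega>)"
proof -
  define \<beta> where "\<beta> = min 1 ((m - real CARD('d) / 2 - real (length is) - 1) / 2)"
  have \<beta>: "0 < \<beta>" "\<beta> \<le> 1" using m by (auto simp: \<beta>_def)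
  have m': "m > real CARD('d) / 2 + real (length is) + 1 + \<beta>"
    using m unfolding \<beta>_def by (auto simp: min_def field_simps)
  have "(iterated_partial \<Omega> is v has_derivative
     (\<lambda>h. \<Sum>i\<in>UNIV. h $ i * Re (fourier_integral (deriv_symbol (i # is)) G x))) (at x within \<Omega>)"
    by (rule has_derivative_transform[OF x _ fourier_integral_has_derivative[OF sobolev_extension_spectral[OF G] \<beta> m']])
      (use m iterated_partial_eq_fourier_integral[OF v G] in auto)
  then show ?thesis by (auto simp: differentiable_def)
qed

text \<open>
  The derivative is defined through a choice of Frechet derivative, so linearity needs
  differentiability of every lower derivative and uniqueness within \<open>\<Omega>\<close>.
\<close>

lemma iterated_partial_linear:
  assumes u: "continuous_on \<Omega> u" "sobolev_extension m \<Omega> u G1"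
    and v: "continuous_on \<Omega> v" "sobolev_extension m \<Omega> v G2"
  shows "m > real CARD('d) / 2 + real (length is) \<Longrightarrow> x \<in> \<Omega> \<Longrightarrow>
    iterated_partial \<Omega> is (\<lambda>x. u x + c * v x) x = iterated_partial \<Omega> is u x + c * iterated_partial \<Omega> is v x"
proof (induction "is" arbitrary: x)
  case (Cons i js)
  have du: "(iterated_partial \<Omega> js u has_derivative frechet_derivative (iterated_partial \<Omega> js u) (at x within \<Omega>)) (at x within \<Omega>)"
    using iterated_partial_differentiable[OF u _ Cons(3), of js] Cons(2) by (simp add: frechet_derivative_works)
  have dv: "(iterated_partial \<Omega> js v has_derivative frechet_derivative (iterated_partial \<Omega> js v) (at x within \<Omega>)) (at x within \<Omega>)"
    using iterated_partial_differentiable[OF v _ Cons(3), of js] Cons(2) by (simp add: frechet_derivative_works)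
  have "(iterated_partial \<Omega> js (\<lambda>x. u x + c * v x) has_derivative
     (\<lambda>h. frechet_derivative (iterated_partial \<Omega> js u) (at x within \<Omega>) h
        + c * frechet_derivative (iterated_partial \<Omega> js v) (at x within \<Omega>) h)) (at x within \<Omega>)"
    by (rule has_derivative_transform[OF Cons(3) _ has_derivative_add[OF du has_derivative_mult_right[OF dv]]])
      (use Cons in auto)
  from frechet_derivative_within_eq[OF Cons(3) this]
  show ?case by simp
qed simp

end

lemma multi_partial_eq_iterated_partial:
  fixes \<alpha> :: "nat^'d"
  obtains "is" where "length is = multi_order \<alpha>"
    "\<And>\<Omega>. multi_partial \<Omega> \<alpha> = iterated_partial \<Omega> is"
proof -
  define P where "P = (\<lambda>is :: 'd list. \<forall>i. count_list is i = \<alpha> $ i)"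
  obtain ms where ms: "mset ms = Abs_multiset (\<lambda>i. \<alpha> $ i)" using ex_mset by blast
  have "count_list ms i = \<alpha> $ i" for i
    unfolding count_mset[symmetric] ms by (subst Abs_multiset_inverse) auto
  then have "P (SOME is. P is)" by (intro someI[of P ms]) (simp add: P_def)
  then have c: "count_list (SOME is. P is) i = \<alpha> $ i" for i by (simp add: P_def)
  have "length (SOME is. P is) = multi_order \<alpha>"
    using sum_count_set[of "SOME is. P is" UNIV] by (simp add: c multi_order_def)
  then show ?thesis by (rule that) (simp add: multi_partial_def P_def)
qed

section \<open>Finite-difference symbols\<close>

text \<open>
  The Fourier symbols of finite linear combinations of translations by vectors of length at most \<open>r\<close>.
  They form a filtered algebra under pointwise multiplication.
\<close>

definition exp_sums :: "real \<Rightarrow> ('a::euclidean_space \<Rightarrow> complex) set" where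
  "exp_sums r = {q. \<exists>ps. (\<forall>p\<in>set ps. norm (snd p) \<le> r) \<and>
      q = (\<lambda>w. \<Sum>p\<leftarrow>ps. fst p * cis (w \<bullet> snd p))}"

lemma exp_sumsI:
  "(\<And>p. p \<in> set ps \<Longrightarrow> norm (snd p) \<le> r) \<Longrightarrow> q = (\<lambda>w. \<Sum>p\<leftarrow>ps. fst p * cis (w \<bullet> snd p)) \<Longrightarrow> q \<in> exp_sums r"
  unfolding exp_sums_def by blast

lemma exp_sums_const: "0 \<le> r \<Longrightarrow> (\<lambda>_. b) \<in> exp_sums r"
  by (rule exp_sumsI[of "[(b, 0)]"]) auto

lemma exp_sums_cis: "norm s \<le> r \<Longrightarrow> (\<lambda>w. cis (w \<bullet> s)) \<in> exp_sums r"
  by (rule exp_sumsI[of "[(1, s)]"]) auto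

lemma exp_sums_add:
  assumes "p \<in> exp_sums r" "q \<in> exp_sums r"
  shows "(\<lambda>w. p w + q w) \<in> exp_sums r"
proof -
  obtain ps qs where "\<forall>p\<in>set ps. norm (snd p) \<le> r" "p = (\<lambda>w. \<Sum>p\<leftarrow>ps. fst p * cis (w \<bullet> snd p))"
    "\<forall>p\<in>set qs. norm (snd p) \<le> r" "q = (\<lambda>w. \<Sum>p\<leftarrow>qs. fst p * cis (w \<bullet> snd p))"
    using assms by (auto simp: exp_sums_def)
  then show ?thesis by (intro exp_sumsI[of "ps @ qs"]) auto
qed

lemma exp_sums_mult:
  assumes "p \<in> exp_sums r" "q \<in> exp_sums s"
  shows "(\<lambda>w. p w * q w) \<in> exp_sums (r + s)"
proof -
  obtain ps qs where ps: "\<forall>p\<in>set ps. norm (snd p) \<le> r" "p = (\<lambda>w. \<Sum>p\<leftarrow>ps. fst p * cis (w \<bullet> snd p))"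
    and qs: "\<forall>p\<in>set qs. norm (snd p) \<le> s" "q = (\<lambda>w. \<Sum>p\<leftarrow>qs. fst p * cis (w \<bullet> snd p))"
    using assms by (auto simp: exp_sums_def)
  have "(\<Sum>p\<leftarrow>ps. fst p * cis (w \<bullet> snd p)) * (\<Sum>q\<leftarrow>qs. fst q * cis (w \<bullet> snd q))
     = (\<Sum>p\<leftarrow>concat (map (\<lambda>p. map (\<lambda>q. (fst p * fst q, snd p + snd q)) qs) ps). fst p * cis (w \<bullet> snd p))" for w
  proof (induction ps)
    case (Cons p ps)
    have "fst p * cis (w \<bullet> snd p) * (\<Sum>q\<leftarrow>qs. fst q * cis (w \<bullet> snd q))
       = (\<Sum>q\<leftarrow>qs. fst p * fst q * cis (w \<bullet> (snd p + snd q)))"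
      by (induction qs) (auto simp: inner_add_right cis_mult[symmetric] algebra_simps)
    then show ?case using Cons by (simp add: distrib_right o_def)
  qed simp
  then show ?thesis
    using ps qs by (intro exp_sumsI[of "concat (map (\<lambda>p. map (\<lambda>q. (fst p * fst q, snd p + snd q)) qs) ps)"])
      (fastforce intro!: norm_triangle_mono)+
qed

lemma exp_sums_mono: "q \<in> exp_sums r \<Longrightarrow> r \<le> s \<Longrightarrow> q \<in> exp_sums s"
  by (fastforce simp: exp_sums_def)

lemma exp_sums_power: "q \<in> exp_sums r \<Longrightarrow> (\<lambda>w. q w ^ j) \<in> exp_sums (real j * r)"
proof (induction j)
  case (Suc j)
  from exp_sums_mult[OF Suc(2) Suc(1)[OF Suc(2)]] show ?case by (simp add: algebra_simps)
qed (simp add: exp_sums_const)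

lemma exp_sums_sum:
  "finite A \<Longrightarrow> 0 \<le> r \<Longrightarrow> (\<And>j. j \<in> A \<Longrightarrow> q j \<in> exp_sums r) \<Longrightarrow> (\<lambda>w. \<Sum>j\<in>A. q j w) \<in> exp_sums r"
  by (induction A rule: finite_induct) (auto intro: exp_sums_const exp_sums_add)

lemma exp_sums_nodes:
  assumes "q \<in> exp_sums r"
  obtains n :: nat and b s where "\<And>i. i < n \<Longrightarrow> norm (s i) \<le> r"
    "\<And>w. q w = (\<Sum>i<n. b i * cis (w \<bullet> s i))"
proof -
  obtain ps where ps: "\<forall>p\<in>set ps. norm (snd p) \<le> r" "q = (\<lambda>w. \<Sum>p\<leftarrow>ps. fst p * cis (w \<bullet> snd p))"
    using assms by (auto simp: exp_sums_def)
  show ?thesis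
    by (rule that[of "length ps" "\<lambda>i. snd (ps ! i)" "\<lambda>i. fst (ps ! i)"])
      (use ps in \<open>auto simp: sum_list_sum_nth lessThan_atLeast0\<close>)
qed

lemma exp_sums_bounded:
  assumes "q \<in> exp_sums r"
  obtains B where "0 \<le> B" "\<And>w. cmod (q w) \<le> B"
proof -
  obtain n :: nat and b s where q: "\<And>w. q w = (\<Sum>i<n. b i * cis (w \<bullet> s i))"
    using exp_sums_nodes[OF assms] by metis
  show ?thesis
  proof (rule that[of "\<Sum>i<n. cmod (b i)"])
    fix w show "cmod (q w) \<le> (\<Sum>i<n. cmod (b i))"
      unfolding q by (rule order_trans[OF norm_sum]) (simp add: norm_mult)
  qed (simp add: sum_nonneg)
qed

text \<open>
  The truncated logarithmic series of \<open>is = ln (cis s)\<close> in powers of \<open>u = 1 - cis s\<close>, which is a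
  finite-difference formula of order \<open>k\<close> for the first derivative. Differentiation telescopes the
  geometric sum and leaves \<open>i u\<^bsup>k-1\<^esup>\<close>, of modulus at most \<open>|s|\<^bsup>k-1\<^esup>\<close>, so the mean value inequality
  gives the bound for all \<open>s\<close> without any branch of the logarithm.
\<close>

lemma logarithm_difference_formula:
  assumes k: "k \<ge> 1"
  shows "cmod (\<i> * complex_of_real s + (\<Sum>j = 1..<k. (1 - cis s) ^ j / of_nat j)) \<le> \<bar>s\<bar> ^ k"
proof -
  define f where "f = (\<lambda>s. \<i> * complex_of_real s + (\<Sum>j = 1..<k. (1 - cis s) ^ j / of_nat j))"
  define S where "S = {- \<bar>s\<bar>..\<bar>s\<bar>}"
  have der: "(f has_derivative (\<lambda>h. h *\<^sub>R (\<i> * (1 - cis t) ^ (k - 1)))) (at t within S)" for t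
  proof -
    let ?u = "1 - cis t"
    have summand: "((\<lambda>s. (1 - cis s) ^ j / of_nat j) has_derivative (\<lambda>h. - (h *\<^sub>R (\<i> * cis t)) * ?u ^ (j - 1))) (at t within S)"
      if "j \<in> {1..<k}" for j
    proof -
      have "((\<lambda>s. (1 - cis s) ^ j) has_derivative (\<lambda>h. of_nat j * (- (h *\<^sub>R (\<i> * cis t))) * ?u ^ (j - 1))) (at t within S)"
        by (auto intro!: derivative_eq_intros)
      then have "((\<lambda>s. (1 - cis s) ^ j / of_nat j) has_derivative
          (\<lambda>h. of_nat j * (- (h *\<^sub>R (\<i> * cis t))) * ?u ^ (j - 1) / of_nat j)) (at t within S)"
        by (rule bounded_linear.has_derivative[OF bounded_linear_divide])
      also have "(\<lambda>h. of_nat j * (- (h *\<^sub>R (\<i> * cis t))) * ?u ^ (j - 1) / of_nat j) = (\<lambda>h. - (h *\<^sub>R (\<i> * cis t)) * ?u ^ (j - 1))"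
        using that by (simp add: fun_eq_iff scaleR_conv_of_real)
      finally show ?thesis .
    qed
    have "((\<lambda>s. \<i> * complex_of_real s) has_derivative (\<lambda>h. \<i> * complex_of_real h)) (at t within S)"
      by (auto intro!: derivative_eq_intros)
    then have "(f has_derivative (\<lambda>h. \<i> * complex_of_real h + (\<Sum>j = 1..<k. - (h *\<^sub>R (\<i> * cis t)) * ?u ^ (j - 1)))) (at t within S)"
      unfolding f_def by (intro has_derivative_add has_derivative_sum summand)
    also have "(\<lambda>h. \<i> * complex_of_real h + (\<Sum>j = 1..<k. - (h *\<^sub>R (\<i> * cis t)) * ?u ^ (j - 1)))
       = (\<lambda>h. h *\<^sub>R (\<i> * ?u ^ (k - 1)))"
    proof
      fix h
      have "(\<Sum>j = 1..<k. - (h *\<^sub>R (\<i> * cis t)) * ?u ^ (j - 1)) = - (h *\<^sub>R (\<i> * cis t)) * (\<Sum>j = 1..<k. ?u ^ (j - 1))"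
        by (rule sum_distrib_left[symmetric])
      also have "(\<Sum>j = 1..<k. ?u ^ (j - 1)) = (\<Sum>j<k - 1. ?u ^ j)"
        using k by (intro sum.reindex_bij_witness[of _ Suc "\<lambda>j. j - 1"]) auto
      also have "- (h *\<^sub>R (\<i> * cis t)) * (\<Sum>j<k - 1. ?u ^ j) = - (h *\<^sub>R \<i>) * ((1 - ?u) * (\<Sum>j<k - 1. ?u ^ j))"
        by (simp add: scaleR_conv_of_real)
      also have "(1 - ?u) * (\<Sum>j<k - 1. ?u ^ j) = 1 - ?u ^ (k - 1)"
        by (rule one_diff_power_eq[symmetric])
      finally show "\<i> * complex_of_real h + (\<Sum>j = 1..<k. - (h *\<^sub>R (\<i> * cis t)) * ?u ^ (j - 1)) = h *\<^sub>R (\<i> * ?u ^ (k - 1))"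
        by (simp add: scaleR_conv_of_real algebra_simps)
    qed
    finally show ?thesis .
  qed
  have "norm (f s - f 0) \<le> \<bar>s\<bar> ^ (k - 1) * norm (s - 0)"
  proof (rule differentiable_bound[where S = S and f' = "\<lambda>t h. h *\<^sub>R (\<i> * (1 - cis t) ^ (k - 1))"])
    fix t assume t: "t \<in> S"
    show "onorm (\<lambda>h. h *\<^sub>R (\<i> * (1 - cis t) ^ (k - 1))) \<le> \<bar>s\<bar> ^ (k - 1)"
    proof (rule onorm_le)
      fix h
      have "cmod (1 - cis t) \<le> \<bar>s\<bar>"
        using cmod_cis_minus_one_le[of t] t by (auto simp: S_def norm_minus_commute)
      then have "cmod (1 - cis t) ^ (k - 1) \<le> \<bar>s\<bar> ^ (k - 1)" by (intro power_mono) auto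
      then show "norm (h *\<^sub>R (\<i> * (1 - cis t) ^ (k - 1))) \<le> \<bar>s\<bar> ^ (k - 1) * norm h"
        by (simp add: norm_mult norm_power mult_left_mono mult.commute)
    qed
  qed (use der in \<open>auto simp: S_def\<close>)
  also have "f 0 = 0" by (auto simp: f_def intro!: sum.neutral)
  also have "\<bar>s\<bar> ^ (k - 1) * norm (s - 0) = \<bar>s\<bar> ^ k" using k by (cases k) auto
  finally show ?thesis by (simp add: f_def)
qed

text \<open>
  Partial derivatives of any order are approximated to order \<open>k\<close> at low frequencies by differences with
  arbitrarily short steps: one factor for each entry of the list, each using half of the remaining
  step length.
\<close>

lemma deriv_symbol_approximation:
  fixes "is" :: "'d::finite list"
  assumes k: "k \<ge> 1"
  shows "0 < \<eta> \<Longrightarrow> \<exists>q\<in>exp_sums \<eta>. \<exists>C\<ge>0. \<forall>w. norm w \<le> 1 \<longrightarrow> cmod (deriv_symbol is w - q w) \<le> C * norm w ^ k"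
proof (induction "is" arbitrary: \<eta>)
  case Nil
  then show ?case by (intro bexI[of _ "\<lambda>_. 1"] exI[of _ 0]) (auto intro: exp_sums_const)
next
  case (Cons i js)
  obtain q C where q: "q \<in> exp_sums (\<eta> / 2)" "C \<ge> 0"
    "\<And>w. norm w \<le> 1 \<Longrightarrow> cmod (deriv_symbol js w - q w) \<le> C * norm w ^ k"
    using Cons.IH[of "\<eta> / 2"] Cons.prems by auto
  define \<delta> where "\<delta> = \<eta> / (2 * real k)"
  have \<delta>: "0 < \<delta>" using k Cons.prems by (simp add: \<delta>_def)
  define p where "p = (\<lambda>w :: real^'d. \<Sum>j = 1..<k. (- 1 / (of_nat j * complex_of_real \<delta>)) * (1 - cis (w \<bullet> (\<delta> *\<^sub>R axis i 1))) ^ j)"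
  have c1: "(\<lambda>w :: real^'d. 1 - cis (w \<bullet> (\<delta> *\<^sub>R axis i 1))) \<in> exp_sums \<delta>"
  proof -
    have "(\<lambda>w :: real^'d. 1 + (- 1) * cis (w \<bullet> (\<delta> *\<^sub>R axis i 1))) \<in> exp_sums (0 + \<delta>)"
      using \<delta> by (intro exp_sums_add exp_sums_mult exp_sums_const exp_sums_cis) auto
    then show ?thesis by simp
  qed
  have p: "p \<in> exp_sums (\<eta> / 2)"
    unfolding p_def
  proof (intro exp_sums_sum)
    fix j assume j: "j \<in> {1..<k}"
    have "real j * \<delta> \<le> real k * \<delta>" using j \<delta> by (intro mult_right_mono) auto
    also have "\<dots> = \<eta> / 2" using k by (simp add: \<delta>_def)
    finally have le: "real j * \<delta> \<le> \<eta> / 2" .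
    have "(\<lambda>w :: real^'d. (- 1 / (of_nat j * complex_of_real \<delta>)) * (1 - cis (w \<bullet> (\<delta> *\<^sub>R axis i 1))) ^ j) \<in> exp_sums (0 + real j * \<delta>)"
      by (intro exp_sums_mult exp_sums_const exp_sums_power c1) auto
    then show "(\<lambda>w :: real^'d. (- 1 / (of_nat j * complex_of_real \<delta>)) * (1 - cis (w \<bullet> (\<delta> *\<^sub>R axis i 1))) ^ j) \<in> exp_sums (\<eta> / 2)"
      by (rule exp_sums_mono) (use le in simp)
  qed (use Cons.prems in auto)
  have pe: "cmod (\<i> * complex_of_real (w $ i) - p w) \<le> \<delta> ^ k / \<delta> * norm w ^ k" for w
  proof -
    have "\<i> * complex_of_real (w $ i) - p w
       = (\<i> * complex_of_real (\<delta> * w $ i) + (\<Sum>j = 1..<k. (1 - cis (\<delta> * w $ i)) ^ j / of_nat j)) / complex_of_real \<delta>"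
      using \<delta> by (simp add: p_def inner_axis add_divide_distrib sum_divide_distrib sum_negf mult_ac)
    then have "cmod (\<i> * complex_of_real (w $ i) - p w)
       = cmod (\<i> * complex_of_real (\<delta> * w $ i) + (\<Sum>j = 1..<k. (1 - cis (\<delta> * w $ i)) ^ j / of_nat j)) / \<delta>"
      using \<delta> by (simp add: norm_divide)
    also have "\<dots> \<le> \<bar>\<delta> * w $ i\<bar> ^ k / \<delta>"
      using \<delta> by (intro divide_right_mono logarithm_difference_formula[OF k]) auto
    also have "\<dots> \<le> (\<delta> * norm w) ^ k / \<delta>"
      using \<delta> component_le_norm_cart[of w i]
      by (intro divide_right_mono power_mono) (auto simp: abs_mult)
    finally show ?thesis by (simp add: power_mult_distrib)
  qed
  obtain B where B: "0 \<le> B" "\<And>w. cmod (p w) \<le> B" using exp_sums_bounded[OF p] by blast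
  have pq: "(\<lambda>w. p w * q w) \<in> exp_sums \<eta>" using exp_sums_mult[OF p q(1)] by simp
  show ?case
  proof (intro bexI[OF _ pq] exI[of _ "\<delta> ^ k / \<delta> + B * C"] conjI allI impI)
    show "0 \<le> \<delta> ^ k / \<delta> + B * C" using \<delta> B q by simp
    fix w :: "real^'d" assume w: "norm w \<le> 1"
    let ?D = "deriv_symbol js w"
    have "deriv_symbol (i # js) w - p w * q w = (\<i> * complex_of_real (w $ i) - p w) * ?D + p w * (?D - q w)"
      by (simp add: algebra_simps)
    then have "cmod (deriv_symbol (i # js) w - p w * q w)
        \<le> cmod (\<i> * complex_of_real (w $ i) - p w) * cmod ?D + cmod (p w) * cmod (?D - q w)"
      by (metis norm_mult norm_triangle_ineq)
    also have "\<dots> \<le> (\<delta> ^ k / \<delta> * norm w ^ k) * 1 + B * (C * norm w ^ k)"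
    proof (intro add_mono mult_mono pe B q w)
      show "cmod ?D \<le> 1"
        using cmod_deriv_symbol_le[of js w] w power_le_one[of "norm w" "length js"] by simp
    qed (use \<delta> B q in auto)
    finally show "cmod (deriv_symbol (i # js) w - p w * q w) \<le> (\<delta> ^ k / \<delta> + B * C) * norm w ^ k"
      by (simp add: algebra_simps)
  qed
qed

section \<open>Interpolation between the \<open>L\<^sub>2\<close> norm and the Sobolev norm\<close>

lemma lborel_affine_integral:
  fixes f :: "'a::euclidean_space \<Rightarrow> real"
  assumes [measurable]: "f \<in> borel_measurable borel" and c: "0 < c" and f: "integrable lborel f"
  shows "integrable lborel (\<lambda>x. f (t + c *\<^sub>R x))"
    and "(LINT x|lborel. f (t + c *\<^sub>R x)) = (LINT x|lborel. f x) / c ^ DIM('a)"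
proof -
  have eq: "lborel = density (distr lborel borel (\<lambda>x::'a. t + c *\<^sub>R x)) (\<lambda>_. ennreal (c ^ DIM('a)))"
    using lborel_affine[of c t] c by simp
  have "integrable (density (distr lborel borel (\<lambda>x::'a. t + c *\<^sub>R x)) (\<lambda>_. ennreal (c ^ DIM('a)))) f"
    unfolding eq[symmetric] by (rule f)
  then have "integrable (distr lborel borel (\<lambda>x::'a. t + c *\<^sub>R x)) (\<lambda>x. c ^ DIM('a) * f x)"
    by (subst (asm) integrable_density) (use c in auto)
  then have "integrable lborel (\<lambda>x. c ^ DIM('a) * f (t + c *\<^sub>R x))"
    by (subst (asm) integrable_distr_eq) auto
  then show "integrable lborel (\<lambda>x. f (t + c *\<^sub>R x))" using c by simp
  have "(LINT x|lborel. f x) = (LINT x|density (distr lborel borel (\<lambda>x::'a. t + c *\<^sub>R x)) (\<lambda>_. ennreal (c ^ DIM('a))). f x)"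
    unfolding eq[symmetric] ..
  also have "\<dots> = (LINT x|lborel. c ^ DIM('a) * f (t + c *\<^sub>R x))"
    using c by (subst integral_density) (auto simp: integral_distr)
  finally show "(LINT x|lborel. f (t + c *\<^sub>R x)) = (LINT x|lborel. f x) / c ^ DIM('a)"
    using c by simp
qed

text \<open>
  The average of \<open>|u|\<close> over a copy of \<open>B\<close> scaled by \<open>c\<close> is controlled by the \<open>L\<^sub>2\<close> norm, at the price of
  \<open>c\<^bsup>-d/2\<^esup>\<close>. This is the source of the \<open>d/2\<close> in the interpolation inequality.
\<close>

lemma affine_average_bound:
  fixes u :: "'a::euclidean_space \<Rightarrow> real"
  assumes [measurable]: "u \<in> borel_measurable borel" "B \<in> sets borel"
    and B: "emeasure lborel B < \<infinity>" and u: "integrable lborel (\<lambda>x. (u x)\<^sup>2)" and c: "0 < c"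
  shows "integrable lborel (\<lambda>y. indicator B y * \<bar>u (t + c *\<^sub>R y)\<bar>)"
    and "(LINT y|lborel. indicator B y * \<bar>u (t + c *\<^sub>R y)\<bar>)
      \<le> sqrt (measure lborel B) * (c powr (- real DIM('a) / 2) * sqrt (LINT x|lborel. (u x)\<^sup>2))"
proof -
  define f where "f = (indicator B :: 'a \<Rightarrow> real)"
  define g where "g = (\<lambda>y. u (t + c *\<^sub>R y))"
  have [measurable]: "f \<in> borel_measurable borel" "g \<in> borel_measurable borel"
    unfolding f_def g_def by measurable
  have f2: "(f y)\<^sup>2 = indicator B y" for y by (simp add: f_def indicator_def)
  have if2: "integrable lborel (\<lambda>y. (f y)\<^sup>2)" unfolding f2 using B by simp
  note aff = lborel_affine_integral[OF _ c u, of t]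
  have ig2: "integrable lborel (\<lambda>y. (g y)\<^sup>2)" unfolding g_def by (rule aff(1)) measurable
  note CS = Cauchy_Schwarz_integral[of f lborel g, OF _ _ if2 ig2]
  have eq: "indicator B y * \<bar>u (t + c *\<^sub>R y)\<bar> = \<bar>f y * g y\<bar>" for y
    by (simp add: f_def g_def abs_mult)
  show "integrable lborel (\<lambda>y. indicator B y * \<bar>u (t + c *\<^sub>R y)\<bar>)"
    unfolding eq by (intro integrable_abs CS(1)) auto
  have "(LINT y|lborel. indicator B y * \<bar>u (t + c *\<^sub>R y)\<bar>) = (LINT y|lborel. \<bar>f y * g y\<bar>)"
    unfolding eq ..
  also have "\<dots> \<le> sqrt (LINT y|lborel. (f y)\<^sup>2) * sqrt (LINT y|lborel. (g y)\<^sup>2)"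
    by (rule CS(2)) auto
  also have "(LINT y|lborel. (f y)\<^sup>2) = measure lborel B" unfolding f2 by simp
  also have "(LINT y|lborel. (g y)\<^sup>2) = (LINT x|lborel. (u x)\<^sup>2) / c ^ DIM('a)"
    unfolding g_def by (rule aff(2)) measurable
  also have "sqrt ((LINT x|lborel. (u x)\<^sup>2) / c ^ DIM('a)) = c powr (- real DIM('a) / 2) * sqrt (LINT x|lborel. (u x)\<^sup>2)"
  proof -
    have "c powr (- real DIM('a) / 2) = (c powr (- real DIM('a))) powr (1 / 2)"
      by (simp add: powr_powr)
    also have "c powr (- real DIM('a)) = inverse (c ^ DIM('a))"
      using c by (simp add: powr_minus powr_realpow)
    also have "inverse (c ^ DIM('a)) powr (1 / 2) = sqrt (inverse (c ^ DIM('a)))"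
      by (rule powr_half_sqrt) (use c in simp)
    finally show ?thesis
      by (simp only: divide_inverse real_sqrt_mult mult.commute)
  qed
  finally show "(LINT y|lborel. indicator B y * \<bar>u (t + c *\<^sub>R y)\<bar>)
      \<le> sqrt (measure lborel B) * (c powr (- real DIM('a) / 2) * sqrt (LINT x|lborel. (u x)\<^sup>2))" .
qed

text \<open>
  With \<open>z = cis (s / k)\<close> this says that \<open>1\<close> is reproduced up to an error of order \<open>|s|\<^sup>k\<close> by the
  exponentials \<open>cis (j s / k)\<close> with \<open>1 \<le> j \<le> k\<close>, that is, a function is extrapolated to \<open>0\<close> from its values
  at the positive nodes \<open>j / k\<close>.
\<close>

lemma one_minus_power_expansion:
  fixes z :: complex
  shows "1 - (1 - z) ^ k = (\<Sum>j = 1..k. (- of_nat (k choose j) * (- 1) ^ j) * z ^ j)"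
proof -
  have "(1 - z) ^ k = (\<Sum>j\<le>k. of_nat (k choose j) * (- z) ^ j)"
    using binomial_ring[of "- z" 1 k] by simp
  also have "{..k} = insert 0 {1..k}" by auto
  also have "(\<Sum>j\<in>insert 0 {1..k}. of_nat (k choose j) * (- z) ^ j)
     = 1 + (\<Sum>j = 1..k. of_nat (k choose j) * ((- 1) ^ j * z ^ j))"
    by (subst sum.insert) (auto simp: power_minus[of z])
  finally show ?thesis by (simp add: sum_negf mult_ac)
qed

context convex_body begin

text \<open>
  The derivative at \<open>x\<close> is replaced by values at \<open>x + s\<^sub>i + (j / k)(y - x)\<close>: extrapolation along the
  segment from \<open>y\<close> to \<open>x\<close>, combined with the finite differences above. Extrapolation is needed because
  \<open>x\<close> may be a boundary point, where differences around \<open>x\<close> itself would leave \<open>\<Omega>\<close>. The nodes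
  are bounded away from \<open>0\<close>, so at each of them the cone from \<open>x\<close> over a ball in \<open>\<Omega>\<close> leaves room for short shifts.
  The error bound says that the symbol
  of the error vanishes to order \<open>m\<close> at \<open>0\<close> and grows only like \<open>|w|\<^bsup>|is|\<^esup>\<close> at infinity.
\<close>

lemma fourier_cell_formula:
  fixes "is" :: "'d list"
  assumes m: "m > real CARD('d) / 2 + real (length is)"
  obtains n k :: nat and b :: "nat \<Rightarrow> complex" and a :: "nat \<Rightarrow> complex" and s :: "nat \<Rightarrow> real^'d"
    and c :: "real^'d" and \<rho> A :: real
  where "0 < \<rho>" "1 \<le> k" "0 \<le> A"
    "\<And>i j x y h. \<lbrakk>i < n; j \<in> {1..k}; x \<in> \<Omega>; y \<in> ball c \<rho>; 0 < h; h \<le> 1\<rbrakk>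
       \<Longrightarrow> x + h *\<^sub>R (s i + (real j / real k) *\<^sub>R (y - x)) \<in> \<Omega>"
    "\<And>x y w. \<lbrakk>x \<in> \<Omega>; y \<in> ball c \<rho>\<rbrakk> \<Longrightarrow>
       cmod (deriv_symbol is w - (\<Sum>i<n. \<Sum>j = 1..k. b i * a j * cis (w \<bullet> (s i + (real j / real k) *\<^sub>R (y - x)))))
         \<le> A * (norm w powr m * (1 + (norm w)\<^sup>2) powr ((real (length is) - m) / 2))"
proof -
  obtain c \<rho> where \<rho>: "0 < \<rho>" "ball c \<rho> \<subseteq> \<Omega>" by (rule ball_in_domain)
  have m0: "0 < m" using m by (smt (verit) divide_nonneg_nonneg of_nat_0_le_iff)
  define k where "k = nat \<lceil>m\<rceil>"
  have k: "m \<le> real k" "1 \<le> k" using m0 by (auto simp: k_def) linarith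
  \<comment> \<open>Divided by a node \<open>t \<ge> 1/k\<close>, shifts of this length are at most \<open>\<rho>/2\<close>.\<close>
  define \<eta> where "\<eta> = \<rho> / (2 * real k)"
  have \<eta>: "0 < \<eta>" using \<rho> k by (simp add: \<eta>_def)
  obtain q C where q: "q \<in> exp_sums \<eta>" "C \<ge> 0"
    "\<And>w. norm w \<le> 1 \<Longrightarrow> cmod (deriv_symbol is w - q w) \<le> C * norm w ^ k"
    using deriv_symbol_approximation[OF k(2) \<eta>, of "is"] by auto
  obtain n :: nat and b s where s: "\<And>i. i < n \<Longrightarrow> norm (s i) \<le> \<eta>"
    and qe: "\<And>w. q w = (\<Sum>i<n. b i * cis (w \<bullet> s i))"
    using exp_sums_nodes[OF q(1)] by metis
  obtain Q where Q: "0 \<le> Q" "\<And>w. cmod (q w) \<le> Q" using exp_sums_bounded[OF q(1)] by blast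
  define a where "a = (\<lambda>j. - of_nat (k choose j) * (- 1) ^ j :: complex)"
  obtain D0 where D0: "\<And>x. x \<in> \<Omega> \<Longrightarrow> norm x \<le> D0" using compact_imp_bounded[OF compact_domain] by (auto simp: bounded_iff)
  define D where "D = 2 * \<bar>D0\<bar>"
  have D: "norm (y - x) \<le> D" if "x \<in> \<Omega>" "y \<in> \<Omega>" for x y
    using D0[OF that(1)] D0[OF that(2)] norm_triangle_ineq4[of y x] unfolding D_def by linarith
  define l where "l = real (length is)"
  define A1 where "A1 = (C + Q * D ^ k) * 2 powr ((m - l) / 2)"
  define A2 where "A2 = (1 + Q * (1 + 2 ^ k)) * 2 powr ((m - l) / 2)"
  have D_nonneg: "0 \<le> D" by (simp add: D_def)
  have lm: "l \<le> m" using m by (smt (verit) l_def divide_nonneg_nonneg of_nat_0_le_iff)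
  show ?thesis
  proof (rule that[of "\<rho> / 2" k "A1 + A2" n c s b a])
    show "0 < \<rho> / 2" "1 \<le> k" using \<rho> k by auto
    have "0 \<le> A1" "0 \<le> A2" using q Q D_nonneg by (auto simp: A1_def A2_def)
    then show "0 \<le> A1 + A2" by simp
  next
    fix i j x y and h :: real
    assume i: "i < n" and j: "j \<in> {1..k}" and x: "x \<in> \<Omega>" and y: "y \<in> ball c (\<rho> / 2)" and h: "0 < h" "h \<le> 1"
    define t where "t = real j / real k"
    have t: "0 < t" "t \<le> 1" "1 / t \<le> real k" using j k(2) by (auto simp: t_def divide_simps)
    have "norm (inverse t *\<^sub>R s i) \<le> real k * \<eta>"
      using t s[OF i] by (auto simp: divide_inverse intro!: mult_mono)
    also have "\<dots> = \<rho> / 2" using k by (simp add: \<eta>_def)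
    finally have n: "norm (inverse t *\<^sub>R s i) \<le> \<rho> / 2" .
    have "dist c (y + inverse t *\<^sub>R s i) \<le> dist c y + norm (inverse t *\<^sub>R s i)"
      using norm_triangle_ineq4[of "c - y" "inverse t *\<^sub>R s i"] by (simp add: dist_norm diff_diff_eq)
    then have "y + inverse t *\<^sub>R s i \<in> ball c \<rho>" using y n by simp
    then have "y + inverse t *\<^sub>R s i \<in> \<Omega>" using \<rho> by auto
    from convexD_alt[OF convex_domain x this, of "h * t"]
    \<comment> \<open>The point of evaluation lies on the segment from \<open>x\<close> to a point of the larger ball.\<close>
    have "(1 - h * t) *\<^sub>R x + (h * t) *\<^sub>R (y + inverse t *\<^sub>R s i) \<in> \<Omega>"
      using h t by (auto simp: mult_le_one)
    also have "(1 - h * t) *\<^sub>R x + (h * t) *\<^sub>R (y + inverse t *\<^sub>R s i) = x + h *\<^sub>R (s i + t *\<^sub>R (y - x))"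
      using t by (simp add: algebra_simps)
    finally show "x + h *\<^sub>R (s i + (real j / real k) *\<^sub>R (y - x)) \<in> \<Omega>" by (simp add: t_def)
  next
    fix x y w
    assume x: "x \<in> \<Omega>" and y: "y \<in> ball c (\<rho> / 2)"
    have yO: "y \<in> \<Omega>" using y \<rho> by auto
    define z where "z = cis (w \<bullet> ((1 / real k) *\<^sub>R (y - x)))"
    have zj: "z ^ j = cis (w \<bullet> ((real j / real k) *\<^sub>R (y - x)))" for j
      by (simp add: z_def Complex.DeMoivre divide_inverse mult_ac)
    have "(\<Sum>i<n. \<Sum>j = 1..k. b i * a j * cis (w \<bullet> (s i + (real j / real k) *\<^sub>R (y - x))))
        = (\<Sum>i<n. \<Sum>j = 1..k. (b i * cis (w \<bullet> s i)) * (a j * z ^ j))"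
      by (simp add: zj inner_add_right cis_mult[symmetric] mult_ac)
    also have "\<dots> = q w * (1 - (1 - z) ^ k)"
      unfolding qe one_minus_power_expansion a_def sum_product ..
    finally have eq: "deriv_symbol is w - (\<Sum>i<n. \<Sum>j = 1..k. b i * a j * cis (w \<bullet> (s i + (real j / real k) *\<^sub>R (y - x))))
        = deriv_symbol is w - q w * (1 - (1 - z) ^ k)" by simp
    let ?R = "norm w powr m * (1 + (norm w)\<^sup>2) powr ((l - m) / 2)"
    have R0: "0 \<le> ?R" by simp
    let ?err = "cmod (deriv_symbol is w - q w * (1 - (1 - z) ^ k))"
    have two: "2 powr ((m - l) / 2) * 2 powr ((l - m) / 2) = 1"
      by (simp add: powr_add[symmetric] add_divide_distrib[symmetric])
    have "?err \<le> (A1 + A2) * ?R"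
    proof (cases "norm w \<le> 1")
      case True
      have "cmod (1 - z) \<le> \<bar>w \<bullet> ((1 / real k) *\<^sub>R (y - x))\<bar>"
        unfolding z_def by (metis cmod_cis_minus_one_le norm_minus_commute)
      also have "\<dots> \<le> norm w * norm ((1 / real k) *\<^sub>R (y - x))" by (rule Cauchy_Schwarz_ineq2)
      also have "\<dots> \<le> norm w * D"
      proof (rule mult_left_mono)
        have "norm ((1 / real k) *\<^sub>R (y - x)) = 1 / real k * norm (y - x)" by simp
        also have "\<dots> \<le> 1 * norm (y - x)" using k(2) by (intro mult_right_mono) auto
        finally show "norm ((1 / real k) *\<^sub>R (y - x)) \<le> D" using D[OF x yO] by simp
      qed simp
      finally have z1: "cmod (1 - z) ^ k \<le> (norm w * D) ^ k" by (intro power_mono) auto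
      have "deriv_symbol is w - q w * (1 - (1 - z) ^ k) = (deriv_symbol is w - q w) + q w * (1 - z) ^ k"
        by (simp add: algebra_simps)
      then have "?err \<le> cmod (deriv_symbol is w - q w) + cmod (q w) * cmod (1 - z) ^ k"
        by (metis norm_mult norm_power norm_triangle_ineq)
      also have "\<dots> \<le> C * norm w ^ k + Q * (norm w * D) ^ k"
        by (intro add_mono mult_mono q Q z1 True) auto
      also have "\<dots> = (C + Q * D ^ k) * norm w ^ k" by (simp add: algebra_simps power_mult_distrib)
      also have "norm w ^ k \<le> norm w powr m"
      proof (cases "w = 0")
        case False
        then have "norm w ^ k = norm w powr real k" by (simp add: powr_realpow)
        also have "\<dots> \<le> norm w powr m" using k True by (intro powr_mono') auto
        finally show ?thesis .
      qed (use k in \<open>auto simp: zero_power\<close>)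
      then have "(C + Q * D ^ k) * norm w ^ k \<le> (C + Q * D ^ k) * norm w powr m"
        using q Q D_nonneg by (intro mult_left_mono) auto
      also have "\<dots> = A1 * (norm w powr m * 2 powr ((l - m) / 2))"
        using two by (simp add: A1_def mult_ac)
      also have "\<dots> \<le> A1 * ?R"
      proof (intro mult_left_mono powr_mono2')
        show "1 + (norm w)\<^sup>2 \<le> 2" using True by (simp add: power_le_one)
        show "0 \<le> A1" using q Q D_nonneg by (auto simp: A1_def)
        show "0 < 1 + (norm w)\<^sup>2" by (smt (verit) zero_le_power2)
      qed (use lm in auto)
      also have "\<dots> \<le> (A1 + A2) * ?R"
        using Q R0 by (intro mult_right_mono) (auto simp: A2_def)
      finally show ?thesis .
    next
      case False
      have w1: "1 < norm w" using False by simp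
      have "cmod (1 - z) \<le> 2"
        using norm_triangle_ineq4[of 1 z] by (simp add: z_def)
      then have "cmod (1 - z) ^ k \<le> 2 ^ k" by (intro power_mono) auto
      then have u: "cmod (1 - (1 - z) ^ k) \<le> 1 + 2 ^ k"
        using norm_triangle_ineq4[of 1 "(1 - z) ^ k"] by (simp add: norm_power)
      have "?err \<le> cmod (deriv_symbol is w) + cmod (q w) * cmod (1 - (1 - z) ^ k)"
        by (metis norm_mult norm_triangle_ineq4)
      also have "\<dots> \<le> norm w ^ length is + Q * (1 + 2 ^ k)"
        by (intro add_mono mult_mono cmod_deriv_symbol_le Q u) auto
      also have "\<dots> \<le> norm w ^ length is + Q * (1 + 2 ^ k) * norm w ^ length is"
        using Q w1 one_le_power[of "norm w" "length is"] mult_left_mono[of 1 "norm w ^ length is" "Q * (1 + 2 ^ k)"] by simp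
      also have "\<dots> = (1 + Q * (1 + 2 ^ k)) * norm w powr l"
      proof -
        have "norm w powr l = norm w ^ length is" unfolding l_def using w1 by (intro powr_realpow) linarith
        then show ?thesis by (simp add: algebra_simps)
      qed
      finally have upto: "?err \<le> (1 + Q * (1 + 2 ^ k)) * norm w powr l" .
      have "norm w powr l = norm w powr m * (norm w)\<^sup>2 powr ((l - m) / 2)"
      proof -
        have "(norm w)\<^sup>2 = norm w powr 2" by simp
        moreover have "m + 2 * ((l - m) / 2) = l" by (simp add: field_simps)
        ultimately show ?thesis by (simp only: powr_powr powr_add[symmetric])
      qed
      moreover have "(norm w)\<^sup>2 powr ((l - m) / 2) \<le> ((1 + (norm w)\<^sup>2) / 2) powr ((l - m) / 2)"
        using lm w1 one_le_power[of "norm w" 2] by (intro powr_mono2') (auto simp: add_pos_nonneg)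
      moreover have "((1 + (norm w)\<^sup>2) / 2) powr ((l - m) / 2) = (1 + (norm w)\<^sup>2) powr ((l - m) / 2) * 2 powr ((m - l) / 2)"
      proof -
        have "((1 + (norm w)\<^sup>2) / 2) powr ((l - m) / 2) = (1 + (norm w)\<^sup>2) powr ((l - m) / 2) / 2 powr ((l - m) / 2)"
          by (rule powr_divide)
        also have "\<dots> = (1 + (norm w)\<^sup>2) powr ((l - m) / 2) * 2 powr ((m - l) / 2)"
          using two by (simp add: field_simps)
        finally show ?thesis .
      qed
      ultimately have "norm w powr l \<le> norm w powr m * ((1 + (norm w)\<^sup>2) powr ((l - m) / 2) * 2 powr ((m - l) / 2))"
        by (simp add: mult_left_mono)
      then have "(1 + Q * (1 + 2 ^ k)) * norm w powr l \<le> (1 + Q * (1 + 2 ^ k)) * (norm w powr m * ((1 + (norm w)\<^sup>2) powr ((l - m) / 2) * 2 powr ((m - l) / 2)))"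
        using Q by (intro mult_left_mono) auto
      also have "\<dots> = A2 * ?R" by (simp only: A2_def mult_ac)
      finally have "(1 + Q * (1 + 2 ^ k)) * norm w powr l \<le> A2 * ?R" .
      with upto have "?err \<le> A2 * ?R" by (rule order_trans)
      also have "\<dots> \<le> (A1 + A2) * ?R"
        using Q q D_nonneg R0 by (intro mult_right_mono) (auto simp: A1_def)
      finally show ?thesis .
    qed
    then show "cmod (deriv_symbol is w - (\<Sum>i<n. \<Sum>j = 1..k. b i * a j * cis (w \<bullet> (s i + (real j / real k) *\<^sub>R (y - x)))))
      \<le> (A1 + A2) * (norm w powr m * (1 + (norm w)\<^sup>2) powr ((real (length is) - m) / 2))"
      unfolding eq by (simp add: l_def)
  qed
qed

text \<open>
  Substituting \<open>hw\<close> into a symbol that vanishes to order \<open>m\<close> gains \<open>h\<^sup>m\<close>, and the change of variables in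
  the remaining integral costs a factor \<open>h\<^bsup>-d/2\<^esup>\<close>.
\<close>

lemma remainder_integral_bound:
  fixes G :: "real^'d \<Rightarrow> complex"
  assumes G: "spectral m G" and l: "m > real CARD('d) / 2 + l" "0 \<le> l" and h: "0 < h" "h \<le> 1" and A: "0 \<le> A"
    and [measurable]: "E \<in> borel_measurable borel"
    and E: "\<And>w. cmod (E w) \<le> A * (norm w powr m * (1 + (norm w)\<^sup>2) powr ((l - m) / 2))"
  shows "cmod (LINT w|lborel. E (h *\<^sub>R w) * cis (w \<bullet> x) * G w)
    \<le> A * h powr (m - real CARD('d) / 2) * bessel_mass TYPE(real^'d) (m - l) * spectral_norm m G"
proof -
  have m0: "0 \<le> m" using l by (smt (verit) divide_nonneg_nonneg of_nat_0_le_iff)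
  define \<psi> where "\<psi> = (\<lambda>u :: real^'d. (1 + (norm u)\<^sup>2) powr (- (m - l)))"
  define \<phi> where "\<phi> = (\<lambda>w :: real^'d. A * h powr m * (1 + (norm (h *\<^sub>R w))\<^sup>2) powr ((l - m) / 2))"
  have [measurable]: "\<psi> \<in> borel_measurable borel" "\<phi> \<in> borel_measurable borel"
    unfolding \<psi>_def \<phi>_def by measurable
  have i\<psi>: "integrable lborel \<psi>" unfolding \<psi>_def using l by (intro integrable_bessel_weight) auto
  note aff = lborel_affine_integral[OF _ h(1) i\<psi>, of 0]
  have \<phi>2: "(\<phi> w)\<^sup>2 = (A * h powr m)\<^sup>2 * \<psi> (0 + h *\<^sub>R w)" for w
    by (simp add: \<phi>_def \<psi>_def power_mult_distrib power2_eq_square[of "_ powr _"] flip: powr_add)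
  have i\<phi>: "integrable lborel (\<lambda>w. (\<phi> w)\<^sup>2)"
    unfolding \<phi>2 by (intro integrable_mult_right aff(1)) measurable
  have "(LINT w|lborel. (\<phi> w)\<^sup>2) = (A * h powr m)\<^sup>2 * ((LINT u|lborel. \<psi> u) / h ^ DIM(real^'d))"
    unfolding \<phi>2 by (subst integral_mult_right_zero) (subst aff(2), auto)
  then have sq: "sqrt (LINT w|lborel. (\<phi> w)\<^sup>2) = A * h powr m * (bessel_mass TYPE(real^'d) (m - l) / sqrt (h ^ CARD('d)))"
    using A h by (simp add: real_sqrt_mult real_sqrt_divide bessel_mass_def \<psi>_def)
  have "sqrt (h ^ CARD('d)) = h powr (real CARD('d) / 2)"
  proof -
    have "sqrt (h ^ CARD('d)) = (h powr real CARD('d)) powr (1 / 2)"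
      using h by (simp add: powr_realpow powr_half_sqrt)
    then show ?thesis by (simp only: powr_powr) simp
  qed
  then have sq': "sqrt (LINT w|lborel. (\<phi> w)\<^sup>2) = A * h powr (m - real CARD('d) / 2) * bessel_mass TYPE(real^'d) (m - l)"
    unfolding sq by (simp add: powr_diff)
  have b: "cmod (E (h *\<^sub>R w) * cis (w \<bullet> x)) \<le> (1 + (norm w)\<^sup>2) powr (m / 2) * \<phi> w" for w
  proof -
    have "cmod (E (h *\<^sub>R w) * cis (w \<bullet> x)) \<le> A * (norm (h *\<^sub>R w) powr m * (1 + (norm (h *\<^sub>R w))\<^sup>2) powr ((l - m) / 2))"
      using E[of "h *\<^sub>R w"] by (simp add: norm_mult)
    also have "norm (h *\<^sub>R w) powr m = h powr m * norm w powr m"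
      using h by (simp add: powr_mult)
    also have "A * (h powr m * norm w powr m * (1 + (norm (h *\<^sub>R w))\<^sup>2) powr ((l - m) / 2)) = norm w powr m * \<phi> w"
      by (simp add: \<phi>_def)
    also have "\<dots> \<le> (1 + (norm w)\<^sup>2) powr (m / 2) * \<phi> w"
      using A norm_powr_le_weight[OF m0 order_refl] by (intro mult_right_mono) (auto simp: \<phi>_def)
    finally show ?thesis .
  qed
  have "cmod (LINT w|lborel. (E (h *\<^sub>R w) * cis (w \<bullet> x)) * G w) \<le> sqrt (LINT w|lborel. (\<phi> w)\<^sup>2) * spectral_norm m G"
    using G by (intro weighted_spectral_integral(2)[OF _ _ _ _ i\<phi> b]) (auto simp: spectral_def)
  then show ?thesis unfolding sq' .
qed

text \<open>
  The formula for the configuration shrunk by \<open>h\<close> towards \<open>x\<close> holds for every \<open>y\<close> in a fixed ball, with the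
  same remainder. Integrating over \<open>y\<close> replaces the point values by \<open>L\<^sub>2\<close> averages over affine images of the
  ball. The constant does not depend on the extension, so that the infimum over extensions may be
  taken afterwards.
\<close>

lemma derivative_interpolation_extension:
  fixes "is" :: "'d list"
  assumes m: "m > real CARD('d) / 2 + real (length is)"
  obtains C where "0 < C"
    "\<And>v G x h. \<lbrakk>continuous_on \<Omega> v; sobolev_extension m \<Omega> v G; x \<in> \<Omega>; 0 < h; h \<le> 1\<rbrakk>
      \<Longrightarrow> \<bar>iterated_partial \<Omega> is v x\<bar>
        \<le> C * h powr (- (real (length is) + real CARD('d) / 2)) * (L2_norm_on \<Omega> v + h powr m * spectral_norm m G)"
proof -
  let ?l = "real (length is)" and ?d = "real CARD('d)"
  let ?c = "fourier_const TYPE('d)"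
  show ?thesis
  proof (rule fourier_cell_formula[OF m])
    fix n k :: nat and b a :: "nat \<Rightarrow> complex" and s :: "nat \<Rightarrow> real^'d" and c :: "real^'d" and \<rho> A :: real
    assume \<rho>: "0 < \<rho>" and k: "1 \<le> k" and A: "0 \<le> A"
      and dom: "\<And>i j x y h. \<lbrakk>i < n; j \<in> {1..k}; x \<in> \<Omega>; y \<in> ball c \<rho>; 0 < h; h \<le> 1\<rbrakk>
         \<Longrightarrow> x + h *\<^sub>R (s i + (real j / real k) *\<^sub>R (y - x)) \<in> \<Omega>"
      and err: "\<And>x y w. \<lbrakk>x \<in> \<Omega>; y \<in> ball c \<rho>\<rbrakk> \<Longrightarrow>
         cmod (deriv_symbol is w - (\<Sum>i<n. \<Sum>j = 1..k. b i * a j * cis (w \<bullet> (s i + (real j / real k) *\<^sub>R (y - x)))))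
           \<le> A * (norm w powr m * (1 + (norm w)\<^sup>2) powr ((?l - m) / 2))"
    define V where "V = measure lborel (ball c \<rho>)"
    have V: "0 < V" unfolding V_def using \<rho> by (simp add: content_ball_pos)
    have Vf: "emeasure lborel (ball c \<rho>) < \<infinity>" by (rule emeasure_lborel_ball_finite)
    define S where "S = (\<Sum>i<n. \<Sum>j = 1..k. cmod (b i) * cmod (a j))"
    have S: "0 \<le> S" by (auto simp: S_def intro!: sum_nonneg)
    define C1 where "C1 = S * real k powr (?d / 2) / sqrt V"
    define C2 where "C2 = ?c * A * bessel_mass TYPE(real^'d) (m - ?l)"
    have C1: "0 \<le> C1" using S V by (simp add: C1_def)
    have C2: "0 \<le> C2" using A by (simp add: C2_def bessel_mass_nonneg)
    show ?thesis
    proof (rule that[of "1 + C1 + C2"])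
      show "0 < 1 + C1 + C2" using C1 C2 by simp
      fix v G x and h :: real
      assume v: "continuous_on \<Omega> v" and G: "sobolev_extension m \<Omega> v G" and x: "x \<in> \<Omega>" and h: "0 < h" "h \<le> 1"
      have sG: "spectral m G" by (rule sobolev_extension_spectral[OF G])
      have [measurable]: "G \<in> borel_measurable borel" using sG by (simp add: spectral_def)
      have [measurable]: "ball c \<rho> \<in> sets borel" by simp
      have d0: "m > ?d / 2" using m by linarith
      \<comment> \<open>Extension by zero makes \<open>v\<close> a Borel function on the whole space.\<close>
      define vv where "vv = (\<lambda>z. indicator \<Omega> z * v z)"
      have vvm [measurable]: "vv \<in> borel_measurable borel"
        unfolding vv_def using borel_measurable_continuous_on_indicator[OF _ v] closed_domain by simp
      have "compact (v ` \<Omega>)" by (rule compact_continuous_image[OF v compact_domain])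
      then have "\<exists>Bv. \<forall>z\<in>\<Omega>. \<bar>v z\<bar> \<le> Bv" by (auto dest!: compact_imp_bounded simp: bounded_iff)
      then obtain Bv where Bv: "\<And>z. z \<in> \<Omega> \<Longrightarrow> \<bar>v z\<bar> \<le> Bv" by blast
      have vv2: "(vv z)\<^sup>2 = indicator \<Omega> z *\<^sub>R (v z)\<^sup>2" for z by (simp add: vv_def indicator_def)
      have ivv: "integrable lborel (\<lambda>z. (vv z)\<^sup>2)"
      proof (rule Bochner_Integration.integrable_bound)
        show "integrable lborel (\<lambda>z. indicator \<Omega> z * Bv\<^sup>2)"
          using closed_domain emeasure_compact_finite[OF compact_domain] by simp
        show "AE z in lborel. norm ((vv z)\<^sup>2) \<le> norm (indicator \<Omega> z * Bv\<^sup>2)"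
          using Bv power_mono[OF Bv abs_ge_zero, of _ 2] by (auto simp: vv2 indicator_def)
      qed auto
      have L2: "sqrt (LINT z|lborel. (vv z)\<^sup>2) = L2_norm_on \<Omega> v"
        by (simp add: L2_norm_on_def set_lebesgue_integral_def vv2)
      let ?D = "\<bar>iterated_partial \<Omega> is v x\<bar>" and ?ab = "\<lambda>i j. cmod (b i) * cmod (a j)"
      let ?z = "\<lambda>i j y. x + h *\<^sub>R (s i + (real j / real k) *\<^sub>R (y - x))"
      let ?u = "\<lambda>i j y. indicator (ball c \<rho>) y * \<bar>vv (?z i j y)\<bar>"
      define R where "R = C2 * h powr (m - ?d / 2) * spectral_norm m G"
      \<comment> \<open>The formula for a single configuration, multiplied by \<open>h\<close> to the order of the derivative.\<close>
      have cell: "h ^ length is * ?D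
          \<le> (\<Sum>i<n. \<Sum>j = 1..k. ?ab i j * \<bar>vv (?z i j y)\<bar>) + R" if y: "y \<in> ball c \<rho>" for y
      proof -
        define T where "T = (\<lambda>w. \<Sum>i<n. \<Sum>j = 1..k. b i * a j * cis (w \<bullet> (s i + (real j / real k) *\<^sub>R (y - x))))"
        define E where "E = (\<lambda>w. deriv_symbol is w - T w)"
        have [measurable]: "T \<in> borel_measurable borel" unfolding T_def by measurable
        have [measurable]: "E \<in> borel_measurable borel" unfolding E_def by measurable
        have i1: "integrable lborel (\<lambda>w. deriv_symbol is w * cis (w \<bullet> x) * G w)"
          using m by (intro spectral_integral_bound(1)[OF sG, where r = ?l and A = 1])
            (auto simp: norm_mult intro: symbol_weight_bound)
        have i0: "integrable lborel (\<lambda>w. cis (w \<bullet> z) * G w)" for z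
          using d0 by (intro spectral_integral_bound(1)[OF sG, where r = 0 and A = 1]) (auto simp: add_nonneg_eq_0_iff)
        have Tz: "T (h *\<^sub>R w) * cis (w \<bullet> x) * G w = (\<Sum>i<n. \<Sum>j = 1..k. b i * a j * (cis (w \<bullet> ?z i j y) * G w))" for w
        proof -
          have "cis (w \<bullet> ?z i j y) = cis (h *\<^sub>R w \<bullet> (s i + (real j / real k) *\<^sub>R (y - x))) * cis (w \<bullet> x)" for i j
            by (simp only: cis_mult inner_add_right inner_scaleR_right inner_scaleR_left) (simp add: distrib_left mult_ac add_ac)
          then show ?thesis by (simp only: T_def sum_distrib_right mult.assoc)
        qed
        have iT: "integrable lborel (\<lambda>w. T (h *\<^sub>R w) * cis (w \<bullet> x) * G w)"
          unfolding Tz by (intro Bochner_Integration.integrable_sum integrable_mult_right i0)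
        have "complex_of_real h ^ length is * fourier_integral (deriv_symbol is) G x
            = complex_of_real ?c * (LINT w|lborel. deriv_symbol is (h *\<^sub>R w) * cis (w \<bullet> x) * G w)"
          unfolding deriv_symbol_scaleR fourier_integral_def mult.assoc integral_mult_right_zero by (simp add: mult_ac)
        also have "(LINT w|lborel. deriv_symbol is (h *\<^sub>R w) * cis (w \<bullet> x) * G w)
           = (LINT w|lborel. T (h *\<^sub>R w) * cis (w \<bullet> x) * G w) + (LINT w|lborel. E (h *\<^sub>R w) * cis (w \<bullet> x) * G w)"
        proof -
          have "integrable lborel (\<lambda>w. deriv_symbol is (h *\<^sub>R w) * cis (w \<bullet> x) * G w)"
            unfolding deriv_symbol_scaleR mult.assoc using i1 by (intro integrable_mult_right) (simp add: mult.assoc)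
          then have "integrable lborel (\<lambda>w. E (h *\<^sub>R w) * cis (w \<bullet> x) * G w)"
            unfolding E_def left_diff_distrib by (intro Bochner_Integration.integrable_diff iT)
          then show ?thesis
            by (subst Bochner_Integration.integral_add[OF iT, symmetric]) (auto simp: E_def algebra_simps)
        qed
        also have "(LINT w|lborel. T (h *\<^sub>R w) * cis (w \<bullet> x) * G w)
           = (\<Sum>i<n. \<Sum>j = 1..k. b i * a j * (LINT w|lborel. cis (w \<bullet> ?z i j y) * G w))"
        proof -
          have "(LINT w|lborel. (\<Sum>i<n. \<Sum>j = 1..k. b i * a j * (cis (w \<bullet> ?z i j y) * G w)))
             = (\<Sum>i<n. (LINT w|lborel. (\<Sum>j = 1..k. b i * a j * (cis (w \<bullet> ?z i j y) * G w))))"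
            by (intro Bochner_Integration.integral_sum Bochner_Integration.integrable_sum integrable_mult_right i0)
          also have "\<dots> = (\<Sum>i<n. \<Sum>j = 1..k. (LINT w|lborel. b i * a j * (cis (w \<bullet> ?z i j y) * G w)))"
            by (intro sum.cong refl Bochner_Integration.integral_sum integrable_mult_right i0)
          finally show ?thesis unfolding Tz by (simp only: integral_mult_right_zero)
        qed
        finally have eq: "complex_of_real h ^ length is * fourier_integral (deriv_symbol is) G x
           = (\<Sum>i<n. \<Sum>j = 1..k. b i * a j * fourier_integral (deriv_symbol []) G (?z i j y))
             + complex_of_real ?c * (LINT w|lborel. E (h *\<^sub>R w) * cis (w \<bullet> x) * G w)"
          by (simp add: fourier_integral_def distrib_left sum_distrib_left mult_ac)
        have "h ^ length is * ?D = h ^ length is * \<bar>Re (fourier_integral (deriv_symbol is) G x)\<bar>"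
          by (subst iterated_partial_eq_fourier_integral[OF v G m x]) simp
        also have "\<dots> \<le> h ^ length is * cmod (fourier_integral (deriv_symbol is) G x)"
          using h by (intro mult_left_mono abs_Re_le_cmod) auto
        also have "\<dots> = cmod (complex_of_real h ^ length is * fourier_integral (deriv_symbol is) G x)"
          using h by (simp add: norm_mult norm_power)
        also have "\<dots> \<le> cmod (\<Sum>i<n. \<Sum>j = 1..k. b i * a j * fourier_integral (deriv_symbol []) G (?z i j y))
             + cmod (complex_of_real ?c * (LINT w|lborel. E (h *\<^sub>R w) * cis (w \<bullet> x) * G w))"
          unfolding eq by (rule norm_triangle_ineq)
        also have "\<dots> \<le> (\<Sum>i<n. \<Sum>j = 1..k. ?ab i j * \<bar>vv (?z i j y)\<bar>) + R"
        proof (rule add_mono)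
          show "cmod (\<Sum>i<n. \<Sum>j = 1..k. b i * a j * fourier_integral (deriv_symbol []) G (?z i j y))
            \<le> (\<Sum>i<n. \<Sum>j = 1..k. ?ab i j * \<bar>vv (?z i j y)\<bar>)"
          proof (intro sum_norm_le)
            fix i j assume ij: "i \<in> {..<n}" "j \<in> {1..k}"
            have z: "?z i j y \<in> \<Omega>" using ij by (intro dom x y h) auto
            have "fourier_integral (deriv_symbol []) G (?z i j y) = complex_of_real (vv (?z i j y))"
              using sobolev_function_eq_fourier_integral[OF v G d0 z] z by (simp add: vv_def)
            then show "cmod (b i * a j * fourier_integral (deriv_symbol []) G (?z i j y)) \<le> ?ab i j * \<bar>vv (?z i j y)\<bar>"
              by (simp add: norm_mult)
          qed
          have "cmod (LINT w|lborel. E (h *\<^sub>R w) * cis (w \<bullet> x) * G w)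
             \<le> A * h powr (m - ?d / 2) * bessel_mass TYPE(real^'d) (m - ?l) * spectral_norm m G"
            by (rule remainder_integral_bound[OF sG m _ h A]) (use err[OF x y] in \<open>auto simp: E_def T_def\<close>)
          then have "?c * cmod (LINT w|lborel. E (h *\<^sub>R w) * cis (w \<bullet> x) * G w)
             \<le> ?c * (A * h powr (m - ?d / 2) * bessel_mass TYPE(real^'d) (m - ?l) * spectral_norm m G)"
            by (intro mult_left_mono) auto
          then show "cmod (complex_of_real ?c * (LINT w|lborel. E (h *\<^sub>R w) * cis (w \<bullet> x) * G w)) \<le> R"
            by (simp add: norm_mult R_def C2_def mult_ac)
        qed
        finally show ?thesis .
      qed
      \<comment> \<open>Each node contributes an average over a ball scaled by \<open>h j / k\<close>.\<close>
      have term_int: "integrable lborel (\<lambda>y. ?u i j y)"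
        and term_le: "(LINT y|lborel. ?u i j y) \<le> sqrt V * ((h / real k) powr (- ?d / 2) * L2_norm_on \<Omega> v)"
        if j: "j \<in> {1..k}" for i j
      proof -
        define t where "t = h * (real j / real k)"
        have t: "0 < t" using j k h by (simp add: t_def)
        have "h / real k \<le> t" using j k h by (simp add: t_def field_simps)
        then have tp: "t powr (- ?d / 2) \<le> (h / real k) powr (- ?d / 2)"
          using h k by (intro powr_mono2') auto
        have z: "?z i j y = (x + h *\<^sub>R s i - t *\<^sub>R x) + t *\<^sub>R y" for y
          by (simp add: t_def algebra_simps)
        show "integrable lborel (\<lambda>y. ?u i j y)" unfolding z by (rule affine_average_bound(1)[OF vvm _ Vf ivv t]) simp
        have "(LINT y|lborel. ?u i j y) \<le> sqrt V * (t powr (- ?d / 2) * L2_norm_on \<Omega> v)"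
          unfolding z using affine_average_bound(2)[OF vvm _ Vf ivv t] by (simp add: V_def L2)
        also have "\<dots> \<le> sqrt V * ((h / real k) powr (- ?d / 2) * L2_norm_on \<Omega> v)"
          using V tp by (intro mult_left_mono mult_right_mono) (auto simp: L2_norm_on_def set_lebesgue_integral_def intro!: integral_nonneg_AE)
        finally show "(LINT y|lborel. ?u i j y) \<le> sqrt V * ((h / real k) powr (- ?d / 2) * L2_norm_on \<Omega> v)" .
      qed
      let ?N = "L2_norm_on \<Omega> v"
      have "V * (h ^ length is * ?D)
          = (LINT y|lborel. indicator (ball c \<rho>) y * (h ^ length is * ?D))"
        by (simp add: V_def)
      also have "\<dots> \<le> (LINT y|lborel. (\<Sum>i<n. \<Sum>j = 1..k. ?ab i j * ?u i j y) + indicator (ball c \<rho>) y * R)"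
      proof (rule integral_mono)
        show "integrable lborel (\<lambda>y. indicator (ball c \<rho>) y * (h ^ length is * ?D))"
          using Vf by simp
        show "integrable lborel (\<lambda>y. (\<Sum>i<n. \<Sum>j = 1..k. ?ab i j * ?u i j y) + indicator (ball c \<rho>) y * R)"
          using Vf by (intro Bochner_Integration.integrable_add Bochner_Integration.integrable_sum integrable_mult_right term_int) auto
        show "indicator (ball c \<rho>) y * (h ^ length is * ?D)
           \<le> (\<Sum>i<n. \<Sum>j = 1..k. ?ab i j * ?u i j y) + indicator (ball c \<rho>) y * R" for y
          using cell[of y] by (cases "y \<in> ball c \<rho>") auto
      qed
      also have "\<dots> = (\<Sum>i<n. \<Sum>j = 1..k. ?ab i j * (LINT y|lborel. ?u i j y)) + V * R"
      proof -
        have "(LINT y|lborel. (\<Sum>i<n. \<Sum>j = 1..k. ?ab i j * ?u i j y))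
           = (\<Sum>i<n. (LINT y|lborel. (\<Sum>j = 1..k. ?ab i j * ?u i j y)))"
          by (intro Bochner_Integration.integral_sum Bochner_Integration.integrable_sum integrable_mult_right term_int)
        also have "\<dots> = (\<Sum>i<n. \<Sum>j = 1..k. (LINT y|lborel. ?ab i j * ?u i j y))"
          by (intro sum.cong refl Bochner_Integration.integral_sum integrable_mult_right term_int)
        finally have 1: "(LINT y|lborel. (\<Sum>i<n. \<Sum>j = 1..k. ?ab i j * ?u i j y))
           = (\<Sum>i<n. \<Sum>j = 1..k. ?ab i j * (LINT y|lborel. ?u i j y))"
          by (simp only: integral_mult_right_zero)
        have iS: "integrable lborel (\<lambda>y. (\<Sum>i<n. \<Sum>j = 1..k. ?ab i j * ?u i j y))"
          by (intro Bochner_Integration.integrable_sum integrable_mult_right term_int)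
        have iR: "integrable lborel (\<lambda>y. indicator (ball c \<rho>) y * R)" using Vf by simp
        show ?thesis unfolding Bochner_Integration.integral_add[OF iS iR] 1 by (simp add: V_def)
      qed
      also have "\<dots> \<le> (\<Sum>i<n. \<Sum>j = 1..k. ?ab i j * (sqrt V * ((h / real k) powr (- ?d / 2) * ?N))) + V * R"
        by (intro add_right_mono sum_mono mult_left_mono term_le) auto
      also have "\<dots> = S * (sqrt V * ((h / real k) powr (- ?d / 2) * ?N)) + V * R"
        by (simp add: S_def sum_distrib_right)
      also have "(h / real k) powr (- ?d / 2) = h powr (- ?d / 2) * real k powr (?d / 2)"
        using h k by (simp add: powr_divide powr_minus_divide)
      also have "S * (sqrt V * (h powr (- ?d / 2) * real k powr (?d / 2) * ?N)) = V * (C1 * h powr (- ?d / 2) * ?N)"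
      proof -
        have sV: "sqrt V = V / sqrt V" using V by (simp add: real_div_sqrt)
        show ?thesis by (subst sV) (simp add: C1_def mult_ac)
      qed
      finally have "V * (h ^ length is * ?D) \<le> V * (C1 * h powr (- ?d / 2) * ?N + R)"
        by (simp add: algebra_simps)
      then have main: "h ^ length is * ?D \<le> C1 * h powr (- ?d / 2) * ?N + R"
        using V by simp
      have N0: "0 \<le> ?N" by (auto simp: L2_norm_on_def set_lebesgue_integral_def intro!: integral_nonneg_AE)
      have "R = C2 * h powr (- ?d / 2) * (h powr m * spectral_norm m G)"
        by (simp add: R_def powr_diff powr_minus_divide)
      also have "C1 * h powr (- ?d / 2) * ?N + \<dots> \<le> (1 + C1 + C2) * h powr (- ?d / 2) * ?N + (1 + C1 + C2) * h powr (- ?d / 2) * (h powr m * spectral_norm m G)"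
        using C1 C2 N0 by (intro add_mono mult_right_mono) (auto simp: spectral_norm_nonneg)
      finally have "h ^ length is * ?D \<le> (1 + C1 + C2) * h powr (- ?d / 2) * (?N + h powr m * spectral_norm m G)"
        using main by (simp add: algebra_simps)
      then have "h powr (- ?l) * (h ^ length is * ?D)
         \<le> h powr (- ?l) * ((1 + C1 + C2) * h powr (- ?d / 2) * (?N + h powr m * spectral_norm m G))"
        by (intro mult_left_mono) auto
      also have "h powr (- ?l) * (h ^ length is * ?D) = ?D"
        using h by (simp add: powr_minus powr_realpow)
      also have "h powr (- ?l) * ((1 + C1 + C2) * h powr (- ?d / 2) * (?N + h powr m * spectral_norm m G))
        = (1 + C1 + C2) * h powr (- (?l + ?d / 2)) * (?N + h powr m * spectral_norm m G)"
        by (simp add: powr_add[of h "- ?l" "- ?d / 2", simplified] mult_ac powr_diff powr_minus_divide)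
      finally show "\<bar>iterated_partial \<Omega> is v x\<bar> \<le> (1 + C1 + C2) * h powr (- (?l + ?d / 2)) * (?N + h powr m * spectral_norm m G)" .
    qed
  qed
qed

end

section \<open>Sobolev reproducing kernel Hilbert spaces\<close>

lemma le_sobolev_normI:
  assumes v: "v \<in> sobolev_space m \<Omega>" and B: "0 \<le> B"
    and le: "\<And>G. sobolev_extension m \<Omega> v G \<Longrightarrow> X \<le> A + B * spectral_norm m G"
  shows "X \<le> A + B * sobolev_norm m \<Omega> v"
proof (cases "B = 0")
  case True
  then show ?thesis using v le by (auto simp: sobolev_space_def)
next
  case False
  with B have B: "0 < B" by simp
  have "(X - A) / B \<le> sobolev_norm m \<Omega> v"
    unfolding sobolev_norm_def
  proof (rule cInf_greatest)
    show "{sqrt (LINT w|lborel. (1 + (norm w)\<^sup>2) powr m * (cmod (G w))\<^sup>2) | G. sobolev_extension m \<Omega> v G} \<noteq> {}"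
      using v by (auto simp: sobolev_space_def)
    fix s assume "s \<in> {sqrt (LINT w|lborel. (1 + (norm w)\<^sup>2) powr m * (cmod (G w))\<^sup>2) | G. sobolev_extension m \<Omega> v G}"
    then obtain G where G: "sobolev_extension m \<Omega> v G" "s = spectral_norm m G" by (auto simp: spectral_norm_def)
    show "(X - A) / B \<le> s" using le[OF G(1)] B G(2) by (simp add: field_simps)
  qed
  then show ?thesis using B by (simp add: field_simps)
qed

locale sobolev_rkhs = convex_body \<Omega> + rkhs \<Omega> K H ip
  for \<Omega> :: "(real^'d) set" and K H ip +
  fixes m :: real
  assumes sobolev: "equals_sobolev m \<Omega> H ip" and smooth: "m > real CARD('d) / 2"
begin

abbreviation nrm :: "(real^'d \<Rightarrow> real) \<Rightarrow> real" where "nrm \<equiv> ip_norm ip"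

lemma nrm_nonneg: "v \<in> H \<Longrightarrow> 0 \<le> nrm v"
  using ip_nonneg by (simp add: ip_norm_def)

lemma mem_H_iff: "v \<in> H \<longleftrightarrow> v \<in> sobolev_space m \<Omega> \<and> continuous_on \<Omega> v \<and> (\<forall>x. x \<notin> \<Omega> \<longrightarrow> v x = 0)"
  using sobolev by (auto simp: equals_sobolev_def)

lemma continuous_on_H: "v \<in> H \<Longrightarrow> continuous_on \<Omega> v"
  by (simp add: mem_H_iff)

lemma obtain_extension:
  assumes "v \<in> H" obtains G where "sobolev_extension m \<Omega> v G"
  using assms by (auto simp: mem_H_iff sobolev_space_def)

lemma sobolev_norm_le_nrm: "\<exists>b>0. \<forall>v\<in>H. sobolev_norm m \<Omega> v \<le> b * nrm v"
proof -
  obtain a where a: "0 < a" "\<forall>v\<in>H. a * sobolev_norm m \<Omega> v \<le> nrm v"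
    using sobolev by (auto simp: equals_sobolev_def)
  then show ?thesis by (intro exI[of _ "1 / a"]) (auto simp: field_simps)
qed

lemma le_nrmI:
  assumes b: "\<And>v. v \<in> H \<Longrightarrow> sobolev_norm m \<Omega> v \<le> b * nrm v" and v: "v \<in> H" and B: "0 \<le> B"
    and le: "\<And>G. sobolev_extension m \<Omega> v G \<Longrightarrow> X \<le> A + B * spectral_norm m G"
  shows "X \<le> A + B * (b * nrm v)"
proof -
  have "X \<le> A + B * sobolev_norm m \<Omega> v" using v by (intro le_sobolev_normI B le) (auto simp: mem_H_iff)
  also have "\<dots> \<le> A + B * (b * nrm v)" using B b[OF v] by (intro add_left_mono mult_left_mono)
  finally show ?thesis .
qed

text \<open>
  The inequality for extensions survives the infimum over all of them, and the norm of \<open>H\<close> is equivalent to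
  the resulting quotient norm.
\<close>

lemma derivative_interpolation:
  fixes "is" :: "'d list"
  assumes m: "m > real CARD('d) / 2 + real (length is)"
  obtains C where "0 < C"
    "\<And>v x h. \<lbrakk>v \<in> H; x \<in> \<Omega>; 0 < h; h \<le> 1\<rbrakk>
      \<Longrightarrow> \<bar>iterated_partial \<Omega> is v x\<bar>
        \<le> C * h powr (- (real (length is) + real CARD('d) / 2)) * (L2_norm_on \<Omega> v + h powr m * nrm v)"
proof -
  obtain b where b: "0 < b" "\<And>v. v \<in> H \<Longrightarrow> sobolev_norm m \<Omega> v \<le> b * nrm v"
    using sobolev_norm_le_nrm by blast
  obtain C where C: "0 < C" "\<And>v G x h. \<lbrakk>continuous_on \<Omega> v; sobolev_extension m \<Omega> v G; x \<in> \<Omega>; 0 < h; h \<le> 1\<rbrakk>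
      \<Longrightarrow> \<bar>iterated_partial \<Omega> is v x\<bar>
        \<le> C * h powr (- (real (length is) + real CARD('d) / 2)) * (L2_norm_on \<Omega> v + h powr m * spectral_norm m G)"
    by (rule derivative_interpolation_extension[OF m]) blast
  show ?thesis
  proof (rule that[of "C * (1 + b)"])
    show "0 < C * (1 + b)" using C b by simp
    fix v x and h :: real assume v: "v \<in> H" and x: "x \<in> \<Omega>" and h: "0 < h" "h \<le> 1"
    define s where "s = C * h powr (- (real (length is) + real CARD('d) / 2))"
    have s: "0 \<le> s" using C by (simp add: s_def)
    have L: "0 \<le> L2_norm_on \<Omega> v" by (auto simp: L2_norm_on_def set_lebesgue_integral_def intro!: integral_nonneg_AE)
    have "\<bar>iterated_partial \<Omega> is v x\<bar> \<le> s * L2_norm_on \<Omega> v + (s * h powr m) * (b * nrm v)"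
    proof (rule le_nrmI[OF b(2) v])
      fix G assume "sobolev_extension m \<Omega> v G"
      from C(2)[OF continuous_on_H[OF v] this x h]
      show "\<bar>iterated_partial \<Omega> is v x\<bar> \<le> s * L2_norm_on \<Omega> v + (s * h powr m) * spectral_norm m G"
        by (simp add: s_def algebra_simps)
    qed (use s in \<open>auto intro: mult_nonneg_nonneg\<close>)
    also have "\<dots> \<le> s * (1 + b) * L2_norm_on \<Omega> v + s * (1 + b) * (h powr m * nrm v)"
    proof -
      have "s * 1 * L2_norm_on \<Omega> v \<le> s * (1 + b) * L2_norm_on \<Omega> v"
        using s b L by (intro mult_right_mono mult_left_mono) auto
      moreover have "s * b * (h powr m * nrm v) \<le> s * (1 + b) * (h powr m * nrm v)"
        using s b nrm_nonneg[OF v] by (intro mult_right_mono mult_left_mono) auto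
      ultimately show ?thesis by (simp add: mult_ac)
    qed
    finally show "\<bar>iterated_partial \<Omega> is v x\<bar> \<le> C * (1 + b) * h powr (- (real (length is) + real CARD('d) / 2)) * (L2_norm_on \<Omega> v + h powr m * nrm v)"
      by (simp add: s_def algebra_simps)
  qed
qed

lemma derivative_bounded:
  fixes "is" :: "'d list"
  assumes m: "m > real CARD('d) / 2 + real (length is)"
  obtains C where "0 < C" "\<And>v x. \<lbrakk>v \<in> H; x \<in> \<Omega>\<rbrakk> \<Longrightarrow> \<bar>iterated_partial \<Omega> is v x\<bar> \<le> C * nrm v"
proof -
  obtain b where b: "0 < b" "\<And>v. v \<in> H \<Longrightarrow> sobolev_norm m \<Omega> v \<le> b * nrm v"
    using sobolev_norm_le_nrm by blast
  define B where "B = fourier_const TYPE('d) * bessel_mass TYPE(real^'d) (m - real (length is))"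
  have B: "0 \<le> B" by (simp add: B_def bessel_mass_nonneg)
  show ?thesis
  proof (rule that[of "B * b + 1"])
    show "0 < B * b + 1" using B b by (intro add_nonneg_pos) auto
    fix v x assume v: "v \<in> H" and x: "x \<in> \<Omega>"
    have "\<bar>iterated_partial \<Omega> is v x\<bar> \<le> 0 + B * (b * nrm v)"
    proof (rule le_nrmI[OF b(2) v B])
      fix G assume G: "sobolev_extension m \<Omega> v G"
      have sG: "spectral m G" by (rule sobolev_extension_spectral[OF G])
      have "\<bar>iterated_partial \<Omega> is v x\<bar> \<le> cmod (fourier_integral (deriv_symbol is) G x)"
        unfolding iterated_partial_eq_fourier_integral[OF continuous_on_H[OF v] G m x] by (rule abs_Re_le_cmod)
      also have "\<dots> = fourier_const TYPE('d) * cmod (LINT w|lborel. deriv_symbol is w * cis (w \<bullet> x) * G w)"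
        by (simp add: fourier_integral_def norm_mult)
      also have "cmod (LINT w|lborel. deriv_symbol is w * cis (w \<bullet> x) * G w)
         \<le> 1 * bessel_mass TYPE(real^'d) (m - real (length is)) * spectral_norm m G"
        using m by (intro spectral_integral_bound(2)[OF sG, where r = "length is" and A = 1])
          (auto simp: norm_mult intro: symbol_weight_bound)
      finally show "\<bar>iterated_partial \<Omega> is v x\<bar> \<le> 0 + B * spectral_norm m G"
        by (simp add: B_def mult_ac)
    qed
    also have "0 + B * (b * nrm v) \<le> (B * b + 1) * nrm v"
      using nrm_nonneg[OF v] by (simp add: algebra_simps)
    finally show "\<bar>iterated_partial \<Omega> is v x\<bar> \<le> (B * b + 1) * nrm v" .
  qed
qed

text \<open>
  The exponent is half of the smoothness in excess of \<open>d/2 + |is|\<close>, and at most \<open>1\<close>.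
\<close>

lemma derivative_hoelder:
  fixes "is" :: "'d list"
  assumes m: "m > real CARD('d) / 2 + real (length is)"
  obtains C \<beta> where "0 < C" "0 < \<beta>"
    "\<And>v x y. \<lbrakk>v \<in> H; x \<in> \<Omega>; y \<in> \<Omega>\<rbrakk>
      \<Longrightarrow> \<bar>iterated_partial \<Omega> is v x - iterated_partial \<Omega> is v y\<bar> \<le> C * norm (x - y) powr \<beta> * nrm v"
proof -
  obtain b where b: "0 < b" "\<And>v. v \<in> H \<Longrightarrow> sobolev_norm m \<Omega> v \<le> b * nrm v"
    using sobolev_norm_le_nrm by blast
  define \<beta> where "\<beta> = min 1 ((m - real CARD('d) / 2 - real (length is)) / 2)"
  have \<beta>: "0 < \<beta>" "\<beta> \<le> 1" using m by (auto simp: \<beta>_def)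
  have m': "m > real CARD('d) / 2 + real (length is) + \<beta>" using m unfolding \<beta>_def by (auto simp: min_def field_simps)
  define B where "B = fourier_const TYPE('d) * 2 * bessel_mass TYPE(real^'d) (m - (real (length is) + \<beta>))"
  have B: "0 \<le> B" by (simp add: B_def bessel_mass_nonneg)
  show ?thesis
  proof (rule that[of "B * b + 1" \<beta>])
    show "0 < B * b + 1" using B b by (intro add_nonneg_pos) auto
    fix v x y assume v: "v \<in> H" and x: "x \<in> \<Omega>" and y: "y \<in> \<Omega>"
    have "\<bar>iterated_partial \<Omega> is v x - iterated_partial \<Omega> is v y\<bar> \<le> 0 + (B * norm (x - y) powr \<beta>) * (b * nrm v)"
    proof (rule le_nrmI[OF b(2) v])
      fix G assume G: "sobolev_extension m \<Omega> v G"
      have sG: "spectral m G" by (rule sobolev_extension_spectral[OF G])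
      have "\<bar>iterated_partial \<Omega> is v x - iterated_partial \<Omega> is v y\<bar>
        = \<bar>Re (fourier_integral (deriv_symbol is) G x - fourier_integral (deriv_symbol is) G y)\<bar>"
        using iterated_partial_eq_fourier_integral[OF continuous_on_H[OF v] G m] x y by simp
      also have "\<dots> \<le> cmod (fourier_integral (deriv_symbol is) G x - fourier_integral (deriv_symbol is) G y)"
        by (rule abs_Re_le_cmod)
      also have "\<dots> \<le> fourier_const TYPE('d) * (2 * norm (x - y) powr \<beta> *
         bessel_mass TYPE(real^'d) (m - (real (length is) + \<beta>)) * spectral_norm m G)"
        by (rule fourier_integral_hoelder[OF sG \<beta> m'])
      finally show "\<bar>iterated_partial \<Omega> is v x - iterated_partial \<Omega> is v y\<bar> \<le> 0 + (B * norm (x - y) powr \<beta>) * spectral_norm m G"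
        by (simp add: B_def mult_ac)
    qed (use B in \<open>auto intro: mult_nonneg_nonneg\<close>)
    also have "0 + (B * norm (x - y) powr \<beta>) * (b * nrm v) \<le> (B * b + 1) * norm (x - y) powr \<beta> * nrm v"
      using nrm_nonneg[OF v] by (simp add: algebra_simps)
    finally show "\<bar>iterated_partial \<Omega> is v x - iterated_partial \<Omega> is v y\<bar> \<le> (B * b + 1) * norm (x - y) powr \<beta> * nrm v" .
  qed (use \<beta> in simp)
qed

lemma derivative_linear:
  assumes m: "m > real CARD('d) / 2 + real (length is)" and u: "u \<in> H" and v: "v \<in> H" and x: "x \<in> \<Omega>"
  shows "iterated_partial \<Omega> is (\<lambda>x. u x + c * v x) x = iterated_partial \<Omega> is u x + c * iterated_partial \<Omega> is v x"
proof -
  obtain G1 where G1: "sobolev_extension m \<Omega> u G1" using obtain_extension[OF u] .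
  obtain G2 where G2: "sobolev_extension m \<Omega> v G2" using obtain_extension[OF v] .
  show ?thesis
    by (rule iterated_partial_linear[OF continuous_on_H[OF u] G1 continuous_on_H[OF v] G2 m x])
qed

end

section \<open>The ridge form and its reproducing kernel\<close>

context rkhs begin

lemma lincomb_mem: "u \<in> H \<Longrightarrow> v \<in> H \<Longrightarrow> (\<lambda>x. u x + c * v x) \<in> H"
  by (intro add_mem scale_mem)

lemma diff_mem: "u \<in> H \<Longrightarrow> v \<in> H \<Longrightarrow> (\<lambda>x. u x - v x) \<in> H"
  using lincomb_mem[of u v "-1"] by simp

lemma sum_mem: "finite A \<Longrightarrow> (\<And>i. i \<in> A \<Longrightarrow> f i \<in> H) \<Longrightarrow> (\<lambda>x. \<Sum>i\<in>A. c i * f i x) \<in> H"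
proof (induction A rule: finite_induct)
  case (insert i A)
  then have "(\<lambda>x. (\<Sum>i\<in>A. c i * f i x) + c i * f i x) \<in> H" by (intro lincomb_mem) auto
  then show ?case using insert by (simp add: add.commute)
qed (simp add: zero_mem)

lemma ip_lincomb_left: "u \<in> H \<Longrightarrow> v \<in> H \<Longrightarrow> w \<in> H \<Longrightarrow> ip (\<lambda>x. u x + c * v x) w = ip u w + c * ip v w"
  by (simp add: ip_add scale_mem ip_scale)

lemma ip_lincomb_right: "u \<in> H \<Longrightarrow> v \<in> H \<Longrightarrow> w \<in> H \<Longrightarrow> ip w (\<lambda>x. u x + c * v x) = ip w u + c * ip w v"
  by (simp add: ip_sym[of w] lincomb_mem ip_lincomb_left)

definition kernel_section :: "'a \<Rightarrow> 'a \<Rightarrow> real" where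
  "kernel_section y = (\<lambda>x. if x \<in> \<Omega> then K x y else 0)"

lemma kernel_section_mem: "y \<in> \<Omega> \<Longrightarrow> kernel_section y \<in> H"
  unfolding kernel_section_def by (rule kernel_mem)

lemma kernel_section_reproducing: "y \<in> \<Omega> \<Longrightarrow> v \<in> H \<Longrightarrow> ip v (kernel_section y) = v y"
  unfolding kernel_section_def by (rule reproducing)

text \<open>
  For \<open>c = n \<lambda>\<close> and \<open>j = n\<close> this is \<open>n\<close> times the quadratic part of the objective of kernel ridge
  regression.
\<close>

definition ridge_form :: "real \<Rightarrow> (nat \<Rightarrow> 'a) \<Rightarrow> nat \<Rightarrow> ('a \<Rightarrow> real) \<Rightarrow> ('a \<Rightarrow> real) \<Rightarrow> real" where
  "ridge_form c xs j u v = c * ip u v + (\<Sum>i<j. u (xs i) * v (xs i))"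

lemma ridge_form_sym: "u \<in> H \<Longrightarrow> v \<in> H \<Longrightarrow> ridge_form c xs j u v = ridge_form c xs j v u"
  by (simp add: ridge_form_def ip_sym[of u v] mult.commute)

lemma ridge_form_lincomb_right:
  "u \<in> H \<Longrightarrow> v \<in> H \<Longrightarrow> w \<in> H \<Longrightarrow>
    ridge_form c xs j w (\<lambda>x. u x + a * v x) = ridge_form c xs j w u + a * ridge_form c xs j w v"
  by (simp add: ridge_form_def ip_lincomb_right algebra_simps sum.distrib sum_distrib_left)

lemma ridge_form_zero_right: "w \<in> H \<Longrightarrow> ridge_form c xs j w (\<lambda>x. 0) = 0"
  using ip_lincomb_right[of "\<lambda>x. 0" "\<lambda>x. 0" w 1] by (simp add: ridge_form_def zero_mem)

lemma ridge_form_nonneg: "0 \<le> c \<Longrightarrow> v \<in> H \<Longrightarrow> 0 \<le> ridge_form c xs j v v"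
  by (simp add: ridge_form_def ip_nonneg sum_nonneg)

lemma ridge_form_sum_right:
  "finite A \<Longrightarrow> (\<And>i. i \<in> A \<Longrightarrow> f i \<in> H) \<Longrightarrow> w \<in> H \<Longrightarrow>
    ridge_form c xs j w (\<lambda>x. \<Sum>i\<in>A. b i * f i x) = (\<Sum>i\<in>A. b i * ridge_form c xs j w (f i))"
proof (induction A rule: finite_induct)
  case (insert i A)
  have "ridge_form c xs j w (\<lambda>x. (\<Sum>i\<in>A. b i * f i x) + b i * f i x)
     = ridge_form c xs j w (\<lambda>x. \<Sum>i\<in>A. b i * f i x) + b i * ridge_form c xs j w (f i)"
    using insert by (intro ridge_form_lincomb_right sum_mem) auto
  then show ?case using insert by (simp add: add.commute)
qed (simp add: ridge_form_zero_right)

text \<open>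
  The form grows by the rank-one term \<open>u(x\<^sub>j) v(x\<^sub>j)\<close> with every design point, and its reproducing kernel changes
  accordingly by the Sherman-Morrison formula. Compared with inverting the kernel matrix, the recursion exhibits the
  values as rational functions of kernel values, and every step can be verified by evaluating the form.
  The first point argument labels the section.
\<close>

primrec ridge_kernel :: "real \<Rightarrow> (nat \<Rightarrow> 'a) \<Rightarrow> nat \<Rightarrow> 'a \<Rightarrow> 'a \<Rightarrow> real" where
  "ridge_kernel c xs 0 y x = kernel_section y x / c"
| "ridge_kernel c xs (Suc j) y x = ridge_kernel c xs j y x
     - ridge_kernel c xs j y (xs j) / (1 + ridge_kernel c xs j (xs j) (xs j)) * ridge_kernel c xs j (xs j) x"

lemma ridge_kernel_Suc:
  "ridge_kernel c xs (Suc j) y = (\<lambda>x. ridge_kernel c xs j y x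
     + (- (ridge_kernel c xs j y (xs j) / (1 + ridge_kernel c xs j (xs j) (xs j)))) * ridge_kernel c xs j (xs j) x)"
  by (simp add: fun_eq_iff)

lemma ridge_kernel_reproducing:
  assumes c: "0 < c"
  shows "(\<And>i. i < j \<Longrightarrow> xs i \<in> \<Omega>) \<Longrightarrow> y \<in> \<Omega> \<Longrightarrow>
    ridge_kernel c xs j y \<in> H \<and> (\<forall>v\<in>H. ridge_form c xs j v (ridge_kernel c xs j y) = v y)"
proof (induction j arbitrary: y)
  case 0
  let ?k = "kernel_section y"
  have k: "?k \<in> H" using 0 by (simp add: kernel_section_mem)
  have eq: "ridge_kernel c xs 0 y = (\<lambda>x. (1 / c) * ?k x)" by (simp add: fun_eq_iff)
  have mem: "(\<lambda>x. (1 / c) * ?k x) \<in> H" by (rule scale_mem[OF k])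
  have "ridge_form c xs 0 v (\<lambda>x. (1 / c) * ?k x) = v y" if v: "v \<in> H" for v
  proof -
    have "ip v (\<lambda>x. (1 / c) * ?k x) = 1 / c * ip v ?k"
      by (subst ip_sym[OF v mem], subst ip_scale[OF k v], subst ip_sym[OF k v], rule refl)
    then show ?thesis using c kernel_section_reproducing[OF 0(2) v] by (simp add: ridge_form_def)
  qed
  with mem show ?case unfolding eq by blast
next
  case (Suc j)
  let ?R = "ridge_kernel c xs j" and ?t = "xs j"
  have t: "?t \<in> \<Omega>" and xs: "\<And>i. i < j \<Longrightarrow> xs i \<in> \<Omega>" using Suc.prems(1) by auto
  have Ry: "?R y \<in> H" "\<And>v. v \<in> H \<Longrightarrow> ridge_form c xs j v (?R y) = v y" using Suc.IH[OF xs Suc.prems(2)] by auto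
  have Rt: "?R ?t \<in> H" "\<And>v. v \<in> H \<Longrightarrow> ridge_form c xs j v (?R ?t) = v ?t" using Suc.IH[OF xs t] by auto
  have pos: "0 \<le> ?R ?t ?t" using ridge_form_nonneg[of c "?R ?t" xs j] c Rt by simp
  let ?a = "- (?R y ?t / (1 + ?R ?t ?t))"
  have mem: "ridge_kernel c xs (Suc j) y \<in> H" unfolding ridge_kernel_Suc by (intro lincomb_mem Ry Rt)
  have "ridge_form c xs (Suc j) v (ridge_kernel c xs (Suc j) y) = v y" if v: "v \<in> H" for v
  proof -
    have "ridge_form c xs (Suc j) v (ridge_kernel c xs (Suc j) y)
       = ridge_form c xs j v (\<lambda>x. ?R y x + ?a * ?R ?t x) + v ?t * (?R y ?t + ?a * ?R ?t ?t)"
      unfolding ridge_kernel_Suc by (simp add: ridge_form_def)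
    also have "\<dots> = v y + ?a * v ?t + v ?t * (?R y ?t + ?a * ?R ?t ?t)"
      unfolding ridge_form_lincomb_right[OF Ry(1) Rt(1) v] Ry(2)[OF v] Rt(2)[OF v] ..
    also have "?R y ?t + ?a * ?R ?t ?t = - ?a"
      using pos by (simp add: field_simps add_nonneg_eq_0_iff)
    finally show ?thesis by (simp del: ridge_kernel.simps)
  qed
  then show ?case using mem by blast
qed

definition ridge_fit :: "real \<Rightarrow> (nat \<Rightarrow> 'a) \<Rightarrow> nat \<Rightarrow> (nat \<Rightarrow> real) \<Rightarrow> 'a \<Rightarrow> real" where
  "ridge_fit c xs n b = (\<lambda>x. \<Sum>i<n. b i * ridge_kernel c xs n (xs i) x)"

lemma ridge_kernel_cong:
  "(\<And>i. i < j \<Longrightarrow> xs i = xs' i) \<Longrightarrow> ridge_kernel c xs j y = ridge_kernel c xs' j y"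
  by (induction j arbitrary: y) (auto simp: fun_eq_iff)

context
  fixes c :: real and xs :: "nat \<Rightarrow> 'a" and n :: nat
  assumes c: "0 < c" and xs: "\<And>i. i < n \<Longrightarrow> xs i \<in> \<Omega>"
begin

lemma ridge_kernel_mem: "y \<in> \<Omega> \<Longrightarrow> ridge_kernel c xs n y \<in> H"
  using ridge_kernel_reproducing[OF c, of n xs y] xs by blast

lemma ridge_form_kernel: "y \<in> \<Omega> \<Longrightarrow> v \<in> H \<Longrightarrow> ridge_form c xs n v (ridge_kernel c xs n y) = v y"
  using ridge_kernel_reproducing[OF c, of n xs y] xs by blast

lemma ridge_fit_mem: "ridge_fit c xs n b \<in> H"
  unfolding ridge_fit_def using xs by (intro sum_mem ridge_kernel_mem) auto

lemma ridge_form_fit: "v \<in> H \<Longrightarrow> ridge_form c xs n v (ridge_fit c xs n b) = (\<Sum>i<n. b i * v (xs i))"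
  unfolding ridge_fit_def using xs
  by (subst ridge_form_sum_right) (auto simp: ridge_kernel_mem ridge_form_kernel)

lemma ridge_form_diff_fit:
  assumes v: "v \<in> H"
  shows "ridge_form c xs n (\<lambda>x. v x - ridge_fit c xs n b x) (\<lambda>x. v x - ridge_fit c xs n b x)
    = ridge_form c xs n v v - 2 * (\<Sum>i<n. b i * v (xs i)) + ridge_form c xs n (ridge_fit c xs n b) (ridge_fit c xs n b)"
proof -
  let ?f = "ridge_fit c xs n b"
  let ?w = "\<lambda>x. v x + (- 1) * ?f x"
  note f = ridge_fit_mem[of b]
  have w: "?w \<in> H" by (rule lincomb_mem[OF v f])
  have "ridge_form c xs n ?w ?w = ridge_form c xs n ?w v + (- 1) * ridge_form c xs n ?w ?f"
    by (rule ridge_form_lincomb_right[OF v f w])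
  also have "ridge_form c xs n ?w v = ridge_form c xs n v v + (- 1) * ridge_form c xs n v ?f"
    by (subst ridge_form_sym[OF w v]) (rule ridge_form_lincomb_right[OF v f v])
  also have "ridge_form c xs n ?w ?f = ridge_form c xs n ?f v + (- 1) * ridge_form c xs n ?f ?f"
    by (subst ridge_form_sym[OF w f]) (rule ridge_form_lincomb_right[OF v f f])
  also have "ridge_form c xs n ?f v = ridge_form c xs n v ?f" by (rule ridge_form_sym[OF f v])
  finally show ?thesis by (simp add: ridge_form_fit[OF v])
qed

lemma ridge_form_zero_iff: "v \<in> H \<Longrightarrow> ridge_form c xs n v v \<le> 0 \<Longrightarrow> v = (\<lambda>x. 0)"
proof (rule ip_definite)
  assume v: "v \<in> H" and le: "ridge_form c xs n v v \<le> 0"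
  have "0 \<le> (\<Sum>i<n. v (xs i) * v (xs i))" by (simp add: sum_nonneg)
  then have "c * ip v v \<le> 0" using le by (simp add: ridge_form_def)
  then show "ip v v = 0" using c ip_nonneg[OF v] by (simp add: mult_le_0_iff)
qed

text \<open>
  Completing the square: up to a constant, \<open>n\<close> times the objective at \<open>v\<close> is the ridge form of \<open>v\<close> minus the
  fit, and this form is definite.
\<close>

lemma krr_estimator_eq_ridge_fit:
  assumes n: "0 < n" and cl: "c = real n * l"
  shows "krr_estimator H ip l n xs ys = ridge_fit c xs n ys"
proof -
  let ?f = "ridge_fit c xs n ys"
  define J where "J = (\<lambda>v. (\<Sum>i<n. (ys i - v (xs i))\<^sup>2) / real n + l * (ip_norm ip v)\<^sup>2)"
  have J: "real n * J v = (\<Sum>i<n. (ys i)\<^sup>2) - 2 * (\<Sum>i<n. ys i * v (xs i)) + ridge_form c xs n v v" if v: "v \<in> H" for v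
  proof -
    have "(\<Sum>i<n. (ys i - v (xs i))\<^sup>2) = (\<Sum>i<n. (ys i)\<^sup>2) - 2 * (\<Sum>i<n. ys i * v (xs i)) + (\<Sum>i<n. v (xs i) * v (xs i))"
      by (simp add: power2_diff sum.distrib sum_subtractf sum_distrib_left power2_eq_square algebra_simps)
    moreover have "(ip_norm ip v)\<^sup>2 = ip v v" using ip_nonneg[OF v] by (simp add: ip_norm_def)
    ultimately show ?thesis using n by (simp add: J_def ridge_form_def cl algebra_simps)
  qed
  have JJ: "real n * J v = real n * J ?f + ridge_form c xs n (\<lambda>x. v x - ?f x) (\<lambda>x. v x - ?f x)" if v: "v \<in> H" for v
    unfolding J[OF v] J[OF ridge_fit_mem] ridge_form_diff_fit[OF v]
    by (simp add: ridge_form_fit[OF ridge_fit_mem])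
  have le: "J ?f \<le> J v" if v: "v \<in> H" for v
  proof -
    have "real n * J ?f \<le> real n * J v"
      using JJ[OF v] ridge_form_nonneg[of c "\<lambda>x. v x - ?f x" xs n] c diff_mem[OF v ridge_fit_mem] by simp
    then show ?thesis using n by simp
  qed
  have "is_arg_min J (\<lambda>v. v \<in> H) v \<longleftrightarrow> v = ?f" for v
  proof
    assume "is_arg_min J (\<lambda>v. v \<in> H) v"
    then have v: "v \<in> H" "J v \<le> J ?f" using ridge_fit_mem[of ys] by (auto simp: is_arg_min_def not_less)
    then have "real n * J v \<le> real n * J ?f" by (intro mult_left_mono) auto
    then have "ridge_form c xs n (\<lambda>x. v x - ?f x) (\<lambda>x. v x - ?f x) \<le> 0" using JJ[OF v(1)] by simp
    from ridge_form_zero_iff[OF diff_mem[OF v(1) ridge_fit_mem] this]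
    show "v = ?f" by (simp add: fun_eq_iff)
  next
    assume "v = ?f"
    then show "is_arg_min J (\<lambda>v. v \<in> H) v" using le ridge_fit_mem[of ys] by (auto simp: is_arg_min_def not_less)
  qed
  then have "(SOME v. is_arg_min J (\<lambda>v. v \<in> H) v) = ?f" by simp
  then show ?thesis by (simp add: krr_estimator_def arg_min_def J_def)
qed

lemma functional_ridge_fit:
  assumes T: "\<And>u v a. u \<in> H \<Longrightarrow> v \<in> H \<Longrightarrow> T (\<lambda>x. u x + a * v x) = T u + a * T v"
  shows "T (ridge_fit c xs n b) = (\<Sum>i<n. b i * T (ridge_kernel c xs n (xs i)))"
proof -
  have T0: "T (\<lambda>x. 0) = 0" using T[of "\<lambda>x. 0" "\<lambda>x. 0" 1] zero_mem by simp
  have "j \<le> n \<Longrightarrow> T (\<lambda>x. \<Sum>i<j. b i * ridge_kernel c xs n (xs i) x) = (\<Sum>i<j. b i * T (ridge_kernel c xs n (xs i)))" for j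
  proof (induction j)
    case (Suc j)
    have "T (\<lambda>x. (\<Sum>i<j. b i * ridge_kernel c xs n (xs i) x) + b j * ridge_kernel c xs n (xs j) x)
      = T (\<lambda>x. \<Sum>i<j. b i * ridge_kernel c xs n (xs i) x) + b j * T (ridge_kernel c xs n (xs j))"
      using xs Suc.prems by (intro T sum_mem ridge_kernel_mem) auto
    then show ?case using Suc by simp
  qed (simp add: T0)
  then show ?thesis by (simp add: ridge_fit_def)
qed

text \<open>
  Duality. Let \<open>v\<close> be the fit to the weights \<open>b\<^sub>i = T(R(\<cdot>, x\<^sub>i))\<close> themselves. Then \<open>T v = \<Sum>\<^sub>i b\<^sub>i\<^sup>2\<close>, while the energy
  of any fit is at most the sum of squares of its data.
\<close>

lemma functional_weights_bound:
  assumes T: "\<And>u v a. u \<in> H \<Longrightarrow> v \<in> H \<Longrightarrow> T (\<lambda>x. u x + a * v x) = T u + a * T v"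
    and S: "\<And>v. v \<in> H \<Longrightarrow> \<bar>T v\<bar> \<le> S * sqrt (ridge_form c xs n v v)" and S0: "0 \<le> S"
  shows "(\<Sum>i<n. (T (ridge_kernel c xs n (xs i)))\<^sup>2) \<le> S\<^sup>2"
proof -
  define b where "b = (\<lambda>i. T (ridge_kernel c xs n (xs i)))"
  let ?f = "ridge_fit c xs n b"
  let ?q = "ridge_form c xs n ?f ?f"
  define B where "B = (\<Sum>i<n. (b i)\<^sup>2)"
  have B0: "0 \<le> B" by (simp add: B_def sum_nonneg)
  have q0: "0 \<le> ?q" using c by (intro ridge_form_nonneg ridge_fit_mem) auto
  define F where "F = (\<Sum>i<n. (?f (xs i))\<^sup>2)"
  have q: "?q = (\<Sum>i<n. b i * ?f (xs i))" by (rule ridge_form_fit[OF ridge_fit_mem])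
  have "?q\<^sup>2 \<le> B * F"
    unfolding q B_def F_def by (rule Cauchy_Schwarz_ineq_sum)
  also have "F \<le> ?q"
  proof -
    have "?q = c * ip ?f ?f + F" by (simp only: ridge_form_def F_def power2_eq_square)
    moreover have "0 \<le> c * ip ?f ?f" using c ip_nonneg[OF ridge_fit_mem] by simp
    ultimately show ?thesis by linarith
  qed
  then have "B * F \<le> B * ?q" using B0 by (rule mult_left_mono)
  finally have "?q * ?q \<le> B * ?q" by (simp only: power2_eq_square)
  then have qB: "?q \<le> B"
  proof (cases "?q = 0")
    case False
    then have "0 < ?q" using q0 by linarith
    with \<open>?q * ?q \<le> B * ?q\<close> show ?thesis by (rule mult_right_le_imp_le)
  qed (use B0 in simp)
  have "T ?f = (\<Sum>i<n. b i * T (ridge_kernel c xs n (xs i)))" by (rule functional_ridge_fit[OF T])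
  then have "T ?f = (\<Sum>i<n. b i * b i)" by (simp add: b_def)
  then have "B = T ?f" by (simp only: B_def power2_eq_square)
  also have "\<dots> \<le> S * sqrt ?q" using S[OF ridge_fit_mem] by (rule order_trans[OF abs_ge_self])
  also have "\<dots> \<le> S * sqrt B" using qB S0 by (intro mult_left_mono) auto
  finally have "sqrt B * sqrt B \<le> S * sqrt B" using B0 by simp
  then have "sqrt B \<le> S"
  proof (cases "B = 0")
    case False
    then have "0 < sqrt B" using B0 by simp
    with \<open>sqrt B * sqrt B \<le> S * sqrt B\<close> show ?thesis by (rule mult_right_le_imp_le)
  qed (use S0 in simp)
  then have "(sqrt B)\<^sup>2 \<le> S\<^sup>2" using B0 by (intro power_mono) auto
  then show ?thesis using B0 by (simp add: B_def b_def)
qed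

lemma ridge_kernel_diagonal_bound:
  assumes y: "y \<in> \<Omega>" and S: "\<And>v. v \<in> H \<Longrightarrow> \<bar>v y\<bar> \<le> S * sqrt (ridge_form c xs n v v)" and S0: "0 \<le> S"
  shows "0 \<le> ridge_kernel c xs n y y" "ridge_kernel c xs n y y \<le> S\<^sup>2"
proof -
  let ?r = "ridge_kernel c xs n y y"
  have eq: "ridge_form c xs n (ridge_kernel c xs n y) (ridge_kernel c xs n y) = ?r"
    by (rule ridge_form_kernel[OF y ridge_kernel_mem[OF y]])
  show r: "0 \<le> ?r" using ridge_form_nonneg[of c "ridge_kernel c xs n y" xs n] c ridge_kernel_mem[OF y] eq by simp
  have "sqrt ?r * sqrt ?r \<le> S * sqrt ?r" using S[OF ridge_kernel_mem[OF y]] r eq by simp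
  then have "sqrt ?r \<le> S"
  proof (cases "?r = 0")
    case False
    then have "0 < sqrt ?r" using r by simp
    with \<open>sqrt ?r * sqrt ?r \<le> S * sqrt ?r\<close> show ?thesis by (rule mult_right_le_imp_le)
  qed (use S0 in simp)
  then have "(sqrt ?r)\<^sup>2 \<le> S\<^sup>2" using r by (intro power_mono) auto
  then show "?r \<le> S\<^sup>2" using r by simp
qed

text \<open>
  In this form the energy of the fit to the errors is a quadratic form in the errors, whose mean is
  determined by the diagonal of the kernel.
\<close>

lemma ridge_energy_expansion:
  "ridge_form c xs n (ridge_fit c xs n b) (ridge_fit c xs n b)
    = (\<Sum>i<n. \<Sum>j<n. b i * b j * ridge_kernel c xs n (xs j) (xs i))"
  unfolding ridge_form_fit[OF ridge_fit_mem] by (simp add: ridge_fit_def sum_distrib_left mult_ac)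

end

end

section \<open>Measurable dependence on the design\<close>

context sobolev_rkhs begin

text \<open>
  The square of the norm of \<open>w = K(\<cdot>, y) - K(\<cdot>, y')\<close> equals \<open>w(y) - w(y')\<close>, to which the Hoelder bound for \<open>w\<close>
  applies; one factor of the norm cancels.
\<close>

lemma kernel_section_hoelder:
  obtains C \<beta> where "0 < C" "0 < \<beta>"
    "\<And>y y'. \<lbrakk>y \<in> \<Omega>; y' \<in> \<Omega>\<rbrakk> \<Longrightarrow> nrm (\<lambda>x. kernel_section y x - kernel_section y' x) \<le> C * norm (y - y') powr \<beta>"
proof -
  have m0: "m > real CARD('d) / 2 + real (length ([] :: 'd list))" using smooth by simp
  obtain C \<beta> where C: "0 < C" "0 < \<beta>" and h: "\<And>v x y. \<lbrakk>v \<in> H; x \<in> \<Omega>; y \<in> \<Omega>\<rbrakk>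
      \<Longrightarrow> \<bar>iterated_partial \<Omega> [] v x - iterated_partial \<Omega> [] v y\<bar> \<le> C * norm (x - y) powr \<beta> * nrm v"
    by (rule derivative_hoelder[OF m0]) blast
  show ?thesis
  proof (rule that[OF C])
    fix y y' assume y: "y \<in> \<Omega>" "y' \<in> \<Omega>"
    let ?k = "kernel_section y" and ?k' = "kernel_section y'"
    define w where "w = (\<lambda>x. ?k x - ?k' x)"
    note k = kernel_section_mem[OF y(1)] kernel_section_mem[OF y(2)]
    have w: "w \<in> H" unfolding w_def by (rule diff_mem[OF k])
    have "ip w w = ip w (\<lambda>x. ?k x + (- 1) * ?k' x)" by (simp add: w_def)
    also have "\<dots> = ip w ?k + (- 1) * ip w ?k'" by (rule ip_lincomb_right[OF k w])
    also have "\<dots> = w y - w y'" using y w by (simp add: kernel_section_reproducing)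
    also have "\<dots> \<le> C * norm (y - y') powr \<beta> * nrm w" using h[OF w y] by simp
    finally have "ip w w \<le> C * norm (y - y') powr \<beta> * nrm w" .
    moreover have "ip w w = nrm w * nrm w" using ip_nonneg[OF w] by (simp add: ip_norm_def)
    ultimately have "nrm w * nrm w \<le> (C * norm (y - y') powr \<beta>) * nrm w" by simp
    then have "nrm w \<le> C * norm (y - y') powr \<beta>"
      using nrm_nonneg[OF w] C by (cases "nrm w = 0") (auto simp: mult_le_cancel_right)
    then show "nrm (\<lambda>x. ?k x - ?k' x) \<le> C * norm (y - y') powr \<beta>" by (simp add: w_def)
  qed
qed

lemma derivative_continuous_on:
  assumes m: "m > real CARD('d) / 2 + real (length is)" and v: "v \<in> H"
  shows "continuous_on \<Omega> (iterated_partial \<Omega> is v)"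
proof -
  obtain C \<beta> where C: "0 < C" "0 < \<beta>" and h: "\<And>v x y. \<lbrakk>v \<in> H; x \<in> \<Omega>; y \<in> \<Omega>\<rbrakk>
      \<Longrightarrow> \<bar>iterated_partial \<Omega> is v x - iterated_partial \<Omega> is v y\<bar> \<le> C * norm (x - y) powr \<beta> * nrm v"
    by (rule derivative_hoelder[OF m]) blast
  show ?thesis by (rule continuous_on_of_powr_bound[OF C(2), of _ _ "C * nrm v"]) (use h[OF v] in \<open>auto simp: mult_ac\<close>)
qed

lemma derivative_kernel_continuous_on:
  assumes m: "m > real CARD('d) / 2 + real (length is)" and x: "x \<in> \<Omega>"
  shows "continuous_on \<Omega> (\<lambda>y. iterated_partial \<Omega> is (kernel_section y) x)"
proof -
  obtain C \<beta> where C: "0 < C" "0 < \<beta>" and h: "\<And>y y'. \<lbrakk>y \<in> \<Omega>; y' \<in> \<Omega>\<rbrakk> \<Longrightarrow> nrm (\<lambda>x. kernel_section y x - kernel_section y' x) \<le> C * norm (y - y') powr \<beta>"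
    by (rule kernel_section_hoelder) blast
  obtain B where B: "0 < B" "\<And>v x. \<lbrakk>v \<in> H; x \<in> \<Omega>\<rbrakk> \<Longrightarrow> \<bar>iterated_partial \<Omega> is v x\<bar> \<le> B * nrm v"
    by (rule derivative_bounded[OF m]) blast
  show ?thesis
  proof (rule continuous_on_of_powr_bound[OF C(2), of _ _ "B * C"])
    fix y y' assume y: "y \<in> \<Omega>" "y' \<in> \<Omega>"
    let ?w = "\<lambda>x. kernel_section y x + (- 1) * kernel_section y' x"
    note k = kernel_section_mem[OF y(1)] kernel_section_mem[OF y(2)]
    have "\<bar>iterated_partial \<Omega> is (kernel_section y) x - iterated_partial \<Omega> is (kernel_section y') x\<bar>
      = \<bar>iterated_partial \<Omega> is ?w x\<bar>"
      by (subst derivative_linear[OF m k x]) simp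
    also have "\<dots> \<le> B * nrm ?w" by (rule B(2)[OF lincomb_mem[OF k] x])
    also have "\<dots> \<le> B * (C * norm (y - y') powr \<beta>)" using h[OF y] B(1) by (intro mult_left_mono) auto
    finally show "norm (iterated_partial \<Omega> is (kernel_section y) x - iterated_partial \<Omega> is (kernel_section y') x) \<le> B * C * norm (y - y') powr \<beta>" by simp
  qed
qed

lemma kernel_section_continuous_on:
  "continuous_on (\<Omega> \<times> \<Omega>) (\<lambda>(y, x). kernel_section y x)"
proof -
  have m0: "m > real CARD('d) / 2 + real (length ([] :: 'd list))" using smooth by simp
  obtain C \<beta> where C: "0 < C" "0 < \<beta>" and h: "\<And>y y'. \<lbrakk>y \<in> \<Omega>; y' \<in> \<Omega>\<rbrakk> \<Longrightarrow> nrm (\<lambda>x. kernel_section y x - kernel_section y' x) \<le> C * norm (y - y') powr \<beta>"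
    by (rule kernel_section_hoelder) blast
  obtain B where B: "0 < B" and Bb: "\<And>v x. \<lbrakk>v \<in> H; x \<in> \<Omega>\<rbrakk> \<Longrightarrow> \<bar>iterated_partial \<Omega> [] v x\<bar> \<le> B * nrm v"
    by (rule derivative_bounded[OF m0]) blast
  show ?thesis
    unfolding continuous_on_def
  proof (clarify)
    fix y0 x0 assume y0: "y0 \<in> \<Omega>" and x0: "x0 \<in> \<Omega>"
    let ?F = "at (y0, x0) within \<Omega> \<times> \<Omega>"
    have ev: "\<forall>\<^sub>F p in ?F. fst p \<in> \<Omega> \<and> snd p \<in> \<Omega>"
      by (auto simp: eventually_at intro!: exI[of _ 1])
    have fst: "(fst \<longlongrightarrow> y0) ?F" and snd: "(snd \<longlongrightarrow> x0) ?F"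
      using tendsto_fst[OF tendsto_ident_at[of "(y0, x0)" "\<Omega> \<times> \<Omega>"]] tendsto_snd[OF tendsto_ident_at[of "(y0, x0)" "\<Omega> \<times> \<Omega>"]] by simp_all
    have 1: "((\<lambda>p. kernel_section y0 (snd p)) \<longlongrightarrow> kernel_section y0 x0) ?F"
    proof (rule continuous_on_tendsto_compose[OF continuous_on_H[OF kernel_section_mem[OF y0]] snd x0])
      show "\<forall>\<^sub>F p in ?F. snd p \<in> \<Omega>" using ev by eventually_elim simp
    qed
    have "((\<lambda>p. B * C * norm (fst p - y0) powr \<beta>) \<longlongrightarrow> 0) ?F"
      by (rule tendsto_norm_powr_zero[OF C(2) fst])
    then have 2: "((\<lambda>p. kernel_section (fst p) (snd p) - kernel_section y0 (snd p)) \<longlongrightarrow> 0) ?F"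
    proof (rule Lim_null_comparison[rotated])
      show "\<forall>\<^sub>F p in ?F. norm (kernel_section (fst p) (snd p) - kernel_section y0 (snd p)) \<le> B * C * norm (fst p - y0) powr \<beta>"
        using ev
      proof eventually_elim
        case (elim p)
        then have p: "fst p \<in> \<Omega>" "snd p \<in> \<Omega>" by auto
        let ?w = "\<lambda>x. kernel_section (fst p) x - kernel_section y0 x"
        have "\<bar>?w (snd p)\<bar> \<le> B * nrm ?w"
          using Bb[OF diff_mem[OF kernel_section_mem[OF p(1)] kernel_section_mem[OF y0]] p(2)] by simp
        also have "\<dots> \<le> B * (C * norm (fst p - y0) powr \<beta>)" using h[OF p(1) y0] B by (intro mult_left_mono) auto
        finally show ?case by (simp add: mult_ac)
      qed
    qed
    from tendsto_add[OF 1 2] show "((\<lambda>(y, x). kernel_section y x) \<longlongrightarrow> kernel_section y0 x0) ?F"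
      by (simp add: case_prod_unfold)
  qed
qed

text \<open>
  Kernel and derivatives are continuous on \<open>\<Omega>\<close> only, so measurability is stated for points that are
  measurable functions with values in \<open>\<Omega>\<close>.
\<close>

lemma kernel_section_measurable:
  assumes [measurable]: "f \<in> N \<rightarrow>\<^sub>M borel" "g \<in> N \<rightarrow>\<^sub>M borel"
    and f: "\<And>\<omega>. \<omega> \<in> space N \<Longrightarrow> f \<omega> \<in> \<Omega>" and g: "\<And>\<omega>. \<omega> \<in> space N \<Longrightarrow> g \<omega> \<in> \<Omega>"
  shows "(\<lambda>\<omega>. kernel_section (f \<omega>) (g \<omega>)) \<in> borel_measurable N"
proof -
  have "(\<lambda>p. indicator (\<Omega> \<times> \<Omega>) p *\<^sub>R (case p of (y, x) \<Rightarrow> kernel_section y x)) \<in> borel_measurable borel"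
    by (rule borel_measurable_continuous_on_indicator[OF _ kernel_section_continuous_on])
      (use closed_domain in \<open>auto intro!: borel_closed closed_Times\<close>)
  then have "(\<lambda>p. indicator (\<Omega> \<times> \<Omega>) p *\<^sub>R (case p of (y, x) \<Rightarrow> kernel_section y x)) \<in> borel_measurable (borel \<Otimes>\<^sub>M borel)"
    by (simp add: borel_prod)
  from measurable_compose[OF measurable_Pair[OF assms(1,2)] this]
  show ?thesis by (rule measurable_cong[THEN iffD1, rotated]) (use f g in simp)
qed

lemma derivative_kernel_measurable:
  assumes m: "m > real CARD('d) / 2 + real (length is)" and x: "x \<in> \<Omega>"
    and f_meas: "f \<in> N \<rightarrow>\<^sub>M borel" and f: "\<And>\<omega>. \<omega> \<in> space N \<Longrightarrow> f \<omega> \<in> \<Omega>"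
  shows "(\<lambda>\<omega>. iterated_partial \<Omega> is (kernel_section (f \<omega>)) x) \<in> borel_measurable N"
proof -
  have "(\<lambda>y. indicator \<Omega> y *\<^sub>R iterated_partial \<Omega> is (kernel_section y) x) \<in> borel_measurable borel"
    by (rule borel_measurable_continuous_on_indicator[OF _ derivative_kernel_continuous_on[OF m x]])
      (use closed_domain in auto)
  from measurable_compose[OF f_meas this]
  show ?thesis by (rule measurable_cong[THEN iffD1, rotated]) (use f in simp)
qed

context
  fixes N :: "'w measure" and xs :: "'w \<Rightarrow> nat \<Rightarrow> real^'d" and c :: real and n :: nat
  assumes c: "0 < c" and xs_meas: "\<And>i. i < n \<Longrightarrow> (\<lambda>\<omega>. xs \<omega> i) \<in> N \<rightarrow>\<^sub>M borel"
    and xs_in: "\<And>i \<omega>. i < n \<Longrightarrow> \<omega> \<in> space N \<Longrightarrow> xs \<omega> i \<in> \<Omega>"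
begin

lemma ridge_kernel_measurable:
  "j \<le> n \<Longrightarrow> f \<in> N \<rightarrow>\<^sub>M borel \<Longrightarrow> g \<in> N \<rightarrow>\<^sub>M borel \<Longrightarrow> (\<And>\<omega>. \<omega> \<in> space N \<Longrightarrow> f \<omega> \<in> \<Omega>) \<Longrightarrow>
    (\<And>\<omega>. \<omega> \<in> space N \<Longrightarrow> g \<omega> \<in> \<Omega>) \<Longrightarrow>
    (\<lambda>\<omega>. ridge_kernel c (xs \<omega>) j (f \<omega>) (g \<omega>)) \<in> borel_measurable N"
proof (induction j arbitrary: f g)
  case 0
  then show ?case using kernel_section_measurable[of f N g] by simp
next
  case (Suc j)
  then have j: "j \<le> n" "j < n" by auto
  note [measurable] = Suc.IH[OF j(1) Suc.prems(2,3) Suc.prems(4,5)]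
    Suc.IH[OF j(1) Suc.prems(2) xs_meas[OF j(2)] Suc.prems(4) xs_in[OF j(2)]]
    Suc.IH[OF j(1) xs_meas[OF j(2)] xs_meas[OF j(2)] xs_in[OF j(2)] xs_in[OF j(2)]]
    Suc.IH[OF j(1) xs_meas[OF j(2)] Suc.prems(3) xs_in[OF j(2)] Suc.prems(5)]
  show ?case unfolding ridge_kernel.simps by measurable
qed

lemma derivative_ridge_kernel_measurable:
  assumes m: "m > real CARD('d) / 2 + real (length is)" and x: "x \<in> \<Omega>"
  shows "j \<le> n \<Longrightarrow> f \<in> N \<rightarrow>\<^sub>M borel \<Longrightarrow> (\<And>\<omega>. \<omega> \<in> space N \<Longrightarrow> f \<omega> \<in> \<Omega>) \<Longrightarrow>
    (\<lambda>\<omega>. iterated_partial \<Omega> is (ridge_kernel c (xs \<omega>) j (f \<omega>)) x) \<in> borel_measurable N"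
proof (induction j arbitrary: f)
  case 0
  have "iterated_partial \<Omega> is (ridge_kernel c (xs \<omega>) 0 (f \<omega>)) x = (1 / c) * iterated_partial \<Omega> is (kernel_section (f \<omega>)) x"
    if w: "\<omega> \<in> space N" for \<omega>
  proof -
    note k = kernel_section_mem[OF 0(3)[OF w]]
    have "ridge_kernel c (xs \<omega>) 0 (f \<omega>) = (\<lambda>x. kernel_section (f \<omega>) x + (1 / c - 1) * kernel_section (f \<omega>) x)"
      by (simp add: fun_eq_iff algebra_simps)
    then show ?thesis using derivative_linear[OF m k k x, of "1 / c - 1"] by (simp add: algebra_simps)
  qed
  moreover have "(\<lambda>\<omega>. (1 / c) * iterated_partial \<Omega> is (kernel_section (f \<omega>)) x) \<in> borel_measurable N"
    using derivative_kernel_measurable[OF m x 0(2,3)] by simp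
  ultimately show ?case by (subst measurable_cong) auto
next
  case (Suc j)
  then have j: "j \<le> n" "j < n" by auto
  note [measurable] = Suc.IH[OF j(1) Suc.prems(2) Suc.prems(3)] Suc.IH[OF j(1) xs_meas[OF j(2)] xs_in[OF j(2)]]
    ridge_kernel_measurable[OF j(1) Suc.prems(2) xs_meas[OF j(2)] Suc.prems(3) xs_in[OF j(2)]]
    ridge_kernel_measurable[OF j(1) xs_meas[OF j(2)] xs_meas[OF j(2)] xs_in[OF j(2)] xs_in[OF j(2)]]
  let ?a = "\<lambda>\<omega>. - (ridge_kernel c (xs \<omega>) j (f \<omega>) (xs \<omega> j) / (1 + ridge_kernel c (xs \<omega>) j (xs \<omega> j) (xs \<omega> j)))"
  have "iterated_partial \<Omega> is (ridge_kernel c (xs \<omega>) (Suc j) (f \<omega>)) x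
     = iterated_partial \<Omega> is (ridge_kernel c (xs \<omega>) j (f \<omega>)) x + ?a \<omega> * iterated_partial \<Omega> is (ridge_kernel c (xs \<omega>) j (xs \<omega> j)) x"
    if w: "\<omega> \<in> space N" for \<omega>
    unfolding ridge_kernel_Suc
    by (rule derivative_linear[OF m _ _ x]; rule ridge_kernel_mem[OF c]) (use w j Suc.prems(3) xs_in in auto)
  moreover have "(\<lambda>\<omega>. iterated_partial \<Omega> is (ridge_kernel c (xs \<omega>) j (f \<omega>)) x + ?a \<omega> * iterated_partial \<Omega> is (ridge_kernel c (xs \<omega>) j (xs \<omega> j)) x) \<in> borel_measurable N"
    by measurable
  ultimately show ?case by (subst measurable_cong) auto
qed

end

end

section \<open>Finite nets\<close>

text \<open>
  Cut a cube that contains \<open>S\<close> into cells of side \<open>\<delta> / d\<close>, and choose a point of \<open>S\<close> from every cell that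
  meets it.
\<close>

lemma bounded_finite_net:
  fixes S :: "(real^'d) set"
  assumes S: "bounded S"
  obtains A where "0 < A"
    "\<And>\<delta>. \<lbrakk>0 < \<delta>; \<delta> \<le> 1\<rbrakk> \<Longrightarrow> \<exists>Z. finite Z \<and> Z \<subseteq> S \<and> real (card Z) \<le> A * \<delta> powr (- real CARD('d)) \<and>
        (\<forall>x\<in>S. \<exists>z\<in>Z. norm (x - z) \<le> \<delta>)"
proof -
  obtain R where R: "\<And>x. x \<in> S \<Longrightarrow> norm x \<le> R" "0 < R" using S by (auto simp: bounded_pos)
  define d where "d = real CARD('d)"
  have d: "1 \<le> d" by (simp add: d_def Suc_leI)
  define A where "A = (2 * R * d + 5) ^ CARD('d)"
  show ?thesis
  proof (rule that[of A])
    show "0 < A" using R d by (auto simp: A_def intro!: zero_less_power add_nonneg_pos)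
    fix \<delta> :: real assume \<delta>: "0 < \<delta>" "\<delta> \<le> 1"
    define s where "s = \<delta> / d"
    have s: "0 < s" using \<delta> d by (simp add: s_def)
    define L where "L = \<lceil>R / s\<rceil> + 1"
    define \<phi> where "\<phi> = (\<lambda>(x::real^'d) i. \<lfloor>x $ i / s\<rfloor>)"
    have "0 \<le> R / s" using R s by simp
    then have L: "0 \<le> L" unfolding L_def by linarith
    have sub: "\<phi> ` S \<subseteq> PiE UNIV (\<lambda>_. {- L..L})"
    proof (rule image_subsetI)
      fix x assume x: "x \<in> S"
      have "\<phi> x i \<in> {- L..L}" for i
      proof -
        have xi: "\<bar>x $ i\<bar> \<le> R" using R(1)[OF x] component_le_norm_cart[of x i] by linarith
        have "\<bar>x $ i / s\<bar> \<le> R / s" using xi s by (simp add: divide_right_mono abs_divide)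
        then have "- real_of_int \<lceil>R / s\<rceil> - 1 \<le> x $ i / s" "x $ i / s < 2 + real_of_int \<lceil>R / s\<rceil>" by linarith+
        then show ?thesis unfolding \<phi>_def L_def by (auto simp: le_floor_iff floor_le_iff)
      qed
      then show "\<phi> x \<in> PiE UNIV (\<lambda>_. {- L..L})" by auto
    qed
    have fin: "finite (\<phi> ` S)" by (rule finite_subset[OF sub]) (auto intro: finite_PiE)
    have "card (\<phi> ` S) \<le> card (PiE (UNIV :: 'd set) (\<lambda>_. {- L..L}))"
      by (rule card_mono[OF _ sub]) (auto intro: finite_PiE)
    also have "\<dots> = nat (2 * L + 1) ^ CARD('d)" by (simp add: card_PiE)
    finally have "real (card (\<phi> ` S)) \<le> real (nat (2 * L + 1) ^ CARD('d))" by linarith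
    also have "\<dots> = (2 * real_of_int L + 1) ^ CARD('d)" using L by simp
    also have "\<dots> \<le> ((2 * R * d + 5) / \<delta>) ^ CARD('d)"
    proof (rule power_mono)
      have "real_of_int L \<le> R / s + 2" unfolding L_def by linarith
      then have "2 * real_of_int L + 1 \<le> 2 * (R * d / \<delta>) + 5" by (simp add: s_def)
      also have "\<dots> \<le> 2 * (R * d / \<delta>) + 5 / \<delta>" using \<delta> by (simp add: field_simps)
      finally show "2 * real_of_int L + 1 \<le> (2 * R * d + 5) / \<delta>" by (simp add: add_divide_distrib mult.assoc)
    qed (use L in auto)
    also have "\<dots> = A * \<delta> powr (- real CARD('d))"
      using \<delta> by (simp add: A_def powr_minus powr_realpow divide_inverse power_mult_distrib power_inverse)
    finally have card: "real (card (\<phi> ` S)) \<le> A * \<delta> powr (- real CARD('d))" .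
    define Z where "Z = inv_into S \<phi> ` (\<phi> ` S)"
    show "\<exists>Z. finite Z \<and> Z \<subseteq> S \<and> real (card Z) \<le> A * \<delta> powr (- real CARD('d)) \<and>
        (\<forall>x\<in>S. \<exists>z\<in>Z. norm (x - z) \<le> \<delta>)"
    proof (intro exI[of _ Z] conjI ballI)
      show "finite Z" using fin by (simp add: Z_def)
      show "Z \<subseteq> S" unfolding Z_def by (auto intro: inv_into_into)
      have "card Z \<le> card (\<phi> ` S)" unfolding Z_def by (rule card_image_le[OF fin])
      then show "real (card Z) \<le> A * \<delta> powr (- real CARD('d))" using card by linarith
      fix x assume x: "x \<in> S"
      define z where "z = inv_into S \<phi> (\<phi> x)"
      have zZ: "z \<in> Z" using x by (auto simp: z_def Z_def)
      have eq: "\<phi> z = \<phi> x" unfolding z_def by (rule f_inv_into_f) (use x in auto)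
      have "\<bar>(x - z) $ i\<bar> \<le> s" for i
      proof -
        have "\<lfloor>x $ i / s\<rfloor> = \<lfloor>z $ i / s\<rfloor>" using eq by (auto simp: \<phi>_def fun_eq_iff)
        then have "\<bar>x $ i / s - z $ i / s\<bar> \<le> 1" by linarith
        then have "\<bar>(x $ i - z $ i) / s\<bar> \<le> 1" by (simp add: diff_divide_distrib)
        then show ?thesis using s by (simp add: abs_divide)
      qed
      then have "(\<Sum>i\<in>UNIV. \<bar>(x - z) $ i\<bar>) \<le> (\<Sum>i\<in>(UNIV :: 'd set). s)" by (intro sum_mono)
      then have "norm (x - z) \<le> d * s" using norm_le_l1_cart[of "x - z"] by (simp add: d_def)
      also have "d * s = \<delta>" using d by (simp add: s_def)
      finally show "\<exists>z\<in>Z. norm (x - z) \<le> \<delta>" using zZ by blast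
    qed
  qed
qed

section \<open>Independent and subgaussian errors\<close>

text \<open>
  Independence is a property of the generated \<open>\<sigma>\<close>-algebras here: design and errors take values in different
  types, so they cannot be members of one independent family.
\<close>

lemma (in prob_space) distr_pair_of_indep_set:
  assumes X: "X \<in> M \<rightarrow>\<^sub>M S" and Y: "Y \<in> M \<rightarrow>\<^sub>M T"
    and indep: "indep_set (sets (vimage_algebra (space M) X S)) (sets (vimage_algebra (space M) Y T))"
  shows "distr M S X \<Otimes>\<^sub>M distr M T Y = distr M (S \<Otimes>\<^sub>M T) (\<lambda>\<omega>. (X \<omega>, Y \<omega>))"
proof (rule pair_measure_eqI)
  have XY: "(\<lambda>\<omega>. (X \<omega>, Y \<omega>)) \<in> M \<rightarrow>\<^sub>M S \<Otimes>\<^sub>M T" using X Y by simp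
  interpret DY: prob_space "distr M T Y" by (rule prob_space_distr[OF Y])
  interpret DX: prob_space "distr M S X" by (rule prob_space_distr[OF X])
  show "sigma_finite_measure (distr M S X)" "sigma_finite_measure (distr M T Y)" by unfold_locales
  show "sets (distr M S X \<Otimes>\<^sub>M distr M T Y) = sets (distr M (S \<Otimes>\<^sub>M T) (\<lambda>\<omega>. (X \<omega>, Y \<omega>)))"
    by (simp cong: sets_pair_measure_cong)
  fix A B assume "A \<in> sets (distr M S X)" "B \<in> sets (distr M T Y)"
  then have A: "A \<in> sets S" and B: "B \<in> sets T" by auto
  have "prob ((X -` A \<inter> space M) \<inter> (Y -` B \<inter> space M)) = prob (X -` A \<inter> space M) * prob (Y -` B \<inter> space M)"
    by (rule indep_setD[OF indep]) (use A B in \<open>auto intro: in_vimage_algebra\<close>)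
  moreover have "(X -` A \<inter> space M) \<inter> (Y -` B \<inter> space M) = (\<lambda>\<omega>. (X \<omega>, Y \<omega>)) -` (A \<times> B) \<inter> space M" by auto
  ultimately show "emeasure (distr M S X) A * emeasure (distr M T Y) B = emeasure (distr M (S \<Otimes>\<^sub>M T) (\<lambda>\<omega>. (X \<omega>, Y \<omega>))) (A \<times> B)"
    using A B by (simp add: emeasure_distr[OF X] emeasure_distr[OF Y] emeasure_distr[OF XY] emeasure_eq_measure ennreal_mult)
qed

lemma (in prob_space) prob_le_of_conditional:
  assumes X: "X \<in> M \<rightarrow>\<^sub>M S" and Y: "Y \<in> M \<rightarrow>\<^sub>M T"
    and indep: "indep_set (sets (vimage_algebra (space M) X S)) (sets (vimage_algebra (space M) Y T))"
    and B: "B \<in> sets (S \<Otimes>\<^sub>M T)" and \<delta>: "0 \<le> \<delta>"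
    and le: "\<And>x. x \<in> space S \<Longrightarrow> prob {\<omega> \<in> space M. (x, Y \<omega>) \<in> B} \<le> \<delta>"
  shows "prob {\<omega> \<in> space M. (X \<omega>, Y \<omega>) \<in> B} \<le> \<delta>"
proof -
  have XY: "(\<lambda>\<omega>. (X \<omega>, Y \<omega>)) \<in> M \<rightarrow>\<^sub>M S \<Otimes>\<^sub>M T" using X Y by simp
  interpret DY: prob_space "distr M T Y" by (rule prob_space_distr[OF Y])
  interpret DX: prob_space "distr M S X" by (rule prob_space_distr[OF X])
  have B': "B \<in> sets (distr M S X \<Otimes>\<^sub>M distr M T Y)"
    using B by (simp cong: sets_pair_measure_cong)
  have "emeasure M {\<omega> \<in> space M. (X \<omega>, Y \<omega>) \<in> B} = emeasure (distr M (S \<Otimes>\<^sub>M T) (\<lambda>\<omega>. (X \<omega>, Y \<omega>))) B"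
    using emeasure_distr[OF XY B] by (simp add: vimage_def Int_def conj_commute)
  also have "\<dots> = emeasure (distr M S X \<Otimes>\<^sub>M distr M T Y) B"
    by (simp only: distr_pair_of_indep_set[OF X Y indep])
  also have "\<dots> = (\<integral>\<^sup>+ x. emeasure (distr M T Y) (Pair x -` B) \<partial>distr M S X)"
    by (rule DY.emeasure_pair_measure_alt[OF B'])
  also have "\<dots> \<le> (\<integral>\<^sup>+ x. ennreal \<delta> \<partial>distr M S X)"
  proof (rule nn_integral_mono)
    fix x assume "x \<in> space (distr M S X)"
    then have x: "x \<in> space S" by simp
    have Bx: "Pair x -` B \<in> sets T" using B by (rule sets_Pair1)
    have "emeasure (distr M T Y) (Pair x -` B) = emeasure M {\<omega> \<in> space M. (x, Y \<omega>) \<in> B}"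
      using emeasure_distr[OF Y Bx] by (simp add: vimage_def Int_def conj_commute)
    also have "\<dots> \<le> ennreal \<delta>" using le[OF x] by (simp add: emeasure_eq_measure ennreal_leI)
    finally show "emeasure (distr M T Y) (Pair x -` B) \<le> ennreal \<delta>" .
  qed
  also have "\<dots> = ennreal \<delta>" using DX.emeasure_space_1 by simp
  finally show ?thesis using \<delta> by (simp add: emeasure_eq_measure)
qed

context regression_model begin

lemma error_measurable [measurable]: "e i \<in> borel_measurable M"
  using errors_indep by (auto simp: indep_vars_def)

text \<open>
  The errors have the same distribution, so moments need to be known only for the first one.
\<close>

lemma error_transfer:
  fixes g :: "real \<Rightarrow> real"
  assumes [measurable]: "g \<in> borel_measurable borel"
  shows "integrable M (\<lambda>\<omega>. g (e i \<omega>)) \<longleftrightarrow> integrable M (\<lambda>\<omega>. g (e 0 \<omega>))"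
    and "(LINT \<omega>|M. g (e i \<omega>)) = (LINT \<omega>|M. g (e 0 \<omega>))"
proof -
  have "integrable M (\<lambda>\<omega>. g (e i \<omega>)) \<longleftrightarrow> integrable (distr M borel (e i)) g" for i
    by (subst integrable_distr_eq) auto
  then show "integrable M (\<lambda>\<omega>. g (e i \<omega>)) \<longleftrightarrow> integrable M (\<lambda>\<omega>. g (e 0 \<omega>))"
    by (simp only: errors_identical[of i])
  have "(LINT \<omega>|M. g (e i \<omega>)) = (LINT x|distr M borel (e i). g x)" for i
    by (subst integral_distr) auto
  then show "(LINT \<omega>|M. g (e i \<omega>)) = (LINT \<omega>|M. g (e 0 \<omega>))"
    by (simp only: errors_identical[of i])
qed

lemma error_integrable: "integrable M (e i)" and error_mean: "expectation (e i) = 0"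
  using error_transfer[of "\<lambda>x. x" i] errors_integrable errors_mean by auto

lemma error_square_integrable: "integrable M (\<lambda>\<omega>. (e i \<omega>)\<^sup>2)"
  and error_square_mean: "(LINT \<omega>|M. (e i \<omega>)\<^sup>2) = (LINT \<omega>|M. (e 0 \<omega>)\<^sup>2)"
  using error_transfer[of "\<lambda>x. x\<^sup>2" i] errors_square_integrable by auto

lemma error_product:
  "integrable M (\<lambda>\<omega>. e i \<omega> * e j \<omega>)"
  "(LINT \<omega>|M. e i \<omega> * e j \<omega>) = (if i = j then (LINT \<omega>|M. (e 0 \<omega>)\<^sup>2) else 0)"
proof -
  have "integrable M (\<lambda>\<omega>. e i \<omega> * e j \<omega>) \<and> (LINT \<omega>|M. e i \<omega> * e j \<omega>) = (if i = j then (LINT \<omega>|M. (e 0 \<omega>)\<^sup>2) else 0)"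
  proof (cases "i = j")
    case True
    then show ?thesis using error_square_integrable[of i] error_square_mean[of i] by (simp add: power2_eq_square)
  next
    case False
    have ind: "indep_vars (\<lambda>_. borel) e {i, j}" by (rule indep_vars_subset[OF errors_indep]) simp
    have "integrable M (\<lambda>\<omega>. \<Prod>k\<in>{i, j}. e k \<omega>)"
      by (rule indep_vars_integrable[OF _ ind]) (auto simp: error_integrable)
    moreover have "(LINT \<omega>|M. (\<Prod>k\<in>{i, j}. e k \<omega>)) = (\<Prod>k\<in>{i, j}. expectation (e k))"
      by (rule indep_vars_lebesgue_integral[OF _ ind]) (auto simp: error_integrable)
    ultimately show ?thesis using False by (simp add: error_mean)
  qed
  then show "integrable M (\<lambda>\<omega>. e i \<omega> * e j \<omega>)"
    "(LINT \<omega>|M. e i \<omega> * e j \<omega>) = (if i = j then (LINT \<omega>|M. (e 0 \<omega>)\<^sup>2) else 0)" by auto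
qed

lemma error_quadratic_form_mean:
  "integrable M (\<lambda>\<omega>. \<Sum>i<n. \<Sum>j<n. e i \<omega> * e j \<omega> * R i j)"
  "(LINT \<omega>|M. (\<Sum>i<n. \<Sum>j<n. e i \<omega> * e j \<omega> * R i j)) = (LINT \<omega>|M. (e 0 \<omega>)\<^sup>2) * (\<Sum>i<n. R i i)"
proof -
  show "integrable M (\<lambda>\<omega>. \<Sum>i<n. \<Sum>j<n. e i \<omega> * e j \<omega> * R i j)"
    by (intro Bochner_Integration.integrable_sum integrable_mult_left error_product)
  have "(LINT \<omega>|M. (\<Sum>i<n. \<Sum>j<n. e i \<omega> * e j \<omega> * R i j)) = (\<Sum>i<n. (LINT \<omega>|M. (\<Sum>j<n. e i \<omega> * e j \<omega> * R i j)))"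
    by (intro Bochner_Integration.integral_sum Bochner_Integration.integrable_sum integrable_mult_left error_product)
  also have "\<dots> = (\<Sum>i<n. \<Sum>j<n. (LINT \<omega>|M. e i \<omega> * e j \<omega> * R i j))"
    by (intro sum.cong refl Bochner_Integration.integral_sum integrable_mult_left error_product)
  also have "\<dots> = (\<Sum>i<n. \<Sum>j<n. if i = j then (LINT \<omega>|M. (e 0 \<omega>)\<^sup>2) * R i j else 0)"
    by (intro sum.cong refl) (simp add: error_product(2))
  also have "\<dots> = (LINT \<omega>|M. (e 0 \<omega>)\<^sup>2) * (\<Sum>i<n. R i i)"
    by (simp add: sum_distrib_left)
  finally show "(LINT \<omega>|M. (\<Sum>i<n. \<Sum>j<n. e i \<omega> * e j \<omega> * R i j)) = (LINT \<omega>|M. (e 0 \<omega>)\<^sup>2) * (\<Sum>i<n. R i i)" .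
qed

context
  fixes \<tau> :: real
  assumes \<tau>: "0 < \<tau>" and sub: "subgaussian M (e 0) \<tau>"
begin

lemma exp_half_le_two: "exp (1 / 2 :: real) \<le> 2"
proof -
  have "(exp (1 / 2 :: real))\<^sup>2 = exp 1" using exp_double[of "1 / 2 :: real"] by simp
  also have "\<dots> \<le> 2\<^sup>2" using exp_le by simp
  finally show ?thesis by (rule power2_le_imp_le) simp
qed

text \<open>
  Compare \<open>2 + x\<^sup>2 / 2 \<le> exp x + exp (- x)\<close> with the bound on the moment generating function at \<open>\<plusminus> 1 / \<tau>\<close>, taking \<open>x = e\<^sub>0 / \<tau>\<close>.
\<close>

lemma error_variance_le: "(LINT \<omega>|M. (e 0 \<omega>)\<^sup>2) \<le> 4 * \<tau>\<^sup>2"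
proof -
  define t where "t = 1 / \<tau>"
  have t: "0 < t" "t\<^sup>2 * \<tau>\<^sup>2 = 1" using \<tau> by (auto simp: t_def power_divide)
  have i: "integrable M (\<lambda>\<omega>. exp (s * e 0 \<omega>))" and l: "(LINT \<omega>|M. exp (s * e 0 \<omega>)) \<le> exp (s\<^sup>2 * \<tau>\<^sup>2 / 2)" for s
    using sub by (auto simp: subgaussian_def)
  have cosh: "2 + x\<^sup>2 / 2 \<le> exp x + exp (- x)" for x :: real
  proof -
    have "2 + y\<^sup>2 / 2 \<le> exp y + exp (- y)" if "0 \<le> y" for y :: real
      using exp_lower_Taylor_quadratic[OF that] exp_ge_add_one_self[of "- y"] by linarith
    from this[of "\<bar>x\<bar>"] show ?thesis by (cases "0 \<le> x") (auto simp: add.commute)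
  qed
  have "t\<^sup>2 * (LINT \<omega>|M. (e 0 \<omega>)\<^sup>2) / 2 + 2 = (LINT \<omega>|M. 2 + (t * e 0 \<omega>)\<^sup>2 / 2)"
    using errors_square_integrable prob_space by (simp add: power_mult_distrib)
  also have "\<dots> \<le> (LINT \<omega>|M. exp (t * e 0 \<omega>) + exp (- t * e 0 \<omega>))"
  proof (rule integral_mono)
    show "integrable M (\<lambda>\<omega>. 2 + (t * e 0 \<omega>)\<^sup>2 / 2)" using errors_square_integrable by (simp add: power_mult_distrib)
    show "integrable M (\<lambda>\<omega>. exp (t * e 0 \<omega>) + exp (- t * e 0 \<omega>))" by (intro Bochner_Integration.integrable_add i)
    show "2 + (t * e 0 \<omega>)\<^sup>2 / 2 \<le> exp (t * e 0 \<omega>) + exp (- t * e 0 \<omega>)" for \<omega> using cosh[of "t * e 0 \<omega>"] by simp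
  qed
  also have "\<dots> = (LINT \<omega>|M. exp (t * e 0 \<omega>)) + (LINT \<omega>|M. exp (- t * e 0 \<omega>))"
    by (intro Bochner_Integration.integral_add i)
  also have "\<dots> \<le> exp (1 / 2) + exp (1 / 2)"
    using l[of t] l[of "- t"] t(2) by (intro add_mono) auto
  also have "\<dots> \<le> 4" using exp_half_le_two by simp
  finally have "t\<^sup>2 * (LINT \<omega>|M. (e 0 \<omega>)\<^sup>2) \<le> 4" by simp
  then have "\<tau>\<^sup>2 * (t\<^sup>2 * (LINT \<omega>|M. (e 0 \<omega>)\<^sup>2)) \<le> \<tau>\<^sup>2 * 4" by (intro mult_left_mono) auto
  also have "\<tau>\<^sup>2 * (t\<^sup>2 * (LINT \<omega>|M. (e 0 \<omega>)\<^sup>2)) = (t\<^sup>2 * \<tau>\<^sup>2) * (LINT \<omega>|M. (e 0 \<omega>)\<^sup>2)" by (simp only: mult_ac)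
  finally show ?thesis unfolding t(2) by simp
qed

lemma subgaussian_sum_mgf:
  "(\<integral>\<^sup>+ \<omega>. ennreal (exp (\<theta> * (\<Sum>i<n. e i \<omega> * w i))) \<partial>M) \<le> ennreal (exp (\<theta>\<^sup>2 * \<tau>\<^sup>2 * (\<Sum>i<n. (w i)\<^sup>2) / 2))"
proof -
  have ind: "indep_vars (\<lambda>_. borel) (\<lambda>i \<omega>. ennreal (exp (\<theta> * (e i \<omega> * w i)))) {..<n}"
    by (rule indep_vars_compose2[OF indep_vars_subset[OF errors_indep]]) auto
  have "(\<integral>\<^sup>+ \<omega>. ennreal (exp (\<theta> * (\<Sum>i<n. e i \<omega> * w i))) \<partial>M)
     = (\<integral>\<^sup>+ \<omega>. (\<Prod>i<n. ennreal (exp (\<theta> * (e i \<omega> * w i)))) \<partial>M)"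
    by (simp add: sum_distrib_left exp_sum prod_ennreal)
  also have "\<dots> = (\<Prod>i<n. \<integral>\<^sup>+ \<omega>. ennreal (exp (\<theta> * (e i \<omega> * w i))) \<partial>M)"
    by (rule indep_vars_nn_integral[OF _ ind]) auto
  also have "\<dots> \<le> (\<Prod>i<n. ennreal (exp ((\<theta> * w i)\<^sup>2 * \<tau>\<^sup>2 / 2)))"
  proof (intro prod_mono_ennreal)
    fix i
    note tr = error_transfer[of "\<lambda>x. exp (\<theta> * (x * w i))" i]
    have i0: "integrable M (\<lambda>\<omega>. exp (\<theta> * (e 0 \<omega> * w i)))" and l0: "(LINT \<omega>|M. exp (\<theta> * (e 0 \<omega> * w i))) \<le> exp ((\<theta> * w i)\<^sup>2 * \<tau>\<^sup>2 / 2)"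
      using sub by (auto simp: subgaussian_def mult_ac dest!: spec[of _ "\<theta> * w i"])
    have "(\<integral>\<^sup>+ \<omega>. ennreal (exp (\<theta> * (e i \<omega> * w i))) \<partial>M) = ennreal (LINT \<omega>|M. exp (\<theta> * (e i \<omega> * w i)))"
      using tr(1) i0 by (intro nn_integral_eq_integral) auto
    also have "\<dots> \<le> ennreal (exp ((\<theta> * w i)\<^sup>2 * \<tau>\<^sup>2 / 2))" using tr(2) l0 by (intro ennreal_leI) simp
    finally show "(\<integral>\<^sup>+ \<omega>. ennreal (exp (\<theta> * (e i \<omega> * w i))) \<partial>M) \<le> ennreal (exp ((\<theta> * w i)\<^sup>2 * \<tau>\<^sup>2 / 2))" .
  qed
  also have "\<dots> = ennreal (exp (\<theta>\<^sup>2 * \<tau>\<^sup>2 * (\<Sum>i<n. (w i)\<^sup>2) / 2))"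
    by (simp add: prod_ennreal exp_sum[symmetric] sum_distrib_left sum_divide_distrib power_mult_distrib mult_ac)
  finally show ?thesis .
qed

text \<open>
  Chernoff's bound with the optimal parameter \<open>t / (\<tau>\<^sup>2 s\<^sup>2)\<close>, applied to the weights and to their negatives.
\<close>

lemma subgaussian_sum_tail:
  assumes s: "0 < s" "(\<Sum>i<n. (w i)\<^sup>2) \<le> s\<^sup>2" and t: "0 < t"
  shows "prob {\<omega> \<in> space M. \<bar>\<Sum>i<n. e i \<omega> * w i\<bar> > t} \<le> 2 * exp (- t\<^sup>2 / (2 * \<tau>\<^sup>2 * s\<^sup>2))"
proof -
  have one: "prob {\<omega> \<in> space M. (\<Sum>i<n. e i \<omega> * w i) > t} \<le> exp (- t\<^sup>2 / (2 * \<tau>\<^sup>2 * s\<^sup>2))"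
    if w: "(\<Sum>i<n. (w i)\<^sup>2) \<le> s\<^sup>2" for w
  proof -
    define \<theta> where "\<theta> = t / (\<tau>\<^sup>2 * s\<^sup>2)"
    have \<theta>: "0 < \<theta>" using t s \<tau> by (simp add: \<theta>_def)
    let ?S = "\<lambda>\<omega>. \<Sum>i<n. e i \<omega> * w i"
    have "{\<omega> \<in> space M. ?S \<omega> > t} \<subseteq> {\<omega> \<in> space M. 1 \<le> ennreal (exp (- \<theta> * t)) * ennreal (exp (\<theta> * ?S \<omega>))}"
      using \<theta> by (auto simp: ennreal_mult[symmetric] exp_add[symmetric])
    then have "emeasure M {\<omega> \<in> space M. ?S \<omega> > t} \<le> emeasure M {\<omega> \<in> space M. 1 \<le> ennreal (exp (- \<theta> * t)) * ennreal (exp (\<theta> * ?S \<omega>))}"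
      by (intro emeasure_mono) auto
    also have "\<dots> \<le> ennreal (exp (- \<theta> * t)) * (\<integral>\<^sup>+ \<omega>. ennreal (exp (\<theta> * ?S \<omega>)) * indicator (space M) \<omega> \<partial>M)"
      using nn_integral_Markov_inequality[where u = "\<lambda>\<omega>. ennreal (exp (\<theta> * ?S \<omega>))" and M = M and A = "space M" and c = "ennreal (exp (- \<theta> * t))"] by simp
    also have "(\<integral>\<^sup>+ \<omega>. ennreal (exp (\<theta> * ?S \<omega>)) * indicator (space M) \<omega> \<partial>M) = (\<integral>\<^sup>+ \<omega>. ennreal (exp (\<theta> * ?S \<omega>)) \<partial>M)"
      by (intro nn_integral_cong) simp
    also have "ennreal (exp (- \<theta> * t)) * (\<integral>\<^sup>+ \<omega>. ennreal (exp (\<theta> * ?S \<omega>)) \<partial>M) \<le> ennreal (exp (- \<theta> * t)) * ennreal (exp (\<theta>\<^sup>2 * \<tau>\<^sup>2 * s\<^sup>2 / 2))"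
    proof (intro mult_left_mono order_trans[OF subgaussian_sum_mgf] ennreal_leI)
      show "exp (\<theta>\<^sup>2 * \<tau>\<^sup>2 * (\<Sum>i<n. (w i)\<^sup>2) / 2) \<le> exp (\<theta>\<^sup>2 * \<tau>\<^sup>2 * s\<^sup>2 / 2)"
        using w by (simp add: divide_right_mono mult_left_mono)
    qed auto
    also have "\<dots> = ennreal (exp (- t\<^sup>2 / (2 * \<tau>\<^sup>2 * s\<^sup>2)))"
    proof -
      have "- \<theta> * t + \<theta>\<^sup>2 * \<tau>\<^sup>2 * s\<^sup>2 / 2 = - t\<^sup>2 / (2 * \<tau>\<^sup>2 * s\<^sup>2)"
        using s \<tau> by (simp add: \<theta>_def power2_eq_square field_simps)
      then show ?thesis by (simp add: ennreal_mult[symmetric] exp_add[symmetric])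
    qed
    finally show ?thesis by (simp add: emeasure_eq_measure)
  qed
  have "{\<omega> \<in> space M. \<bar>\<Sum>i<n. e i \<omega> * w i\<bar> > t}
     = {\<omega> \<in> space M. (\<Sum>i<n. e i \<omega> * w i) > t} \<union> {\<omega> \<in> space M. (\<Sum>i<n. e i \<omega> * - w i) > t}"
    by (auto simp: sum_negf abs_if)
  then have "prob {\<omega> \<in> space M. \<bar>\<Sum>i<n. e i \<omega> * w i\<bar> > t}
     \<le> prob {\<omega> \<in> space M. (\<Sum>i<n. e i \<omega> * w i) > t} + prob {\<omega> \<in> space M. (\<Sum>i<n. e i \<omega> * - w i) > t}"
    by (simp only:) (rule measure_Un_le; measurable)
  also have "\<dots> \<le> exp (- t\<^sup>2 / (2 * \<tau>\<^sup>2 * s\<^sup>2)) + exp (- t\<^sup>2 / (2 * \<tau>\<^sup>2 * s\<^sup>2))"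
    using s by (intro add_mono one) auto
  finally show ?thesis by simp
qed

text \<open>
  By independence only the diagonal contributes to the mean. Markov's inequality
  suffices, as this is a single event, over which no union bound is taken.
\<close>

lemma error_quadratic_form_tail:
  assumes nonneg: "\<And>b :: nat \<Rightarrow> real. 0 \<le> (\<Sum>i<n. \<Sum>j<n. b i * b j * R i j)"
    and diag: "(\<Sum>i<n. R i i) \<le> q" and T: "0 < T" and q: "0 < q"
  shows "prob {\<omega> \<in> space M. (\<Sum>i<n. \<Sum>j<n. e i \<omega> * e j \<omega> * R i j) > T * (\<tau>\<^sup>2 * q)} \<le> 4 / T"
proof -
  let ?Q = "\<lambda>\<omega>. \<Sum>i<n. \<Sum>j<n. e i \<omega> * e j \<omega> * R i j"
  have pos: "0 < T * (\<tau>\<^sup>2 * q)" using T q \<tau> by simp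
  have "prob {\<omega> \<in> space M. ?Q \<omega> > T * (\<tau>\<^sup>2 * q)} \<le> prob {\<omega> \<in> space M. ?Q \<omega> \<ge> T * (\<tau>\<^sup>2 * q)}"
    by (intro finite_measure_mono) auto
  also have "\<dots> \<le> (LINT \<omega>|M. ?Q \<omega>) / (T * (\<tau>\<^sup>2 * q))"
    by (rule integral_Markov_inequality_measure[OF error_quadratic_form_mean(1) sets.top _ pos]) (simp add: nonneg)
  also have "\<dots> = (LINT \<omega>|M. (e 0 \<omega>)\<^sup>2) * (\<Sum>i<n. R i i) / (T * (\<tau>\<^sup>2 * q))"
    by (simp only: error_quadratic_form_mean(2))
  also have "\<dots> \<le> (4 * \<tau>\<^sup>2) * q / (T * (\<tau>\<^sup>2 * q))"
  proof (rule divide_right_mono)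
    have "(LINT \<omega>|M. (e 0 \<omega>)\<^sup>2) * (\<Sum>i<n. R i i) \<le> (LINT \<omega>|M. (e 0 \<omega>)\<^sup>2) * q"
      by (rule mult_left_mono[OF diag]) simp
    also have "\<dots> \<le> 4 * \<tau>\<^sup>2 * q" using error_variance_le q by (intro mult_right_mono) auto
    finally show "(LINT \<omega>|M. (e 0 \<omega>)\<^sup>2) * (\<Sum>i<n. R i i) \<le> 4 * \<tau>\<^sup>2 * q" .
  qed (use pos in simp)
  also have "\<dots> = 4 / T" using \<tau> q by simp
  finally show ?thesis .
qed

end

end

section \<open>Uniform bounds for the noise part\<close>

context sobolev_rkhs begin

text \<open>
  The choice \<open>h = \<lambda>\<^bsup>1/(2m)\<^esup>\<close> balances the two terms of the interpolation inequality: then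
  \<open>h\<^sup>m = \<lambda>\<^bsup>1/2\<^esup>\<close>, and \<open>\<lambda>\<^bsup>1/2\<^esup>\<close> times the norm is at most the root of the ridge form divided by \<open>n\<close>. The lower bound on
  \<open>\<lambda>\<close> absorbs the term \<open>n\<^bsup>-m/d\<^esup>\<close> of the norm comparison.
\<close>

lemma design_functional_bound:
  fixes "is" :: "'d list"
  assumes m: "m > real CARD('d) / 2 + real (length is)"
  obtains C where "0 < C"
    "\<And>n xs lam C1 Ce cc v x. \<lbrakk>1 \<le> n; 0 < lam; lam \<le> 1; norms_comparable \<Omega> H ip m C1 Ce n xs;
        0 < C1; 0 < Ce; 0 \<le> cc; real n powr (- 2 * m / real CARD('d)) \<le> cc * lam; v \<in> H; x \<in> \<Omega>\<rbrakk>
      \<Longrightarrow> \<bar>iterated_partial \<Omega> is v x\<bar>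
        \<le> C * (1 + C1 + Ce * sqrt cc) * (real n powr (- 1 / 2) * lam powr (- (real CARD('d) + 2 * real (length is)) / (4 * m)))
            * sqrt (ridge_form (real n * lam) xs n v v)"
proof -
  let ?d = "real CARD('d)" and ?l = "real (length is)"
  have m0: "0 < m" using smooth by (smt (verit) divide_nonneg_nonneg of_nat_0_le_iff)
  obtain C where C: "0 < C" and interp: "\<And>v x h. \<lbrakk>v \<in> H; x \<in> \<Omega>; 0 < h; h \<le> 1\<rbrakk>
      \<Longrightarrow> \<bar>iterated_partial \<Omega> is v x\<bar> \<le> C * h powr (- (?l + ?d / 2)) * (L2_norm_on \<Omega> v + h powr m * nrm v)"
    by (rule derivative_interpolation[OF m]) blast
  show ?thesis
  proof (rule that[OF C])
    fix n xs and lam C1 Ce cc :: real and v x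
    assume n: "1 \<le> n" and lam: "0 < lam" "lam \<le> 1" and cmp: "norms_comparable \<Omega> H ip m C1 Ce n xs"
      and C1: "0 < C1" and Ce: "0 < Ce" and cc: "0 \<le> cc" and rate: "real n powr (- 2 * m / ?d) \<le> cc * lam"
      and v: "v \<in> H" and x: "x \<in> \<Omega>"
    define q where "q = ridge_form (real n * lam) xs n v v"
    define E where "E = (\<Sum>i<n. (v (xs i))\<^sup>2)"
    have q: "q = real n * lam * ip v v + E" by (simp add: q_def ridge_form_def E_def power2_eq_square)
    have E: "0 \<le> E" by (simp add: E_def sum_nonneg)
    have ip: "0 \<le> ip v v" by (rule ip_nonneg[OF v])
    have n0: "0 < real n" using n by simp
    have qn: "q / real n = lam * ip v v + E / real n" using n0 by (simp add: q add_divide_distrib)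
    define s where "s = sqrt (q / real n)"
    have emp: "empirical_norm n xs v \<le> s"
      unfolding empirical_norm_def s_def E_def[symmetric] qn using lam ip by simp
    have nv: "sqrt lam * nrm v \<le> s"
      unfolding s_def qn ip_norm_def real_sqrt_mult[symmetric] using E n0 by simp
    have s0: "0 \<le> s" by (rule order_trans[OF _ nv]) (use lam nrm_nonneg[OF v] in simp)
    have "real n powr (- m / ?d) = sqrt (real n powr (- 2 * m / ?d))"
    proof -
      have "real n powr (- 2 * m / ?d) = (real n powr (- m / ?d))\<^sup>2"
        by (simp add: power2_eq_square powr_add[symmetric])
      then show ?thesis by simp
    qed
    also have "\<dots> \<le> sqrt (cc * lam)" using rate by simp
    also have "\<dots> = sqrt cc * sqrt lam" by (rule real_sqrt_mult)
    finally have "real n powr (- m / ?d) * nrm v \<le> sqrt cc * sqrt lam * nrm v"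
      by (rule mult_right_mono) (rule nrm_nonneg[OF v])
    also have "\<dots> \<le> sqrt cc * s" using nv cc by (simp add: mult.assoc mult_left_mono)
    finally have rn: "real n powr (- m / ?d) * nrm v \<le> sqrt cc * s" .
    have "L2_norm_on \<Omega> v \<le> max (C1 * empirical_norm n xs v) (Ce * real n powr (- m / ?d) * nrm v)"
      using cmp v by (simp add: norms_comparable_def)
    also have "\<dots> \<le> (C1 + Ce * sqrt cc) * s"
    proof (rule max.boundedI)
      have "C1 * empirical_norm n xs v \<le> C1 * s" using emp C1 by (intro mult_left_mono) auto
      also have "\<dots> \<le> (C1 + Ce * sqrt cc) * s" using Ce cc s0 by (intro mult_right_mono) auto
      finally show "C1 * empirical_norm n xs v \<le> (C1 + Ce * sqrt cc) * s" .
      have "Ce * real n powr (- m / ?d) * nrm v \<le> Ce * (sqrt cc * s)"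
        using rn Ce by (simp add: mult.assoc mult_left_mono)
      also have "\<dots> \<le> (C1 + Ce * sqrt cc) * s" using C1 s0 by (simp add: algebra_simps)
      finally show "Ce * real n powr (- m / ?d) * nrm v \<le> (C1 + Ce * sqrt cc) * s" .
    qed
    finally have L2: "L2_norm_on \<Omega> v \<le> (C1 + Ce * sqrt cc) * s" .
    define h where "h = lam powr (1 / (2 * m))"
    have h: "0 < h" "h \<le> 1" using lam m0 powr_mono2[of "1 / (2 * m)" lam 1] by (auto simp: h_def)
    have hm: "h powr m = sqrt lam" using m0 lam by (simp add: h_def powr_powr powr_half_sqrt)
    have hd: "h powr (- (?l + ?d / 2)) = lam powr (- (?d + 2 * ?l) / (4 * m))"
    proof -
      have "1 / (2 * m) * (- (?l + ?d / 2)) = - (?d + 2 * ?l) / (4 * m)" using m0 by (simp add: field_simps)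
      then show ?thesis by (simp add: h_def powr_powr)
    qed
    have "\<bar>iterated_partial \<Omega> is v x\<bar> \<le> C * h powr (- (?l + ?d / 2)) * (L2_norm_on \<Omega> v + h powr m * nrm v)"
      by (rule interp[OF v x h])
    also have "\<dots> \<le> C * h powr (- (?l + ?d / 2)) * ((C1 + Ce * sqrt cc) * s + s)"
      using L2 nv C by (intro mult_left_mono add_mono) (auto simp: hm)
    also have "s = real n powr (- 1 / 2) * sqrt q"
      using n0 by (simp add: s_def real_sqrt_divide powr_minus_divide powr_half_sqrt[symmetric])
    finally show "\<bar>iterated_partial \<Omega> is v x\<bar> \<le> C * (1 + C1 + Ce * sqrt cc)
        * (real n powr (- 1 / 2) * lam powr (- (?d + 2 * ?l) / (4 * m))) * sqrt (ridge_form (real n * lam) xs n v v)"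
      unfolding hd q_def by (simp add: algebra_simps)
  qed
qed

text \<open>
  The consequences of the norm comparison that the probabilistic estimates use. Unlike the norm comparison, a
  condition on all elements of \<open>H\<close>, they constrain finitely many explicit functions of the design,
  which makes them measurable.
\<close>

definition stable_design ::
  "'d list \<Rightarrow> real \<Rightarrow> nat \<Rightarrow> (real^'d) set \<Rightarrow> real \<Rightarrow> real \<Rightarrow> (nat \<Rightarrow> real^'d) \<Rightarrow> bool" where
  "stable_design is c n Z S q xs \<longleftrightarrow>
     (\<forall>z\<in>Z. (\<Sum>i<n. (iterated_partial \<Omega> is (ridge_kernel c xs n (xs i)) z)\<^sup>2) \<le> S\<^sup>2) \<and>
     (\<Sum>i<n. ridge_kernel c xs n (xs i) (xs i)) \<le> q"

text \<open>
  The complement of this event controls the noise part on the net \<open>Z\<close> and its energy, hence its norm.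
\<close>

definition large_noise ::
  "'d list \<Rightarrow> real \<Rightarrow> nat \<Rightarrow> (real^'d) set \<Rightarrow> real \<Rightarrow> real \<Rightarrow> (nat \<Rightarrow> real^'d) \<Rightarrow> (nat \<Rightarrow> real) \<Rightarrow> bool" where
  "large_noise is c n Z t T xs es \<longleftrightarrow>
     (\<exists>z\<in>Z. \<bar>\<Sum>i<n. es i * iterated_partial \<Omega> is (ridge_kernel c xs n (xs i)) z\<bar> > t) \<or>
     (\<Sum>i<n. \<Sum>j<n. es i * es j * ridge_kernel c xs n (xs j) (xs i)) > T"

lemma stable_design_cong:
  assumes "\<And>i. i < n \<Longrightarrow> xs i = xs' i"
  shows "stable_design is c n Z S q xs = stable_design is c n Z S q xs'"
  using ridge_kernel_cong[OF assms] assms by (simp add: stable_design_def)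

lemma large_noise_cong:
  assumes "\<And>i. i < n \<Longrightarrow> xs i = xs' i" "\<And>i. i < n \<Longrightarrow> es i = es' i"
  shows "large_noise is c n Z t T xs es = large_noise is c n Z t T xs' es'"
  using ridge_kernel_cong[OF assms(1)] assms by (simp add: large_noise_def)

text \<open>
  A union bound over the net, plus one event for the energy.
\<close>

lemma large_noise_prob_fixed_design:
  assumes rm: "regression_model M \<Omega> X e \<sigma>2" and \<tau>: "0 < \<tau>" and sub: "subgaussian M (e 0) \<tau>"
    and xs: "\<And>i. i < n \<Longrightarrow> xs i \<in> \<Omega>" and c: "0 < c" and Z: "finite Z"
    and S: "0 < S" and q: "0 < q" and t: "0 < t" and T: "0 < T" and st: "stable_design is c n Z S q xs"
  shows "measure M {\<omega> \<in> space M. large_noise is c n Z t (T * (\<tau>\<^sup>2 * q)) xs (\<lambda>i. e i \<omega>)}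
     \<le> real (card Z) * (2 * exp (- t\<^sup>2 / (2 * \<tau>\<^sup>2 * S\<^sup>2))) + 4 / T"
proof -
  interpret R: regression_model M \<Omega> X e \<sigma>2 by (rule rm)
  let ?w = "\<lambda>z i. iterated_partial \<Omega> is (ridge_kernel c xs n (xs i)) z"
  let ?R = "\<lambda>i j. ridge_kernel c xs n (xs j) (xs i)"
  let ?A = "\<lambda>z. {\<omega> \<in> space M. \<bar>\<Sum>i<n. e i \<omega> * ?w z i\<bar> > t}"
  let ?B = "{\<omega> \<in> space M. (\<Sum>i<n. \<Sum>j<n. e i \<omega> * e j \<omega> * ?R i j) > T * (\<tau>\<^sup>2 * q)}"
  have eq: "{\<omega> \<in> space M. large_noise is c n Z t (T * (\<tau>\<^sup>2 * q)) xs (\<lambda>i. e i \<omega>)} = (\<Union>z\<in>Z. ?A z) \<union> ?B"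
    by (auto simp: large_noise_def)
  have [measurable]: "?A z \<in> sets M" for z by measurable
  have [measurable]: "?B \<in> sets M" by measurable
  have "measure M ((\<Union>z\<in>Z. ?A z) \<union> ?B) \<le> measure M (\<Union>z\<in>Z. ?A z) + measure M ?B"
    by (rule measure_Un_le) (use Z in \<open>auto intro!: sets.finite_UN\<close>)
  also have "measure M (\<Union>z\<in>Z. ?A z) \<le> (\<Sum>z\<in>Z. measure M (?A z))"
    by (rule measure_UNION_le[OF Z]) simp
  also have "(\<Sum>z\<in>Z. measure M (?A z)) \<le> (\<Sum>z\<in>Z. 2 * exp (- t\<^sup>2 / (2 * \<tau>\<^sup>2 * S\<^sup>2)))"
    by (intro sum_mono R.subgaussian_sum_tail[OF \<tau> sub S _ t]) (use st in \<open>auto simp: stable_design_def\<close>)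
  also have "(\<Sum>z\<in>Z. 2 * exp (- t\<^sup>2 / (2 * \<tau>\<^sup>2 * S\<^sup>2))) = real (card Z) * (2 * exp (- t\<^sup>2 / (2 * \<tau>\<^sup>2 * S\<^sup>2)))" by simp
  also have "measure M ?B \<le> 4 / T"
  proof (rule R.error_quadratic_form_tail[OF \<tau> sub _ _ T q])
    fix b :: "nat \<Rightarrow> real"
    have "ridge_fit c xs n b \<in> H" by (rule ridge_fit_mem[OF c xs])
    from ridge_form_nonneg[OF less_imp_le[OF c] this, of xs n]
    have "0 \<le> ridge_form c xs n (ridge_fit c xs n b) (ridge_fit c xs n b)" .
    also have "\<dots> = (\<Sum>i<n. \<Sum>j<n. b i * b j * ?R i j)" by (rule ridge_energy_expansion[OF c xs])
    finally show "0 \<le> (\<Sum>i<n. \<Sum>j<n. b i * b j * ?R i j)" .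
  next
    show "(\<Sum>i<n. ?R i i) \<le> q" using st by (simp add: stable_design_def)
  qed
  finally show ?thesis unfolding eq by simp
qed

text \<open>
  Measurability is checked on the subspace of designs in \<open>\<Omega>\<close>, where the kernel is continuous.
\<close>

lemma bad_event_measurable:
  assumes m: "m > real CARD('d) / 2 + real (length is)" and c: "0 < c" and Z: "finite Z" "Z \<subseteq> \<Omega>"
  shows "{p \<in> space ((PiM {..<n} (\<lambda>_. borel)) \<Otimes>\<^sub>M (PiM {..<n} (\<lambda>_. borel))). (\<forall>i<n. fst p i \<in> \<Omega>) \<and>
      stable_design is c n Z S q (fst p) \<and> large_noise is c n Z t T (fst p) (snd p)}
    \<in> sets ((PiM {..<n} (\<lambda>_. borel)) \<Otimes>\<^sub>M (PiM {..<n} (\<lambda>_. borel)))"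
proof -
  let ?P = "(PiM {..<n} (\<lambda>_. borel :: (real^'d) measure)) \<Otimes>\<^sub>M (PiM {..<n} (\<lambda>_. borel :: real measure))"
  define G where "G = {p \<in> space ?P. \<forall>i<n. fst p i \<in> \<Omega>}"
  define N where "N = restrict_space ?P G"
  have [measurable]: "\<Omega> \<in> sets borel" using closed_domain by simp
  have comp1: "(\<lambda>p. fst p i) \<in> ?P \<rightarrow>\<^sub>M borel" if "i < n" for i
    using that by (intro measurable_compose[OF measurable_fst measurable_component_singleton]) auto
  have comp2: "(\<lambda>p. snd p i) \<in> ?P \<rightarrow>\<^sub>M borel" if "i < n" for i
    using that by (intro measurable_compose[OF measurable_snd measurable_component_singleton]) auto
  have G: "G \<in> sets ?P"
  proof -
    have "G = space ?P \<inter> (\<Inter>i\<in>{..<n}. (\<lambda>p. fst p i) -` \<Omega> \<inter> space ?P)" if "n \<noteq> 0" using that by (auto simp: G_def)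
    moreover have "(\<Inter>i\<in>{..<n}. (\<lambda>p. fst p i) -` \<Omega> \<inter> space ?P) \<in> sets ?P" if "n \<noteq> 0"
      using that by (intro sets.finite_INT measurable_sets[OF comp1]) auto
    moreover have "G = space ?P" if "n = 0" using that by (auto simp: G_def)
    ultimately show ?thesis by (cases "n = 0") auto
  qed
  have Nspace: "space N = G" using sets.sets_into_space[OF G] by (simp add: N_def space_restrict_space Int_absorb2)
  have x_meas: "(\<lambda>p. fst p i) \<in> N \<rightarrow>\<^sub>M borel" if "i < n" for i
    unfolding N_def by (rule measurable_restrict_space1[OF comp1[OF that]])
  have [measurable]: "(\<lambda>p. snd p i) \<in> N \<rightarrow>\<^sub>M borel" if "i < n" for i
    unfolding N_def by (rule measurable_restrict_space1[OF comp2[OF that]])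
  have x_in: "fst p i \<in> \<Omega>" if "i < n" "p \<in> space N" for i p using that by (simp add: Nspace G_def)
  have [measurable]: "(\<lambda>p. ridge_kernel c (fst p) n (fst p j) (fst p i)) \<in> borel_measurable N" if "i < n" "j < n" for i j
    by (rule ridge_kernel_measurable[where n = n and xs = fst, OF c x_meas x_in order_refl]) (use that in \<open>auto intro: x_meas x_in\<close>)
  have D: "(\<lambda>p. iterated_partial \<Omega> is (ridge_kernel c (fst p) n (fst p i)) z) \<in> borel_measurable N" if "i < n" "z \<in> \<Omega>" for i z
    by (rule derivative_ridge_kernel_measurable[where n = n and xs = fst, OF c x_meas x_in m that(2) order_refl]) (use that in \<open>auto intro: x_meas x_in\<close>)
  have 1: "{p \<in> space N. (\<Sum>i<n. (iterated_partial \<Omega> is (ridge_kernel c (fst p) n (fst p i)) z)\<^sup>2) \<le> S\<^sup>2} \<in> sets N" if "z \<in> Z" for z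
    using D that Z by (intro borel_measurable_le borel_measurable_sum borel_measurable_power) auto
  have 2: "{p \<in> space N. (\<Sum>i<n. ridge_kernel c (fst p) n (fst p i) (fst p i)) \<le> q} \<in> sets N"
    by measurable
  have 3: "{p \<in> space N. \<bar>\<Sum>i<n. snd p i * iterated_partial \<Omega> is (ridge_kernel c (fst p) n (fst p i)) z\<bar> > t} \<in> sets N" if "z \<in> Z" for z
    using D that Z by (intro borel_measurable_less borel_measurable_abs borel_measurable_sum borel_measurable_times) auto
  have 4: "{p \<in> space N. (\<Sum>i<n. \<Sum>j<n. snd p i * snd p j * ridge_kernel c (fst p) n (fst p j) (fst p i)) > T} \<in> sets N"
    by (intro borel_measurable_less borel_measurable_sum borel_measurable_times borel_measurable_const) auto
  have "{p \<in> space N. stable_design is c n Z S q (fst p) \<and> large_noise is c n Z t T (fst p) (snd p)} \<in> sets N"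
    unfolding stable_design_def large_noise_def
    by (intro sets.sets_Collect_conj sets.sets_Collect_disj sets.sets_Collect_finite_All sets.sets_Collect_finite_Ex 1 2 3 4 Z)
  then have "{p \<in> space N. stable_design is c n Z S q (fst p) \<and> large_noise is c n Z t T (fst p) (snd p)} \<in> sets ?P"
    using G unfolding N_def by (subst (asm) sets_restrict_space_iff) (auto intro: sets.Int)
  also have "{p \<in> space N. stable_design is c n Z S q (fst p) \<and> large_noise is c n Z t T (fst p) (snd p)}
     = {p \<in> space ?P. (\<forall>i<n. fst p i \<in> \<Omega>) \<and> stable_design is c n Z S q (fst p) \<and> large_noise is c n Z t T (fst p) (snd p)}"
    by (auto simp: Nspace G_def)
  finally show ?thesis .
qed

text \<open>
  By independence the bound for fixed designs carries over. Designs that are not stable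
  contribute nothing, as stability is part of the event.
\<close>

lemma large_noise_prob_random_design:
  fixes n :: nat
  assumes rm: "regression_model M \<Omega> X e \<sigma>2" and \<tau>: "0 < \<tau>" and sub: "subgaussian M (e 0) \<tau>"
    and m: "m > real CARD('d) / 2 + real (length is)" and c: "0 < c" and Z: "finite Z" "Z \<subseteq> \<Omega>"
    and S: "0 < S" and q: "0 < q" and t: "0 < t" and T: "0 < T"
  defines "bad \<equiv> {\<omega> \<in> space M. stable_design is c n Z S q (\<lambda>i. X n i \<omega>) \<and>
      large_noise is c n Z t (T * (\<tau>\<^sup>2 * q)) (\<lambda>i. X n i \<omega>) (\<lambda>i. e i \<omega>)}"
  shows "bad \<in> sets M"
    and "measure M bad \<le> real (card Z) * (2 * exp (- t\<^sup>2 / (2 * \<tau>\<^sup>2 * S\<^sup>2))) + 4 / T"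
proof -
  interpret R: regression_model M \<Omega> X e \<sigma>2 by (rule rm)
  let ?PX = "PiM {..<n} (\<lambda>_. borel :: (real^'d) measure)" and ?PE = "PiM {..<n} (\<lambda>_. borel :: real measure)"
  define XV where "XV = (\<lambda>\<omega>. \<lambda>i\<in>{..<n}. X n i \<omega>)"
  define EV where "EV = (\<lambda>\<omega>. \<lambda>i\<in>{..<n}. e i \<omega>)"
  have XV: "XV \<in> M \<rightarrow>\<^sub>M ?PX" unfolding XV_def by (rule measurable_restrict) (simp add: R.design_measurable)
  have EV: "EV \<in> M \<rightarrow>\<^sub>M ?PE" unfolding EV_def by (rule measurable_restrict) simp
  have ind: "R.indep_set (sets (vimage_algebra (space M) XV ?PX)) (sets (vimage_algebra (space M) EV ?PE))"
    unfolding XV_def EV_def by (rule R.design_errors_indep)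
  define B where "B = {p \<in> space (?PX \<Otimes>\<^sub>M ?PE). (\<forall>i<n. fst p i \<in> \<Omega>) \<and>
      stable_design is c n Z S q (fst p) \<and> large_noise is c n Z t (T * (\<tau>\<^sup>2 * q)) (fst p) (snd p)}"
  have B: "B \<in> sets (?PX \<Otimes>\<^sub>M ?PE)" unfolding B_def by (rule bad_event_measurable[OF m c Z])
  define \<delta> where "\<delta> = real (card Z) * (2 * exp (- t\<^sup>2 / (2 * \<tau>\<^sup>2 * S\<^sup>2))) + 4 / T"
  have \<delta>: "0 \<le> \<delta>" using T by (simp add: \<delta>_def)
  have bad_eq: "bad = {\<omega> \<in> space M. (XV \<omega>, EV \<omega>) \<in> B}"
  proof -
    have "(XV \<omega>, EV \<omega>) \<in> B \<longleftrightarrow> stable_design is c n Z S q (\<lambda>i. X n i \<omega>) \<and>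
      large_noise is c n Z t (T * (\<tau>\<^sup>2 * q)) (\<lambda>i. X n i \<omega>) (\<lambda>i. e i \<omega>)" if w: "\<omega> \<in> space M" for \<omega>
    proof -
      have "(XV \<omega>, EV \<omega>) \<in> space (?PX \<Otimes>\<^sub>M ?PE)" using measurable_space[OF XV w] measurable_space[OF EV w] by (simp add: space_pair_measure)
      moreover have "\<forall>i<n. XV \<omega> i \<in> \<Omega>" using R.design_in[OF _ w] by (simp add: XV_def)
      moreover have "stable_design is c n Z S q (XV \<omega>) = stable_design is c n Z S q (\<lambda>i. X n i \<omega>)"
        by (rule stable_design_cong) (simp add: XV_def)
      moreover have "large_noise is c n Z t (T * (\<tau>\<^sup>2 * q)) (XV \<omega>) (EV \<omega>) = large_noise is c n Z t (T * (\<tau>\<^sup>2 * q)) (\<lambda>i. X n i \<omega>) (\<lambda>i. e i \<omega>)"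
        by (rule large_noise_cong) (simp_all add: XV_def EV_def)
      ultimately show ?thesis by (simp add: B_def)
    qed
    then show ?thesis by (auto simp: bad_def)
  qed
  have "{\<omega> \<in> space M. (XV \<omega>, EV \<omega>) \<in> B} = (\<lambda>\<omega>. (XV \<omega>, EV \<omega>)) -` B \<inter> space M" by auto
  also have "\<dots> \<in> sets M" by (rule measurable_sets[OF _ B]) (use XV EV in simp)
  finally show "bad \<in> sets M" unfolding bad_eq .
  show "measure M bad \<le> real (card Z) * (2 * exp (- t\<^sup>2 / (2 * \<tau>\<^sup>2 * S\<^sup>2))) + 4 / T"
    unfolding bad_eq \<delta>_def[symmetric]
  proof (rule R.prob_le_of_conditional[OF XV EV ind B \<delta>])
    fix xs assume xs: "xs \<in> space ?PX"
    show "measure M {\<omega> \<in> space M. (xs, EV \<omega>) \<in> B} \<le> \<delta>"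
    proof (cases "(\<forall>i<n. xs i \<in> \<Omega>) \<and> stable_design is c n Z S q xs")
      case True
      have "(xs, EV \<omega>) \<in> B \<longleftrightarrow> large_noise is c n Z t (T * (\<tau>\<^sup>2 * q)) xs (\<lambda>i. e i \<omega>)" if w: "\<omega> \<in> space M" for \<omega>
      proof -
        have "(xs, EV \<omega>) \<in> space (?PX \<Otimes>\<^sub>M ?PE)" using xs measurable_space[OF EV w] by (simp add: space_pair_measure)
        moreover have "large_noise is c n Z t (T * (\<tau>\<^sup>2 * q)) xs (EV \<omega>) = large_noise is c n Z t (T * (\<tau>\<^sup>2 * q)) xs (\<lambda>i. e i \<omega>)"
          by (rule large_noise_cong) (simp_all add: EV_def)
        ultimately show ?thesis using True by (simp add: B_def)
      qed
      then have "{\<omega> \<in> space M. (xs, EV \<omega>) \<in> B} = {\<omega> \<in> space M. large_noise is c n Z t (T * (\<tau>\<^sup>2 * q)) xs (\<lambda>i. e i \<omega>)}" by auto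
      then show ?thesis
        using large_noise_prob_fixed_design[OF rm \<tau> sub _ c Z(1) S q t T, of n xs "is"] True by (simp add: \<delta>_def)
    next
      case False
      then have "{\<omega> \<in> space M. (xs, EV \<omega>) \<in> B} = {}" by (auto simp: B_def)
      then show ?thesis using \<delta> by (simp only: measure_empty)
    qed
  qed
qed

lemma derivative_ridge_fit:
  assumes m: "m > real CARD('d) / 2 + real (length is)" and c: "0 < c" and xs: "\<And>i. i < n \<Longrightarrow> xs i \<in> \<Omega>" and x: "x \<in> \<Omega>"
  shows "iterated_partial \<Omega> is (ridge_fit c xs n b) x = (\<Sum>i<n. b i * iterated_partial \<Omega> is (ridge_kernel c xs n (xs i)) x)"
  by (rule functional_ridge_fit[where T = "\<lambda>v. iterated_partial \<Omega> is v x", OF c xs]) (auto intro: derivative_linear[OF m _ _ x])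

text \<open>
  From \<open>x\<close> to the nearest point of the net, the derivative changes by at most the Hoelder bound, and the
  norm of the fit is bounded by its energy.
\<close>

lemma uniform_bound_from_net:
  assumes m: "m > real CARD('d) / 2 + real (length is)" and c: "0 < c" and xs: "\<And>i. i < n \<Longrightarrow> xs i \<in> \<Omega>"
    and hoelder: "\<And>v x y. \<lbrakk>v \<in> H; x \<in> \<Omega>; y \<in> \<Omega>\<rbrakk>
      \<Longrightarrow> \<bar>iterated_partial \<Omega> is v x - iterated_partial \<Omega> is v y\<bar> \<le> C * norm (x - y) powr \<beta> * nrm v"
    and C: "0 < C" "0 < \<beta>" and Z: "Z \<subseteq> \<Omega>" and net: "\<And>x. x \<in> \<Omega> \<Longrightarrow> \<exists>z\<in>Z. norm (x - z) \<le> \<delta>"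
    and quiet: "\<not> large_noise is c n Z t T xs es" and x: "x \<in> \<Omega>"
  shows "\<bar>iterated_partial \<Omega> is (ridge_fit c xs n es) x\<bar> \<le> t + C * \<delta> powr \<beta> * sqrt (T / c)"
proof -
  let ?f = "ridge_fit c xs n es"
  have f: "?f \<in> H" by (rule ridge_fit_mem[OF c xs])
  obtain z where z: "z \<in> Z" "norm (x - z) \<le> \<delta>" using net[OF x] by blast
  have zO: "z \<in> \<Omega>" using z Z by blast
  have "ridge_form c xs n ?f ?f = (\<Sum>i<n. \<Sum>j<n. es i * es j * ridge_kernel c xs n (xs j) (xs i))"
    by (rule ridge_energy_expansion[OF c xs])
  then have "ridge_form c xs n ?f ?f \<le> T" using quiet unfolding large_noise_def by simp
  then have "c * ip ?f ?f \<le> T"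
    using sum_nonneg[of "{..<n}" "\<lambda>i. ?f (xs i) * ?f (xs i)"] by (simp add: ridge_form_def)
  then have "nrm ?f \<le> sqrt (T / c)" using c by (simp add: ip_norm_def field_simps)
  then have "C * norm (x - z) powr \<beta> * nrm ?f \<le> C * \<delta> powr \<beta> * sqrt (T / c)"
    using C z nrm_nonneg[OF f] by (intro mult_mono mult_left_mono powr_mono2) auto
  moreover have "\<bar>iterated_partial \<Omega> is ?f x - iterated_partial \<Omega> is ?f z\<bar> \<le> C * norm (x - z) powr \<beta> * nrm ?f"
    by (rule hoelder[OF f x zO])
  moreover have "\<bar>iterated_partial \<Omega> is ?f z\<bar> \<le> t"
    using quiet z derivative_ridge_fit[OF m c xs zO, where b = es] by (auto simp: large_noise_def not_less)
  ultimately show ?thesis by linarith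
qed

end

section \<open>The rate\<close>

text \<open>
  A net of \<open>\<lambda>\<^bsup>-k\<^esup>\<close> points is beaten by a tail at the level \<open>(k + b) ln (e / \<lambda>)\<close>, uniformly in \<open>\<lambda> \<le> 1\<close>.
\<close>

lemma exp_tail_times_net_le:
  fixes lam :: real
  assumes lam: "0 < lam" "lam \<le> 1" and A: "0 \<le> A" and b: "0 \<le> b" and N: "N \<le> A * lam powr (- k)"
  shows "N * exp (- ((k + b) * ln (exp 1 / lam))) \<le> A * exp (- k) * exp (- b)"
proof -
  have l: "ln (exp 1 / lam) = 1 - ln lam" using lam by (simp add: ln_div)
  have "N * exp (- ((k + b) * ln (exp 1 / lam))) \<le> A * lam powr (- k) * exp (- ((k + b) * ln (exp 1 / lam)))"
    by (rule mult_right_mono[OF N]) simp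
  also have "\<dots> = A * exp (- k * ln lam + (- ((k + b) * (1 - ln lam))))"
    using lam unfolding l exp_add powr_def by simp
  also have "- k * ln lam + (- ((k + b) * (1 - ln lam))) = - k + (- b + b * ln lam)" by (simp add: algebra_simps)
  also have "A * exp (- k + (- b + b * ln lam)) \<le> A * exp (- k + - b)"
    using A b lam by (intro mult_left_mono) (auto simp: mult_nonneg_nonpos)
  finally show ?thesis unfolding exp_add by (simp only: mult.assoc)
qed

context sobolev_rkhs begin

text \<open>
  The estimator is linear in the data and the errors are centred, so the regression function cancels.
\<close>

lemma krr_derivative_fluctuation:
  assumes rm: "regression_model M \<Omega> X e \<sigma>2" and f: "f \<in> H" and \<omega>: "\<omega> \<in> space M" and n: "1 \<le> n" and lam: "0 < lam"
    and m: "m > real CARD('d) / 2 + real (length is)" and \<alpha>: "\<And>\<Omega>. multi_partial \<Omega> \<alpha> = iterated_partial \<Omega> is" and x: "x \<in> \<Omega>"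
  shows "krr_derivative \<Omega> H ip \<alpha> lam n X f e \<omega> \<omega> x - (LINT \<omega>'|M. krr_derivative \<Omega> H ip \<alpha> lam n X f e \<omega> \<omega>' x)
    = (\<Sum>i<n. e i \<omega> * iterated_partial \<Omega> is (ridge_kernel (real n * lam) (\<lambda>i. X n i \<omega>) n (X n i \<omega>)) x)"
proof -
  interpret R: regression_model M \<Omega> X e \<sigma>2 by (rule rm)
  let ?xs = "\<lambda>i. X n i \<omega>" and ?c = "real n * lam"
  have c: "0 < ?c" using n lam by simp
  have xs: "\<And>i. i < n \<Longrightarrow> ?xs i \<in> \<Omega>" using R.design_in \<omega> by blast
  let ?w = "\<lambda>i. iterated_partial \<Omega> is (ridge_kernel ?c ?xs n (?xs i)) x"
  have est: "krr_derivative \<Omega> H ip \<alpha> lam n X f e \<omega> \<omega>' x = (\<Sum>i<n. (f (?xs i) + e i \<omega>') * ?w i)" for \<omega>'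
  proof -
    have "krr_estimator H ip lam n ?xs (\<lambda>i. f (?xs i) + e i \<omega>') = ridge_fit ?c ?xs n (\<lambda>i. f (?xs i) + e i \<omega>')"
      by (rule krr_estimator_eq_ridge_fit[OF c xs]) (use n in auto)
    then show ?thesis unfolding krr_derivative_def \<alpha> by (simp only: derivative_ridge_fit[OF m c xs x])
  qed
  have i: "integrable M (\<lambda>\<omega>'. (f (?xs i) + e i \<omega>') * ?w i)" for i
    by (intro integrable_mult_left Bochner_Integration.integrable_add R.error_integrable) simp
  have "(LINT \<omega>'|M. (\<Sum>i<n. (f (?xs i) + e i \<omega>') * ?w i)) = (\<Sum>i<n. (LINT \<omega>'|M. (f (?xs i) + e i \<omega>') * ?w i))"
    by (intro Bochner_Integration.integral_sum i)
  also have "\<dots> = (\<Sum>i<n. f (?xs i) * ?w i)"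
    by (intro sum.cong refl) (simp add: R.error_integrable R.error_mean R.prob_space)
  finally show ?thesis unfolding est by (simp add: sum_subtractf[symmetric] algebra_simps sum.distrib)
qed

text \<open>
  The supremum over \<open>\<Omega>\<close> is one over a countable dense subset, by continuity in \<open>x\<close>.
\<close>

lemma fluctuation_event_measurable:
  assumes rm: "regression_model M \<Omega> X e \<sigma>2" and c: "0 < c" and m: "m > real CARD('d) / 2 + real (length is)"
  shows "{\<omega> \<in> space M. \<forall>x\<in>\<Omega>. \<bar>\<Sum>i<n. e i \<omega> * iterated_partial \<Omega> is (ridge_kernel c (\<lambda>i. X n i \<omega>) n (X n i \<omega>)) x\<bar> \<le> r} \<in> sets M"
proof -
  interpret R: regression_model M \<Omega> X e \<sigma>2 by (rule rm)
  let ?D = "\<lambda>\<omega> i x. iterated_partial \<Omega> is (ridge_kernel c (\<lambda>i. X n i \<omega>) n (X n i \<omega>)) x"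
  let ?F = "\<lambda>\<omega> x. \<bar>\<Sum>i<n. e i \<omega> * ?D \<omega> i x\<bar>"
  have xs: "X n i \<omega> \<in> \<Omega>" if "i < n" "\<omega> \<in> space M" for i \<omega> using R.design_in that by blast
  have D: "(\<lambda>\<omega>. ?D \<omega> i x) \<in> borel_measurable M" if "i < n" "x \<in> \<Omega>" for i x
    by (rule derivative_ridge_kernel_measurable[where n = n and xs = "\<lambda>\<omega> i. X n i \<omega>", OF c R.design_measurable xs m that(2) order_refl])
      (use that in \<open>auto intro: R.design_measurable xs\<close>)
  obtain Q where Q: "countable Q" "Q \<subseteq> \<Omega>" "\<Omega> \<subseteq> closure Q" using separable[of \<Omega>] by blast
  have cont: "continuous_on \<Omega> (?F \<omega>)" if "\<omega> \<in> space M" for \<omega>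
    using that xs by (intro continuous_intros derivative_continuous_on[OF m] ridge_kernel_mem[OF c]) auto
  have "{\<omega> \<in> space M. \<forall>x\<in>\<Omega>. ?F \<omega> x \<le> r} = {\<omega> \<in> space M. \<forall>x\<in>Q. ?F \<omega> x \<le> r}"
  proof (intro Collect_cong conj_cong refl iffI)
    fix \<omega> assume w: "\<omega> \<in> space M" and le: "\<forall>x\<in>Q. ?F \<omega> x \<le> r"
    have cl: "closure Q = \<Omega>" using Q closed_domain by (simp add: closure_minimal subset_antisym)
    show "\<forall>x\<in>\<Omega>. ?F \<omega> x \<le> r"
    proof
      fix x assume "x \<in> \<Omega>"
      then show "?F \<omega> x \<le> r"
        using continuous_le_on_closure[of Q "?F \<omega>" x r] cont[OF w] le unfolding cl by blast
    qed
  qed (use Q in auto)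
  also have "\<dots> \<in> sets M"
  proof (rule sets.sets_Collect_countable_All'[OF _ Q(1)])
    fix x assume "x \<in> Q"
    then have "x \<in> \<Omega>" using Q by blast
    then show "{\<omega> \<in> space M. ?F \<omega> x \<le> r} \<in> sets M"
      using D by (intro borel_measurable_le borel_measurable_abs borel_measurable_sum borel_measurable_times borel_measurable_const R.error_measurable) auto
  qed
  finally show ?thesis .
qed

text \<open>
  Up to an event of small probability the design satisfies the norm comparison, hence is stable, and the
  noise is not large. On the remaining event the net bound and the Hoelder step are both of the required order.
  The constant in the logarithm is \<open>e\<close>, so the logarithm is at least \<open>1\<close>; the dimension and the
  mesh only affect the constant of the \<open>O\<close>.
\<close>

theorem krr_fluctuation_rate:
  fixes \<alpha> :: "nat^'d" and lam :: "nat \<Rightarrow> real"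
  assumes m\<alpha>: "m > real CARD('d) / 2 + real (multi_order \<alpha>)"
    and rm: "regression_model M \<Omega> X e \<sigma>2" and f: "f \<in> H" and cmp: "norm_comparison_property M \<Omega> H ip m X"
    and lam: "\<And>n. 1 \<le> n \<Longrightarrow> 0 < lam n \<and> lam n \<le> 1"
    and rate: "(\<lambda>n. real n powr (- 2 * m / real CARD('d))) \<in> O(lam)"
    and \<tau>: "0 < \<tau>" and sub: "subgaussian M (e 0) \<tau>"
  shows "bigO_in_prob M
     (\<lambda>n \<omega>. SUP x\<in>\<Omega>. ereal \<bar>krr_derivative \<Omega> H ip \<alpha> (lam n) n X f e \<omega> \<omega> x
               - (LINT \<omega>'|M. krr_derivative \<Omega> H ip \<alpha> (lam n) n X f e \<omega> \<omega>' x)\<bar>)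
     (\<lambda>n. \<tau> * real n powr (- 1 / 2)
          * lam n powr (- (real CARD('d) + 2 * real (multi_order \<alpha>)) / (4 * m))
          * sqrt (ln (exp 1 / lam n)))" (is "bigO_in_prob M ?Z ?r")
  unfolding bigO_in_prob_def
proof (intro allI impI)
  fix \<epsilon> :: real assume \<epsilon>: "0 < \<epsilon>"
  interpret R: regression_model M \<Omega> X e \<sigma>2 by (rule rm)
  obtain "is" :: "'d list" where len: "length is = multi_order \<alpha>" and \<alpha>: "\<And>\<Omega>. multi_partial \<Omega> \<alpha> = iterated_partial \<Omega> is"
    using multi_partial_eq_iterated_partial[of \<alpha>] by blast
  let ?d = "real CARD('d)" and ?l = "real (length is)"
  have m: "m > ?d / 2 + ?l" using m\<alpha> len by simp
  have m0: "m > ?d / 2 + real (length ([] :: 'd list))" using smooth by simp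
  have mpos: "0 < m" using smooth by (smt (verit) divide_nonneg_nonneg of_nat_0_le_iff)
  obtain C where C: "0 < C" and Cb: "\<And>n xs lam C1 Ce cc v x. \<lbrakk>1 \<le> n; 0 < lam; lam \<le> 1; norms_comparable \<Omega> H ip m C1 Ce n xs;
        0 < C1; 0 < Ce; 0 \<le> cc; real n powr (- 2 * m / ?d) \<le> cc * lam; v \<in> H; x \<in> \<Omega>\<rbrakk>
      \<Longrightarrow> \<bar>iterated_partial \<Omega> is v x\<bar>
        \<le> C * (1 + C1 + Ce * sqrt cc) * (real n powr (- 1 / 2) * lam powr (- (?d + 2 * ?l) / (4 * m)))
            * sqrt (ridge_form (real n * lam) xs n v v)"
    by (rule design_functional_bound[OF m]) blast
  obtain C0 where C0: "0 < C0" and C0b: "\<And>n xs lam C1 Ce cc v x. \<lbrakk>1 \<le> n; 0 < lam; lam \<le> 1; norms_comparable \<Omega> H ip m C1 Ce n xs;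
        0 < C1; 0 < Ce; 0 \<le> cc; real n powr (- 2 * m / ?d) \<le> cc * lam; v \<in> H; x \<in> \<Omega>\<rbrakk>
      \<Longrightarrow> \<bar>iterated_partial \<Omega> [] v x\<bar>
        \<le> C0 * (1 + C1 + Ce * sqrt cc) * (real n powr (- 1 / 2) * lam powr (- (?d + 2 * real (length ([] :: 'd list))) / (4 * m)))
            * sqrt (ridge_form (real n * lam) xs n v v)"
    by (rule design_functional_bound[OF m0]) blast
  obtain CH \<beta> where CH: "0 < CH" "0 < \<beta>" and hoelder: "\<And>v x y. \<lbrakk>v \<in> H; x \<in> \<Omega>; y \<in> \<Omega>\<rbrakk>
      \<Longrightarrow> \<bar>iterated_partial \<Omega> is v x - iterated_partial \<Omega> is v y\<bar> \<le> CH * norm (x - y) powr \<beta> * nrm v"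
    by (rule derivative_hoelder[OF m]) blast
  obtain A where A: "0 < A" and net: "\<And>\<delta>. \<lbrakk>0 < \<delta>; \<delta> \<le> 1\<rbrakk> \<Longrightarrow> \<exists>Z. finite Z \<and> Z \<subseteq> \<Omega> \<and> real (card Z) \<le> A * \<delta> powr (- ?d) \<and>
        (\<forall>x\<in>\<Omega>. \<exists>z\<in>Z. norm (x - z) \<le> \<delta>)"
    by (rule bounded_finite_net[OF compact_imp_bounded[OF compact_domain]]) blast
  define \<epsilon>' where "\<epsilon>' = min (\<epsilon> / 2) (1 / 2)"
  have \<epsilon>': "0 < \<epsilon>'" "\<epsilon>' < 1" "\<epsilon>' \<le> \<epsilon> / 2" using \<epsilon> by (auto simp: \<epsilon>'_def)
  obtain C1 where C1: "0 < C1" and "\<forall>\<epsilon>>0. \<exists>Ce>0. \<forall>n\<ge>1. measure M {\<omega> \<in> space M. norms_comparable \<Omega> H ip m C1 Ce n (\<lambda>i. X n i \<omega>)} \<ge> 1 - \<epsilon>"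
    using cmp by (auto simp: norm_comparison_property_def)
  then obtain Ce where Ce: "0 < Ce" and \<Xi>: "\<And>n. 1 \<le> n \<Longrightarrow> measure M {\<omega> \<in> space M. norms_comparable \<Omega> H ip m C1 Ce n (\<lambda>i. X n i \<omega>)} \<ge> 1 - \<epsilon>'"
    using \<epsilon>' by metis
  obtain cc where cc: "0 < cc" and ev: "\<forall>\<^sub>F n in sequentially. norm (real n powr (- 2 * m / ?d)) \<le> cc * norm (lam n)"
    using landau_o.bigE[OF rate] by blast
  define Qc where "Qc = 1 + C1 + Ce * sqrt cc"
  have Qc: "0 < Qc" using C1 Ce cc by (simp add: Qc_def add_pos_nonneg)
  \<comment> \<open>The exponents of \<open>1/\<lambda>\<close> in the bounds for the derivative and for point evaluation.\<close>
  define g where "g = (?d + 2 * ?l) / (4 * m)"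
  define g0 where "g0 = ?d / (4 * m)"
  have rates: "- (?d + 2 * ?l) / (4 * m) = - g" "- (?d + 2 * real (length ([] :: 'd list))) / (4 * m) = - g0"
    "- (?d + 2 * real (multi_order \<alpha>)) / (4 * m) = - g"
    unfolding g_def g0_def len by (simp_all only: minus_divide_left list.size of_nat_0 mult_zero_right add_0_right)
  have g: "0 \<le> g" "0 \<le> g0" using mpos by (auto simp: g_def g0_def)
  \<comment> \<open>The mesh \<open>\<lambda>\<^bsup>ka\<^esup>\<close> is such that its power \<open>\<beta>\<close> cancels the growth \<open>\<lambda>\<^bsup>-1/2-g0\<^esup>\<close> of the norm of the noise part.\<close>
  define ka where "ka = (1 / 2 + g0) / \<beta>"
  have ka: "0 < ka" "ka * \<beta> = 1 / 2 + g0" using CH g by (auto simp: ka_def)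
  \<comment> \<open>The two failure probabilities below are each made at most \<open>\<epsilon>/4\<close> by \<open>b\<close> and \<open>T\<close>.\<close>
  define b where "b = max 0 (ln (8 * A / \<epsilon>))"
  have b: "0 \<le> b" "2 * (A * exp (- b)) \<le> \<epsilon> / 4"
  proof -
    show "0 \<le> b" by (simp add: b_def)
    have "8 * A / \<epsilon> = exp (ln (8 * A / \<epsilon>))" using A \<epsilon> by simp
    also have "\<dots> \<le> exp b" by (simp add: b_def)
    finally show "2 * (A * exp (- b)) \<le> \<epsilon> / 4" using \<epsilon> by (simp add: exp_minus field_simps)
  qed
  define T where "T = 16 / \<epsilon>"
  have T: "0 < T" "4 / T = \<epsilon> / 4" using \<epsilon> by (auto simp: T_def)
  define kd where "kd = ka * ?d"
  have kd: "0 < kd" using ka by (simp add: kd_def)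
  \<comment> \<open>Chosen so that the subgaussian exponent at the threshold \<open>t\<close> is \<open>(kd + b) ln (e / \<lambda>)\<close>.\<close>
  define B where "B = sqrt (2 * (kd + b))"
  have B: "0 < B" "B\<^sup>2 = 2 * (kd + b)" using kd b by (auto simp: B_def)
  define B' where "B' = B * (C * Qc) + CH * sqrt T * (C0 * Qc)"
  define r where "r n = ?r n" for n
  show "\<exists>B. \<forall>\<^sub>F n in sequentially. 1 - \<epsilon> \<le> measure M {\<omega> \<in> space M. ?Z n \<omega> \<le> ereal (B * ?r n)}"
    unfolding r_def[symmetric]
  proof (intro exI[of _ B'])
    from ev eventually_ge_at_top[of 1]
    show "\<forall>\<^sub>F n in sequentially. 1 - \<epsilon> \<le> measure M {\<omega> \<in> space M. ?Z n \<omega> \<le> ereal (B' * r n)}"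
    proof eventually_elim
      case (elim n)
      define l where "l = lam n"
      have l: "0 < l" "l \<le> 1" using lam[OF elim(2)] by (auto simp: l_def)
      have rt: "real n powr (- 2 * m / ?d) \<le> cc * l" using elim(1) l by (simp add: l_def)
      define c where "c = real n * l"
      have n0: "0 < real n" using elim(2) by simp
      have c: "0 < c" using n0 l by (simp add: c_def)
      define L where "L = sqrt (ln (exp 1 / l))"
      have L2: "L\<^sup>2 = ln (exp 1 / l)" "1 \<le> L"
      proof -
        have "ln (exp 1 / l) = 1 - ln l" using l by (simp add: ln_div)
        moreover have "ln l \<le> 0" using l by simp
        ultimately show "L\<^sup>2 = ln (exp 1 / l)" "1 \<le> L" by (auto simp: L_def)
      qed
      define nh where "nh = real n powr (- 1 / 2)"
      have nh: "0 < nh" "nh\<^sup>2 = 1 / real n"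
        using n0 by (auto simp: nh_def power2_eq_square powr_add[symmetric] powr_minus_divide)
      have rn: "r n = \<tau> * nh * l powr (- g) * L" unfolding r_def rates by (simp add: nh_def l_def L_def)
      define S where "S = C * Qc * (nh * l powr (- g))"
      define S0 where "S0 = C0 * Qc * (nh * l powr (- g0))"
      have S: "0 < S" "0 < S0" using C C0 Qc nh l by (auto simp: S_def S0_def)
      define q where "q = real n * S0\<^sup>2"
      have q: "0 < q" using n0 S by (simp add: q_def)
      define t where "t = B * \<tau> * S * L"
      have t: "0 < t" using B \<tau> S L2 by (simp add: t_def)
      define \<delta> where "\<delta> = l powr ka"
      have \<delta>: "0 < \<delta>" "\<delta> \<le> 1" using l ka powr_mono2[of ka l 1] by (auto simp: \<delta>_def)
      obtain Z where Z: "finite Z" "Z \<subseteq> \<Omega>" and cardZ: "real (card Z) \<le> A * \<delta> powr (- ?d)"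
        and netZ: "\<And>x. x \<in> \<Omega> \<Longrightarrow> \<exists>z\<in>Z. norm (x - z) \<le> \<delta>"
        using net[OF \<delta>] by blast
      have cardZ': "real (card Z) \<le> A * l powr (- kd)" using cardZ by (simp add: \<delta>_def powr_powr kd_def)
      let ?xs = "\<lambda>\<omega> i. X n i \<omega>"
      let ?F = "\<lambda>\<omega> x. \<bar>\<Sum>i<n. e i \<omega> * iterated_partial \<Omega> is (ridge_kernel c (?xs \<omega>) n (X n i \<omega>)) x\<bar>"
      define good where "good = {\<omega> \<in> space M. \<forall>x\<in>\<Omega>. ?F \<omega> x \<le> B' * r n}"
      define bad where "bad = {\<omega> \<in> space M. stable_design is c n Z S q (?xs \<omega>) \<and>
        large_noise is c n Z t (T * (\<tau>\<^sup>2 * q)) (?xs \<omega>) (\<lambda>i. e i \<omega>)}"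
      define cmpe where "cmpe = {\<omega> \<in> space M. norms_comparable \<Omega> H ip m C1 Ce n (?xs \<omega>)}"
      have goodM: "good \<in> sets M" unfolding good_def by (rule fluctuation_event_measurable[OF rm c m])
      have badM: "bad \<in> sets M" unfolding bad_def
        by (rule large_noise_prob_random_design(1)[OF rm \<tau> sub m c Z S(1) q t T(1)])
      have "measure M bad \<le> real (card Z) * (2 * exp (- t\<^sup>2 / (2 * \<tau>\<^sup>2 * S\<^sup>2))) + 4 / T"
        unfolding bad_def by (rule large_noise_prob_random_design(2)[OF rm \<tau> sub m c Z S(1) q t T(1)])
      also have "- t\<^sup>2 / (2 * \<tau>\<^sup>2 * S\<^sup>2) = - ((kd + b) * ln (exp 1 / l))"
        using \<tau> S by (simp add: t_def power_mult_distrib B(2) L2(1))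
      also have "real (card Z) * (2 * exp (- ((kd + b) * ln (exp 1 / l)))) = 2 * (real (card Z) * exp (- ((kd + b) * ln (exp 1 / l))))" by simp
      also have "real (card Z) * exp (- ((kd + b) * ln (exp 1 / l))) \<le> A * exp (- kd) * exp (- b)"
        by (rule exp_tail_times_net_le[OF l less_imp_le[OF A] b(1) cardZ'])
      also have "A * exp (- kd) * exp (- b) \<le> A * exp (- b)"
        using A kd by simp
      also have "2 * (A * exp (- b)) + 4 / T \<le> \<epsilon> / 4 + \<epsilon> / 4" using b(2) T(2) by (intro add_mono) auto
      finally have badP: "measure M bad \<le> \<epsilon> / 2" by simp
      \<comment> \<open>Under the norm comparison the design is stable, so only large noise can fail.\<close>
      have cover: "cmpe \<subseteq> good \<union> bad"
      proof
        fix \<omega> assume w: "\<omega> \<in> cmpe"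
        then have wM: "\<omega> \<in> space M" and cw: "norms_comparable \<Omega> H ip m C1 Ce n (?xs \<omega>)" by (auto simp: cmpe_def)
        have xs: "\<And>i. i < n \<Longrightarrow> ?xs \<omega> i \<in> \<Omega>" using R.design_in wM by blast
        have bd: "\<bar>iterated_partial \<Omega> is v x\<bar> \<le> S * sqrt (ridge_form c (?xs \<omega>) n v v)" if "v \<in> H" "x \<in> \<Omega>" for v x
          using Cb[OF elim(2) l cw C1 Ce less_imp_le[OF cc] rt that] unfolding rates by (simp add: S_def Qc_def nh_def c_def)
        have bd0: "\<bar>v x\<bar> \<le> S0 * sqrt (ridge_form c (?xs \<omega>) n v v)" if "v \<in> H" "x \<in> \<Omega>" for v x
          using C0b[OF elim(2) l cw C1 Ce less_imp_le[OF cc] rt that] unfolding rates by (simp add: S0_def Qc_def nh_def c_def)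
        have stable: "stable_design is c n Z S q (?xs \<omega>)"
          unfolding stable_design_def
        proof
          show "\<forall>z\<in>Z. (\<Sum>i<n. (iterated_partial \<Omega> is (ridge_kernel c (?xs \<omega>) n (?xs \<omega> i)) z)\<^sup>2) \<le> S\<^sup>2"
          proof
            fix z assume "z \<in> Z"
            then have z: "z \<in> \<Omega>" using Z by blast
            show "(\<Sum>i<n. (iterated_partial \<Omega> is (ridge_kernel c (?xs \<omega>) n (?xs \<omega> i)) z)\<^sup>2) \<le> S\<^sup>2"
              by (rule functional_weights_bound[where T = "\<lambda>v. iterated_partial \<Omega> is v z", OF c xs])
                (use S bd z in \<open>auto intro: derivative_linear[OF m _ _ z]\<close>)
          qed
          have "(\<Sum>i<n. ridge_kernel c (?xs \<omega>) n (?xs \<omega> i) (?xs \<omega> i)) \<le> (\<Sum>i<n. S0\<^sup>2)"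
          proof (rule sum_mono)
            fix i assume "i \<in> {..<n}"
            then have y: "?xs \<omega> i \<in> \<Omega>" using xs by simp
            show "ridge_kernel c (?xs \<omega>) n (?xs \<omega> i) (?xs \<omega> i) \<le> S0\<^sup>2"
              by (rule ridge_kernel_diagonal_bound(2)[OF c xs y bd0[OF _ y]]) (use S in auto)
          qed
          then show "(\<Sum>i<n. ridge_kernel c (?xs \<omega>) n (?xs \<omega> i) (?xs \<omega> i)) \<le> q" by (simp add: q_def)
        qed
        show "\<omega> \<in> good \<union> bad"
        proof (cases "\<omega> \<in> bad")
          case False
          then have quiet: "\<not> large_noise is c n Z t (T * (\<tau>\<^sup>2 * q)) (?xs \<omega>) (\<lambda>i. e i \<omega>)"
            using stable wM by (simp add: bad_def)
          have "?F \<omega> x \<le> B' * r n" if x: "x \<in> \<Omega>" for x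
          proof -
            have "?F \<omega> x = \<bar>iterated_partial \<Omega> is (ridge_fit c (?xs \<omega>) n (\<lambda>i. e i \<omega>)) x\<bar>"
              by (simp only: derivative_ridge_fit[OF m c xs x])
            also have "\<dots> \<le> t + CH * \<delta> powr \<beta> * sqrt (T * (\<tau>\<^sup>2 * q) / c)"
              by (rule uniform_bound_from_net[OF m c xs hoelder CH Z(2) netZ quiet x])
            also have "\<delta> powr \<beta> = l powr (1 / 2 + g0)" by (simp add: \<delta>_def powr_powr ka(2))
            also have "sqrt (T * (\<tau>\<^sup>2 * q) / c) = sqrt T * (\<tau> * S0) * l powr (- (1 / 2))"
            proof -
              have "T * (\<tau>\<^sup>2 * q) / c = T * (\<tau> * S0)\<^sup>2 * inverse l"
                using n0 by (simp add: q_def c_def power_mult_distrib divide_inverse)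
              moreover have "sqrt (inverse l) = l powr (- (1 / 2))"
                using l by (simp add: powr_minus powr_half_sqrt real_sqrt_inverse)
              ultimately show ?thesis using \<tau> S by (simp add: real_sqrt_mult)
            qed
            also have "CH * l powr (1 / 2 + g0) * (sqrt T * (\<tau> * S0) * l powr (- (1 / 2)))
               = CH * sqrt T * (C0 * Qc) * (\<tau> * nh * (l powr (1 / 2 + g0) * l powr (- g0) * l powr (- (1 / 2))))"
              by (simp add: S0_def mult_ac)
            also have "l powr (1 / 2 + g0) * l powr (- g0) * l powr (- (1 / 2)) = 1"
              using l by (simp add: powr_add[symmetric])
            also have "t = B * (C * Qc) * (\<tau> * nh * (l powr (- g) * L))" by (simp add: t_def S_def mult_ac)
            also have "B * (C * Qc) * (\<tau> * nh * (l powr (- g) * L)) + CH * sqrt T * (C0 * Qc) * (\<tau> * nh * 1)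
               \<le> B * (C * Qc) * (\<tau> * nh * (l powr (- g) * L)) + CH * sqrt T * (C0 * Qc) * (\<tau> * nh * (l powr (- g) * L))"
            proof (intro add_left_mono mult_left_mono)
              have "1 \<le> l powr (- g)" using powr_mono2'[of "- g" l 1] l g by simp
              then have "1 * 1 \<le> l powr (- g) * L" using L2(2) by (intro mult_mono) auto
              then show "1 \<le> l powr (- g) * L" by simp
            qed (use CH T C0 Qc \<tau> nh in auto)
            also have "\<dots> = B' * r n"
              by (simp add: B'_def rn algebra_simps)
            finally show ?thesis .
          qed
          then show ?thesis using wM by (simp add: good_def)
        qed simp
      qed
      have "1 - \<epsilon>' \<le> measure M cmpe" unfolding cmpe_def by (rule \<Xi>[OF elim(2)])
      also have "measure M cmpe \<le> measure M (good \<union> bad)"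
        by (rule R.finite_measure_mono[OF cover]) (use goodM badM in simp)
      also have "\<dots> \<le> measure M good + measure M bad" by (rule measure_Un_le[OF goodM badM])
      finally have "1 - \<epsilon> \<le> measure M good" using badP \<epsilon>'(3) by linarith
      also have "good = {\<omega> \<in> space M. ?Z n \<omega> \<le> ereal (B' * r n)}"
        unfolding good_def c_def l_def
        by (intro Collect_cong conj_cong refl)
          (use krr_derivative_fluctuation[OF rm f _ elim(2) _ m \<alpha>] lam[OF elim(2)] in \<open>simp add: SUP_le_iff\<close>)
      finally show ?case .
    qed
  qed
qed

end

theorem theorem12:
  fixes \<Omega> :: "(real^'d) set"
    and K :: "real^'d \<Rightarrow> real^'d \<Rightarrow> real"
    and H :: "(real^'d \<Rightarrow> real) set"
    and ip :: "(real^'d \<Rightarrow> real) \<Rightarrow> (real^'d \<Rightarrow> real) \<Rightarrow> real"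
    and m :: real
    and \<alpha> :: "nat^'d"
  assumes "convex \<Omega>" and "compact \<Omega>" and "interior \<Omega> \<noteq> {}"
    and "rkhs \<Omega> K H ip"
    and "equals_sobolev m \<Omega> H ip"
    and "m > real CARD('d) / 2 + real (multi_order \<alpha>)"
  shows "\<exists>C>1. \<forall>(M :: 'w measure) X e \<sigma>2 f lam \<tau>.
           regression_model M \<Omega> X e \<sigma>2 \<longrightarrow>
           f \<in> H \<longrightarrow>
           norm_comparison_property M \<Omega> H ip m X \<longrightarrow>
           (\<forall>n\<ge>1. 0 < lam n \<and> lam n \<le> 1) \<longrightarrow>
           (\<lambda>n. real n powr (- 2 * m / real CARD('d))) \<in> O(lam) \<longrightarrow>
           \<tau> > 0 \<longrightarrow>
           subgaussian M (e 0) \<tau> \<longrightarrow>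
           bigO_in_prob M
             (\<lambda>n \<omega>. SUP x\<in>\<Omega>. ereal \<bar>krr_derivative \<Omega> H ip \<alpha> (lam n) n X f e \<omega> \<omega> x
                       - (LINT \<omega>'|M. krr_derivative \<Omega> H ip \<alpha> (lam n) n X f e \<omega> \<omega>' x)\<bar>)
             (\<lambda>n. \<tau> * real n powr (- 1 / 2)
                  * lam n powr (- (real CARD('d) + 2 * real (multi_order \<alpha>)) / (4 * m))
                  * sqrt (ln (C / lam n)))"
proof (intro exI[of _ "exp 1"] conjI allI impI)
  show "exp 1 > (1 :: real)" by simp
  fix M :: "'w measure" and X e and \<sigma>2 :: real and f and lam :: "nat \<Rightarrow> real" and \<tau> :: real
  assume model: "regression_model M \<Omega> X e \<sigma>2" "f \<in> H" "norm_comparison_property M \<Omega> H ip m X"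
    and lam: "\<forall>n\<ge>1. 0 < lam n \<and> lam n \<le> 1"
    and rate: "(\<lambda>n. real n powr (- 2 * m / real CARD('d))) \<in> O(lam)"
    and noise: "\<tau> > 0" "subgaussian M (e 0) \<tau>"
  have smooth: "m > real CARD('d) / 2" using assms(6) by linarith
  interpret sobolev_rkhs \<Omega> K H ip m
    using assms(1-5) smooth by (simp add: sobolev_rkhs_def sobolev_rkhs_axioms_def convex_body_def)
  show "bigO_in_prob M
     (\<lambda>n \<omega>. SUP x\<in>\<Omega>. ereal \<bar>krr_derivative \<Omega> H ip \<alpha> (lam n) n X f e \<omega> \<omega> x
               - (LINT \<omega>'|M. krr_derivative \<Omega> H ip \<alpha> (lam n) n X f e \<omega> \<omega>' x)\<bar>)
     (\<lambda>n. \<tau> * real n powr (- 1 / 2)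
          * lam n powr (- (real CARD('d) + 2 * real (multi_order \<alpha>)) / (4 * m))
          * sqrt (ln (exp 1 / lam n)))"
    by (rule krr_fluctuation_rate[OF assms(6) model _ rate noise]) (use lam in blast)
qed

end
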